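(* Let $\mathbb{K} = \mathbb{Q}(i)$ and, for distinct odd primes $p,q$, let $E_{pq}: y^2 = x^3 - 5pqx$. (i) If $p$ and $q$ are distinct odd primes with $p \equiv 33 \pmod{40}$ and $q \equiv 7 \pmod{40}$, then the rank of $E_{pq}$ over $\mathbb{K}$ is zero. (ii) If $p$ and $q$ are distinct odd primes and $k, l \in \mathbb{Z}$ are such that $p = 40k+33$, $q = 40l+27$ and $5k + 25l + 21$ is a perfect square, then the rank of $E_{pq}$ over $\mathbb{K}$ is $2$.
   Context: For an elliptic curve $E$ over a number field $\mathbb{K}$, the rank of $E$ over $\mathbb{K}$ is the integer $r \ge 0$ such that $E(\mathbb{K}) \cong \mathbb{Z}^r \oplus E(\mathbb{K})_{tors}$ (Mordell-Weil). A perfect square means the square of an integer. *)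

theory Defs
  imports
    Complex_Main
    "HOL-Computational_Algebra.Primes"
    "HOL-Number_Theory.Cong"
    "HOL-Algebra.Product_Groups"
begin

section \<open>Mordell--Weil groups of short Weierstrass curves\<close>

datatype 'a ec_point = Infinity | Affine 'a 'a

text \<open>
  Points with coordinates in a subset \<open>K\<close> (intended: a subfield) of the ambient field \<open>'a\<close>
  on the projective closure of \<open>y\<^sup>2 = x\<^sup>3 + A x + B\<close>.  For this to be an elliptic curve over
  \<open>K\<close>, one needs \<open>A, B \<in> K\<close> and \<open>4 A\<^sup>3 + 27 B\<^sup>2 \<noteq> 0\<close>; this is left to the user of the definition.
\<close>

definition ec_points :: "'a::field_char_0 set \<Rightarrow> 'a \<Rightarrow> 'a \<Rightarrow> 'a ec_point set" where
  "ec_points K A B =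
     insert Infinity {Affine x y | x y. x \<in> K \<and> y \<in> K \<and> y ^ 2 = x ^ 3 + A * x + B}"

text \<open>
  The chord-tangent law.  Two points of the curve with equal \<open>x\<close>-coordinate are equal or opposite,
  so in the tangent case both points coincide and \<open>y\<^sub>1 \<noteq> 0\<close>.  The coefficient \<open>B\<close> does not occur.
\<close>

fun ec_add :: "'a::field_char_0 \<Rightarrow> 'a ec_point \<Rightarrow> 'a ec_point \<Rightarrow> 'a ec_point" where
  "ec_add A Infinity Q = Q"
| "ec_add A P Infinity = P"
| "ec_add A (Affine x\<^sub>1 y\<^sub>1) (Affine x\<^sub>2 y\<^sub>2) =
     (if x\<^sub>1 = x\<^sub>2 \<and> y\<^sub>1 = - y\<^sub>2 then Infinity
      else
        let m = (if x\<^sub>1 = x\<^sub>2 then (3 * x\<^sub>1 ^ 2 + A) / (2 * y\<^sub>1) else (y\<^sub>2 - y\<^sub>1) / (x\<^sub>2 - x\<^sub>1));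
            x\<^sub>3 = m ^ 2 - x\<^sub>1 - x\<^sub>2
        in Affine x\<^sub>3 (m * (x\<^sub>1 - x\<^sub>3) - y\<^sub>1))"

definition ec_group :: "'a::field_char_0 set \<Rightarrow> 'a \<Rightarrow> 'a \<Rightarrow> 'a ec_point monoid" where
  "ec_group K A B = \<lparr>carrier = ec_points K A B, monoid.mult = ec_add A, one = Infinity\<rparr>"


section \<open>Rank\<close>

definition torsion_set :: "('a, 'b) monoid_scheme \<Rightarrow> 'a set" where
  "torsion_set G = {x \<in> carrier G. \<exists>n::nat. n > 0 \<and> x [^]\<^bsub>G\<^esub> n = \<one>\<^bsub>G\<^esub>}"

definition torsion_group :: "('a, 'b) monoid_scheme \<Rightarrow> ('a, 'b) monoid_scheme" where
  "torsion_group G = G\<lparr>carrier := torsion_set G\<rparr>"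

text \<open>
  \<open>has_rank G r\<close>: the abelian group \<open>G\<close> is isomorphic to \<open>\<int>\<^sup>r \<oplus> G\<^sub>t\<^sub>o\<^sub>r\<^sub>s\<close>.  A relation rather than a
  function, so that no value is assigned to groups which do not split in this way.
\<close>

definition has_rank :: "('a, 'b) monoid_scheme \<Rightarrow> nat \<Rightarrow> bool" where
  "has_rank G r \<longleftrightarrow> G \<cong> product_group {..<r} (\<lambda>_. integer_group) \<times>\<times> torsion_group G"


section \<open>The curves $y^2 = x^3 - 5pqx$ over the Gaussian rationals\<close>

definition gaussian_rationals :: "complex set" where
  "gaussian_rationals = {of_rat a + of_rat b * \<i> | a b. True}"

definition E_pq :: "nat \<Rightarrow> nat \<Rightarrow> complex ec_point monoid" where
  "E_pq p q = ec_group gaussian_rationals (- (5 * of_nat p * of_nat q)) 0"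

end

theory Submission
  imports Defs "HOL-Computational_Algebra.Computational_Algebra" "HOL-Number_Theory.Number_Theory"
begin

text \<open>
  With \<open>u = x / y\<close> the curve becomes the Jacobi quartic \<open>v\<^sup>2 = 1 + 20pq u\<^sup>4\<close>.  Since \<open>20pq\<close> is not
  a square in \<open>\<rat>(\<i>)\<close>, the denominators of its addition law never vanish, so a single rational
  formula makes it a group, and \<open>(u, v) \<mapsto> (\<i>u, v)\<close> makes this group a module over the Gaussian
  integers.

  The descent uses the isogeny \<open>1 + \<i>\<close>, whose cokernel is seen by the class of \<open>2(1 + v)\<close> modulo
  squares.  Quadratic characters at the Gaussian primes above \<open>5\<close> and \<open>p\<close>, together with a
  congruence modulo \<open>8\<close>, leave only the classes coming from torsion in case (i).  In case (ii) one
  further class remains; as \<open>p + 5q = 8m\<^sup>2\<close>, it is realised by the point with \<open>u = - (1 + \<i>) / (4m)\<close>.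

  Because the height grows quadratically under \<open>1 + \<i>\<close>, iterating the descent shows that a common
  nonzero multiple carries the whole group, up to torsion, into the cyclic submodule spanned by
  this point (by \<open>0\<close> in case (i)).  The group modulo torsion is then trivial, respectively
  isomorphic to an ideal of the Gaussian integers; ideals are principal, so it is isomorphic to \<open>\<int>\<^sup>2\<close>.
\<close>

section \<open>Gaussian integers\<close>

text \<open>The second coordinate is \<open>v = 2 x u^2 - 1\<close>, so
  \<open>2 (1 + v) = (2 u)^2 x\<close> carries the square class of \<open>x\<close> used in
  classical 2-descent, and \<open>u\<close> to \<open>i u\<close> is the complex multiplication
  sending \<open>(x, y)\<close> to \<open>(-x, i y)\<close>. The class is represented by a divisor
  \<open>D\<close> of \<open>A = -5pq\<close> with cofactor \<open>D'\<close>, and translation by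
  the point of order two exchanges \<open>D\<close> and \<open>D'\<close>. Since \<open>q\<close>
  stays prime in the Gaussian integers and divides \<open>A\<close> once, it can be kept out of one
  of the two; since \<open>-1\<close> is a square, only the units \<open>1\<close> and
  \<open>i\<close> matter up to squares. The odd primes leave, besides \<open>1\<close>, the class
  of \<open>i p\<close> or of \<open>5 i p\<close>, according as \<open>q\<close> is a nonresidue or
  a residue modulo \<open>p\<close>. For \<open>q = 7\<close> modulo 8 both fail modulo 8. For
  \<open>i p\<close>, up to sign, the homogeneous space is \<open>N^2 = i (p M^4 + 5 q e^4)\<close>;
  at \<open>M = e = 1\<close>, a value \<open>8 m^2\<close> of \<open>p + 5 q\<close> makes the
  right-hand side a square because \<open>8 i = (2 + 2 i)^2\<close>. This is the origin of the
  perfect square hypothesis. The rank is even because it is twice the rank over the Gaussian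
  integers.\<close>

datatype gint = Gint (gre: int) (gim: int)

lemma gint_eq_iff: "z = w \<longleftrightarrow> gre z = gre w \<and> gim z = gim w"
  by (cases z; cases w) simp

instantiation gint :: comm_ring_1
begin

definition "0 = Gint 0 0"
definition "1 = Gint 1 0"
definition "z + w = Gint (gre z + gre w) (gim z + gim w)"
definition "z - w = Gint (gre z - gre w) (gim z - gim w)"
definition "- z = Gint (- gre z) (- gim z)"
definition "z * w = Gint (gre z * gre w - gim z * gim w) (gre z * gim w + gim z * gre w)"

instance
  by standard
    (simp_all add: zero_gint_def one_gint_def plus_gint_def minus_gint_def uminus_gint_def
      times_gint_def algebra_simps)

end

lemma gint_sel [simp]:
  "gre 0 = 0" "gim 0 = 0" "gre 1 = 1" "gim 1 = 0"
  "gre (z + w) = gre z + gre w" "gim (z + w) = gim z + gim w"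
  "gre (z - w) = gre z - gre w" "gim (z - w) = gim z - gim w"
  "gre (- z) = - gre z" "gim (- z) = - gim z"
  "gre (z * w) = gre z * gre w - gim z * gim w" "gim (z * w) = gre z * gim w + gim z * gre w"
  by (simp_all add: zero_gint_def one_gint_def plus_gint_def minus_gint_def uminus_gint_def
      times_gint_def)

lemma gint_of_nat_sel [simp]: "gre (of_nat n) = int n" "gim (of_nat n) = 0"
  by (induction n) simp_all

lemma gint_of_int_sel [simp]: "gre (of_int n) = n" "gim (of_int n) = 0"
  by (cases n; simp)+

lemma gint_numeral_sel [simp]: "gre (numeral n) = numeral n" "gim (numeral n) = 0"
  using gint_of_nat_sel[of "numeral n"] by simp_all

definition gnorm :: "gint \<Rightarrow> nat" where
  "gnorm z = nat (gre z ^ 2 + gim z ^ 2)"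

definition gcnj :: "gint \<Rightarrow> gint" where
  "gcnj z = Gint (gre z) (- gim z)"

definition imag :: gint where
  "imag = Gint 0 1"

lemma gcnj_sel [simp]: "gre (gcnj z) = gre z" "gim (gcnj z) = - gim z"
  by (simp_all add: gcnj_def)

lemma imag_sel [simp]: "gre imag = 0" "gim imag = 1"
  by (simp_all add: imag_def)

lemma int_gnorm: "int (gnorm z) = gre z ^ 2 + gim z ^ 2"
  by (simp add: gnorm_def)

lemma of_nat_gnorm: "(of_nat (gnorm z) :: gint) = z * gcnj z"
  by (simp add: gint_eq_iff int_gnorm power2_eq_square)

lemma gnorm_0 [simp]: "gnorm 0 = 0" and gnorm_1 [simp]: "gnorm 1 = 1"
  by (simp_all add: gnorm_def)

lemma gnorm_eq_0_iff [simp]: "gnorm z = 0 \<longleftrightarrow> z = 0"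
proof -
  have "gnorm z = 0 \<longleftrightarrow> gre z ^ 2 + gim z ^ 2 = 0"
    using int_gnorm[of z] by linarith
  then show ?thesis
    by (simp add: gint_eq_iff sum_power2_eq_zero_iff)
qed

lemma gnorm_mult: "gnorm (z * w) = gnorm z * gnorm w"
proof -
  have "int (gnorm (z * w)) = int (gnorm z) * int (gnorm w)"
    unfolding int_gnorm by (simp add: power2_eq_square algebra_simps)
  then show ?thesis by (metis of_nat_eq_iff of_nat_mult)
qed

lemma gnorm_of_int: "gnorm (of_int n) = nat (n ^ 2)"
  by (simp add: gnorm_def)

instance gint :: idom
proof
  fix z w :: gint
  assume "z \<noteq> 0" "w \<noteq> 0"
  then have "gnorm (z * w) \<noteq> 0" by (simp add: gnorm_mult)
  then show "z * w \<noteq> 0" by auto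
qed

lemma imag_mult_imag [simp]: "imag * imag = - 1"
  by (simp add: gint_eq_iff)

lemma gnorm_1_iff: "gnorm z = 1 \<longleftrightarrow> z \<in> {1, - 1, imag, - imag}"
proof
  assume "gnorm z = 1"
  then have *: "gre z ^ 2 + gim z ^ 2 = 1" using int_gnorm[of z] by simp
  have "\<bar>gre z\<bar> \<le> 1" "\<bar>gim z\<bar> \<le> 1"
    using * by (metis abs_square_le_1 le_add_same_cancel1 zero_le_power2,
      metis abs_square_le_1 le_add_same_cancel2 zero_le_power2)
  then have "gre z \<in> {-1, 0, 1}" "gim z \<in> {-1, 0, 1}" by auto
  with * show "z \<in> {1, - 1, imag, - imag}" by (auto simp: gint_eq_iff)
qed (auto simp: gnorm_def)

lemma gint_dvd_1_iff: "z dvd 1 \<longleftrightarrow> gnorm z = 1" for z :: gint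
proof
  assume "z dvd 1"
  then obtain w where "1 = z * w" by (elim dvdE)
  then have "gnorm z * gnorm w = 1" by (metis gnorm_mult gnorm_1)
  then show "gnorm z = 1" by simp
next
  assume "gnorm z = 1"
  then show "z dvd 1" by (metis dvd_triv_left of_nat_1 of_nat_gnorm)
qed

text \<open>The integer nearest to \<open>n / m\<close>, computed as the floor of
  \<open>n / m + 1 / 2\<close>. For \<open>m = 0\<close> the value is 0, which makes division of a
  Gaussian integer by 0 return 0.\<close>

definition round_div :: "int \<Rightarrow> int \<Rightarrow> int" where
  "round_div n m = (2 * n + m) div (2 * m)"

lemma round_div_mult: "m \<noteq> 0 \<Longrightarrow> round_div (n * m) m = n"
proof -
  assume "m \<noteq> 0"
  have "round_div (n * m) m = (m + n * (2 * m)) div (2 * m)"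
    unfolding round_div_def by (simp add: algebra_simps)
  also have "\<dots> = n + m div (2 * m)"
    using \<open>m \<noteq> 0\<close> by (subst div_mult_self1) auto
  also have "m div (2 * m) = (1 * m) div (2 * m)" by simp
  also have "\<dots> = 0"
    using \<open>m \<noteq> 0\<close> by (subst div_mult_mult2) auto
  finally show ?thesis by simp
qed

lemma round_div_bound: "m > 0 \<Longrightarrow> 2 * \<bar>n - round_div n m * m\<bar> \<le> m"
proof -
  assume m: "m > 0"
  define q r where "q = round_div n m" and "r = (2 * n + m) mod (2 * m)"
  have "2 * n + m = q * (2 * m) + r"
    unfolding q_def r_def round_div_def by (rule div_mult_mod_eq [symmetric])
  then have "2 * (n - q * m) = r - m" by (simp add: algebra_simps)
  moreover have "0 \<le> r" "r < 2 * m" unfolding r_def using m by simp_all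
  ultimately show ?thesis unfolding q_def[symmetric] by linarith
qed

instantiation gint :: normalization_euclidean_semiring
begin

definition divide_gint :: "gint \<Rightarrow> gint \<Rightarrow> gint" where
  "z div w = Gint (round_div (gre (z * gcnj w)) (int (gnorm w)))
    (round_div (gim (z * gcnj w)) (int (gnorm w)))"

definition modulo_gint :: "gint \<Rightarrow> gint \<Rightarrow> gint" where
  "modulo_gint z w = z - (z div w) * w"

definition euclidean_size_gint :: "gint \<Rightarrow> nat" where
  "euclidean_size_gint = gnorm"

text \<open>The unit that rotates the first quadrant onto the quadrant of \<open>z\<close>. Each
  quadrant contains just one of its two bounding half-axes, so every nonzero \<open>z\<close> gets
  exactly one unit.\<close>

definition unit_factor_gint :: "gint \<Rightarrow> gint" where
  "unit_factor_gint z =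
    (if z = 0 then 0 else if gre z > 0 \<and> gim z \<ge> 0 then 1
     else if gre z \<le> 0 \<and> gim z > 0 then imag
     else if gre z < 0 \<and> gim z \<le> 0 then - 1 else - imag)"

definition normalize_gint :: "gint \<Rightarrow> gint" where
  "normalize_gint z = z * gcnj (unit_factor z)"

instance
proof
  fix a b :: gint
  show "b \<noteq> 0 \<Longrightarrow> a * b div b = a"
  proof -
    assume b: "b \<noteq> 0"
    have "a * b * gcnj b = a * of_nat (gnorm b)" by (simp add: of_nat_gnorm mult.assoc)
    then show ?thesis using b by (simp add: divide_gint_def round_div_mult gint_eq_iff)
  qed
  show "a div 0 = 0"
    by (simp add: divide_gint_def round_div_def zero_gint_def)
  show "(a div b) * b + a mod b = a" by (simp add: modulo_gint_def)
  show "euclidean_size (0 :: gint) = 0" by (simp add: euclidean_size_gint_def)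
  show "b \<noteq> 0 \<Longrightarrow> euclidean_size (a mod b) < euclidean_size b"
  proof -
    assume b: "b \<noteq> 0"
    define N where "N = int (gnorm b)"
    have N: "N > 0" using b unfolding N_def by (metis gnorm_eq_0_iff of_nat_0_less_iff not_gr_zero)
    \<comment> \<open>Rounding leaves both coordinates of this product at most \<open>N / 2\<close>
      in absolute value, so its norm, which is \<open>N\<close> times the norm of the remainder, is
      at most \<open>N^2 / 2\<close>.\<close>
    define c where "c = (a mod b) * gcnj b"
    have c: "c = a * gcnj b - (a div b) * of_nat (gnorm b)"
      by (simp add: c_def modulo_gint_def of_nat_gnorm algebra_simps)
    have "2 * \<bar>gre c\<bar> \<le> N" "2 * \<bar>gim c\<bar> \<le> N"
      using round_div_bound[OF N] by (simp_all add: c divide_gint_def N_def)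
    then have "(2 * \<bar>gre c\<bar>) ^ 2 \<le> N ^ 2" "(2 * \<bar>gim c\<bar>) ^ 2 \<le> N ^ 2"
      by (intro power_mono; simp)+
    then have "2 * int (gnorm c) \<le> N ^ 2"
      by (simp add: int_gnorm power_mult_distrib)
    also have "int (gnorm c) = int (gnorm (a mod b)) * N"
      unfolding c_def gnorm_mult N_def by (simp add: gnorm_def)
    finally have "2 * int (gnorm (a mod b)) * N \<le> N * N" by (simp add: power2_eq_square)
    then have "2 * int (gnorm (a mod b)) \<le> N" using N by simp
    then show ?thesis using N by (simp add: euclidean_size_gint_def N_def)
  qed
  show "b \<noteq> 0 \<Longrightarrow> euclidean_size a \<le> euclidean_size (a * b)"
  proof -
    assume "b \<noteq> 0"
    then have "1 \<le> gnorm b" by (metis gnorm_eq_0_iff less_one not_le)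
    then show ?thesis
      using mult_le_mono2[of 1 "gnorm b" "gnorm a"] by (simp add: euclidean_size_gint_def gnorm_mult)
  qed
  show "unit_factor (0 :: gint) = 0" by (simp add: unit_factor_gint_def)
  show "a dvd 1 \<Longrightarrow> unit_factor a = a"
    unfolding gint_dvd_1_iff gnorm_1_iff by (auto simp: unit_factor_gint_def gint_eq_iff)
  show "a \<noteq> 0 \<Longrightarrow> unit_factor a dvd 1"
    unfolding gint_dvd_1_iff gnorm_1_iff by (auto simp: unit_factor_gint_def)
  \<comment> \<open>Multiplication by \<open>i\<close> permutes the four half-open quadrants
    cyclically, and the other units are powers of \<open>i\<close>.\<close>
  have imag: "unit_factor (imag * z) = imag * unit_factor z" for z :: gint
  proof (cases z)
    case (Gint x y)
    have "x = 0 \<and> y = 0 \<or> x > 0 \<and> y \<ge> 0 \<or> x \<le> 0 \<and> y > 0 \<or> x < 0 \<and> y \<le> 0 \<or> x \<ge> 0 \<and> y < 0"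
      by linarith
    then show ?thesis
      by (elim disjE) (simp_all add: Gint unit_factor_gint_def gint_eq_iff)
  qed
  have "imag * (imag * z) = - z" for z :: gint by (simp add: gint_eq_iff)
  then have minus: "unit_factor (- z) = - unit_factor z" for z :: gint
    using imag[of z] imag[of "imag * z"] by simp
  show "a dvd 1 \<Longrightarrow> unit_factor (a * b) = a * unit_factor b"
    unfolding gint_dvd_1_iff gnorm_1_iff by (auto simp: imag minus)
  show "unit_factor a * normalize a = a"
    by (auto simp: unit_factor_gint_def normalize_gint_def gint_eq_iff)
  show "normalize (0 :: gint) = 0" by (simp add: normalize_gint_def)
qed

end

instantiation gint :: euclidean_ring_gcd
begin

definition gcd_gint :: "gint \<Rightarrow> gint \<Rightarrow> gint" where "gcd_gint = Euclidean_Algorithm.gcd"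
definition lcm_gint :: "gint \<Rightarrow> gint \<Rightarrow> gint" where "lcm_gint = Euclidean_Algorithm.lcm"
definition Gcd_gint :: "gint set \<Rightarrow> gint" where "Gcd_gint = Euclidean_Algorithm.Gcd"
definition Lcm_gint :: "gint set \<Rightarrow> gint" where "Lcm_gint = Euclidean_Algorithm.Lcm"

instance
  by standard (simp_all only: gcd_gint_def lcm_gint_def Gcd_gint_def Lcm_gint_def)

end

lemma is_unit_gint_cases:
  assumes "is_unit (z :: gint)"
  obtains "z = 1" | "z = - 1" | "z = imag" | "z = - imag"
  using assms unfolding gint_dvd_1_iff gnorm_1_iff by auto

instance gint :: ring_char_0
proof
  show "inj (of_nat :: nat \<Rightarrow> gint)"
    by (rule injI) (metis gint_of_nat_sel(1) of_nat_eq_iff)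
qed

lemma imag_nonzero [simp]: "imag \<noteq> 0"
  by (simp add: gint_eq_iff)

section \<open>The Jacobi quartic and its complete addition law\<close>

abbreviation K :: "complex set" where "K \<equiv> gaussian_rationals"

lemma K_I: "of_rat a + of_rat b * \<i> \<in> K"
  by (auto simp: gaussian_rationals_def)

lemma K_E:
  assumes "z \<in> K"
  obtains a b where "z = of_rat a + of_rat b * \<i>"
  using assms by (auto simp: gaussian_rationals_def)

lemma K_of_rat [simp]: "of_rat a \<in> K"
  using K_I[of a 0] by simp

lemma K_i [simp]: "\<i> \<in> K"
  using K_I[of 0 1] by simp

lemma K_0 [simp]: "0 \<in> K" and K_1 [simp]: "1 \<in> K"
  using K_of_rat[of 0] K_of_rat[of 1] by simp_all

lemma K_of_nat [simp]: "of_nat n \<in> K" and K_of_int [simp]: "of_int m \<in> K"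
  using K_of_rat[of "of_nat n"] K_of_rat[of "of_int m"] by simp_all

lemma K_numeral [simp]: "numeral n \<in> K"
  using K_of_nat[of "numeral n"] by simp

lemma K_add [simp]: "z \<in> K \<Longrightarrow> w \<in> K \<Longrightarrow> z + w \<in> K"
proof -
  assume "z \<in> K" "w \<in> K"
  then obtain a b a' b' where
    "z = of_rat a + of_rat b * \<i>" "w = of_rat a' + of_rat b' * \<i>" by (elim K_E)
  then have "z + w = of_rat (a + a') + of_rat (b + b') * \<i>"
    by (simp add: of_rat_add algebra_simps)
  then show ?thesis by (simp only: K_I)
qed

lemma K_mult [simp]: "z \<in> K \<Longrightarrow> w \<in> K \<Longrightarrow> z * w \<in> K"
proof -
  assume "z \<in> K" "w \<in> K"
  then obtain a b a' b' where
    zw: "z = of_rat a + of_rat b * \<i>" "w = of_rat a' + of_rat b' * \<i>" by (elim K_E)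
  have "z * w = of_rat (a * a' - b * b') + of_rat (a * b' + b * a') * \<i>"
    unfolding zw by (simp add: of_rat_add of_rat_diff of_rat_mult algebra_simps)
  then show ?thesis by (simp only: K_I)
qed

lemma K_minus [simp]: "z \<in> K \<Longrightarrow> - z \<in> K"
  using K_mult[OF K_of_int[of "- 1"], of z] by simp

lemma K_diff [simp]: "z \<in> K \<Longrightarrow> w \<in> K \<Longrightarrow> z - w \<in> K"
  using K_add[of z "- w"] by simp

lemma K_inverse [simp]: "z \<in> K \<Longrightarrow> inverse z \<in> K"
proof -
  assume "z \<in> K"
  then obtain a b where z: "z = of_rat a + of_rat b * \<i>" by (elim K_E)
  show ?thesis
  proof (cases "z = 0")
    case False
    define w :: complex where "w = of_rat a + of_rat (- b) * \<i>"
    have zw: "z * w = of_rat (a ^ 2 + b ^ 2)"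
      unfolding z w_def
      by (simp add: of_rat_add of_rat_mult of_rat_minus power2_eq_square algebra_simps)
    have "a ^ 2 + b ^ 2 \<noteq> 0"
      using False by (auto simp: z sum_power2_eq_zero_iff)
    then have "z * w \<noteq> 0" by (simp add: zw)
    then have "inverse z = w * inverse (z * w)" by (simp add: field_simps)
    also have "\<dots> = w * of_rat (inverse (a ^ 2 + b ^ 2))" by (simp add: zw of_rat_inverse)
    finally show ?thesis by (simp add: w_def K_I del: of_rat_inverse)
  qed simp
qed

lemma K_divide [simp]: "z \<in> K \<Longrightarrow> w \<in> K \<Longrightarrow> z / w \<in> K"
  by (simp add: divide_inverse)

lemma K_power [simp]: "z \<in> K \<Longrightarrow> z ^ n \<in> K"
  by (induction n) simp_all

definition quartic :: "complex \<Rightarrow> (complex \<times> complex) set" where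
  "quartic d = {(u, v). u \<in> K \<and> v \<in> K \<and> v ^ 2 = 1 + d * u ^ 4}"

fun qadd :: "complex \<Rightarrow> complex \<times> complex \<Rightarrow> complex \<times> complex \<Rightarrow> complex \<times> complex" where
  "qadd d (u1, v1) (u2, v2) =
    ((u1 * v2 + u2 * v1) / (1 - d * u1 ^ 2 * u2 ^ 2),
     ((1 + d * u1 ^ 2 * u2 ^ 2) * v1 * v2 + 2 * d * u1 * u2 * (u1 ^ 2 + u2 ^ 2))
       / (1 - d * u1 ^ 2 * u2 ^ 2) ^ 2)"

text \<open>Rewrite rules that eliminate \<open>v^2\<close>: the first catches a final
  \<open>v * v\<close>, the second one inside a longer product. With them, identities on the curve
  are decided by polynomial normal forms that are linear in each \<open>v\<close>.\<close>

lemma quartic_sq: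
  fixes d u v x :: complex
  assumes "v ^ 2 = 1 + d * u ^ 4"
  shows "v * v = 1 + d * (u * (u * (u * u)))" "v * (v * x) = (1 + d * (u * (u * (u * u)))) * x"
proof -
  show *: "v * v = 1 + d * (u * (u * (u * u)))"
    using assms by (simp add: eval_nat_numeral)
  show "v * (v * x) = (1 + d * (u * (u * (u * u)))) * x"
    using * by (simp flip: mult.assoc)
qed

lemmas quartic_simps = eval_nat_numeral algebra_simps

lemma quartic_closed_identity:
  fixes d u1 v1 u2 v2 :: complex
  assumes "v1 ^ 2 = 1 + d * u1 ^ 4" "v2 ^ 2 = 1 + d * u2 ^ 4"
  shows "((1 + d * u1 ^ 2 * u2 ^ 2) * v1 * v2 + 2 * d * u1 * u2 * (u1 ^ 2 + u2 ^ 2)) ^ 2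
    = (1 - d * u1 ^ 2 * u2 ^ 2) ^ 4 + d * (u1 * v2 + u2 * v1) ^ 4"
  by (simp add: quartic_simps quartic_sq[OF assms(1)] quartic_sq[OF assms(2)])

text \<open>With \<open>P1 + P2 = (U / D, V / D^2)\<close>, these are the coordinates of
  \<open>(P1 + P2) - P2\<close> after clearing denominators.\<close>

lemma quartic_cancel_identities:
  fixes d u1 v1 u2 v2 :: complex
  assumes "v1 ^ 2 = 1 + d * u1 ^ 4" "v2 ^ 2 = 1 + d * u2 ^ 4"
  defines "D \<equiv> 1 - d * u1 ^ 2 * u2 ^ 2" and "U \<equiv> u1 * v2 + u2 * v1"
    and "V \<equiv> (1 + d * u1 ^ 2 * u2 ^ 2) * v1 * v2 + 2 * d * u1 * u2 * (u1 ^ 2 + u2 ^ 2)"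
  shows "U * D * v2 - u2 * V = u1 * (D ^ 2 - d * U ^ 2 * u2 ^ 2)"
    and "V * v2 * (D ^ 2 + d * U ^ 2 * u2 ^ 2) - 2 * d * U * u2 * D * (U ^ 2 + u2 ^ 2 * D ^ 2)
      = v1 * (D ^ 2 - d * U ^ 2 * u2 ^ 2) ^ 2"
  unfolding D_def U_def V_def
  by (simp_all add: quartic_simps quartic_sq[OF assms(1)] quartic_sq[OF assms(2)])

text \<open>Associativity is proved by computing the \<open>u\<close>-coordinate of a threefold sum in a form symmetric in
  the three summands; the cofactor in the second identity below belongs to \<open>P\<^sub>1 - P\<^sub>2\<close>.\<close>

definition triple_num :: "complex \<Rightarrow> complex \<Rightarrow> complex \<Rightarrow> complex \<Rightarrow> complex \<Rightarrow> complex \<Rightarrow> complex \<Rightarrow> complex" where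
  "triple_num d u1 v1 u2 v2 u3 v3 =
     u1 * v2 * v3 * (1 + d * (u2 ^ 2 * u3 ^ 2 - u1 ^ 2 * u2 ^ 2 - u1 ^ 2 * u3 ^ 2))
   + u2 * v1 * v3 * (1 + d * (u1 ^ 2 * u3 ^ 2 - u1 ^ 2 * u2 ^ 2 - u2 ^ 2 * u3 ^ 2))
   + u3 * v1 * v2 * (1 + d * (u1 ^ 2 * u2 ^ 2 - u1 ^ 2 * u3 ^ 2 - u2 ^ 2 * u3 ^ 2))
   + 2 * d * u1 * u2 * u3 * (u1 ^ 2 + u2 ^ 2 + u3 ^ 2 + d * u1 ^ 2 * u2 ^ 2 * u3 ^ 2)"

definition triple_den :: "complex \<Rightarrow> complex \<Rightarrow> complex \<Rightarrow> complex \<Rightarrow> complex" where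
  "triple_den d u1 u2 u3 =
     1 - 2 * d * (u1 ^ 2 * u2 ^ 2 + u1 ^ 2 * u3 ^ 2 + u2 ^ 2 * u3 ^ 2)
   + d ^ 2 * (u1 ^ 4 * u2 ^ 4 + u1 ^ 4 * u3 ^ 4 + u2 ^ 4 * u3 ^ 4)
   - 2 * d ^ 2 * u1 ^ 2 * u2 ^ 2 * u3 ^ 2 * (u1 ^ 2 + u2 ^ 2 + u3 ^ 2)"

lemma triple_identities:
  fixes d u1 v1 u2 v2 u3 v3 :: complex
  assumes "v1 ^ 2 = 1 + d * u1 ^ 4" "v2 ^ 2 = 1 + d * u2 ^ 4" "v3 ^ 2 = 1 + d * u3 ^ 4"
  defines "D \<equiv> 1 - d * u1 ^ 2 * u2 ^ 2" and "U \<equiv> u1 * v2 + u2 * v1"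
    and "V \<equiv> (1 + d * u1 ^ 2 * u2 ^ 2) * v1 * v2 + 2 * d * u1 * u2 * (u1 ^ 2 + u2 ^ 2)"
  shows "(U * D * v3 + u3 * V) * triple_den d u1 u2 u3
      = triple_num d u1 v1 u2 v2 u3 v3 * (D ^ 2 - d * U ^ 2 * u3 ^ 2)"
    and "(D ^ 2 - d * U ^ 2 * u3 ^ 2) * (D ^ 2 - d * (u1 * v2 - u2 * v1) ^ 2 * u3 ^ 2)
      = D ^ 2 * triple_den d u1 u2 u3"
  unfolding D_def U_def V_def triple_den_def triple_num_def
  by (simp_all add: quartic_simps quartic_sq[OF assms(1)] quartic_sq[OF assms(2)] quartic_sq[OF assms(3)])

text \<open>Cleared form of the additivity of \<open>1 + i\<close>. The left-hand sides come from
  the image of \<open>P1 + P2\<close>, the right-hand sides from the sum of the images, whose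
  addition denominator is \<open>G / (v1^2 v2^2)\<close>; the common factor \<open>1 + i\<close> of
  the first coordinates has been dropped.\<close>

lemma quartic_theta_identities:
  fixes d u1 v1 u2 v2 :: complex
  assumes "v1 ^ 2 = 1 + d * u1 ^ 4" "v2 ^ 2 = 1 + d * u2 ^ 4"
  defines "D \<equiv> 1 - d * u1 ^ 2 * u2 ^ 2" and "U \<equiv> u1 * v2 + u2 * v1"
    and "V \<equiv> (1 + d * u1 ^ 2 * u2 ^ 2) * v1 * v2 + 2 * d * u1 * u2 * (u1 ^ 2 + u2 ^ 2)"
    and "G \<equiv> v1 ^ 2 * v2 ^ 2 + 4 * d * u1 ^ 2 * u2 ^ 2"
  shows "U * D * G = V * (u1 * v1 * (2 - v2 ^ 2) + u2 * v2 * (2 - v1 ^ 2))"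
    and "(2 * D ^ 4 - V ^ 2) * G ^ 2
      = V ^ 2 * ((v1 ^ 2 * v2 ^ 2 - 4 * d * u1 ^ 2 * u2 ^ 2) * (2 - v1 ^ 2) * (2 - v2 ^ 2)
          - 8 * d * u1 * u2 * v1 * v2 * (u1 ^ 2 * v2 ^ 2 + u2 ^ 2 * v1 ^ 2))"
  unfolding D_def U_def V_def G_def
  by (simp_all add: quartic_simps quartic_sq[OF assms(1)] quartic_sq[OF assms(2)])

text \<open>An explicit square root showing that the class of \<open>2 (1 + v)\<close> modulo
  squares is multiplicative: \<open>1 + V / D^2\<close> belongs to the sum of the two
  points.\<close>

lemma quartic_alpha_identity:
  fixes d u1 v1 u2 v2 :: complex
  assumes "v1 ^ 2 = 1 + d * u1 ^ 4" "v2 ^ 2 = 1 + d * u2 ^ 4"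
  defines "D \<equiv> 1 - d * u1 ^ 2 * u2 ^ 2"
    and "V \<equiv> (1 + d * u1 ^ 2 * u2 ^ 2) * v1 * v2 + 2 * d * u1 * u2 * (u1 ^ 2 + u2 ^ 2)"
  shows "2 * (1 + v1) * (1 + v2) * (D ^ 2 + V)
    = ((1 + v1) * (1 + v2) + d * u1 * u2 * (u2 ^ 2 * (1 + v1) + u1 ^ 2 * (1 + v2) - u1 * u2)) ^ 2"
  unfolding D_def V_def
  by (simp_all add: quartic_simps quartic_sq[OF assms(1)] quartic_sq[OF assms(2)])

lemma qadd_fractions:
  fixes d D U V x w :: complex
  assumes "D \<noteq> 0"
  shows "qadd d (U / D, V / D ^ 2) (x, w) =
    ((U * D * w + x * V) / (D ^ 2 - d * U ^ 2 * x ^ 2),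
     (V * w * (D ^ 2 + d * U ^ 2 * x ^ 2) + 2 * d * U * x * D * (U ^ 2 + x ^ 2 * D ^ 2))
       / (D ^ 2 - d * U ^ 2 * x ^ 2) ^ 2)"
proof -
  have 1: "U / D * w + x * (V / D ^ 2) = (U * D * w + x * V) / D ^ 2"
    using assms by (simp add: field_simps power2_eq_square)
  have 2: "1 - d * (U / D) ^ 2 * x ^ 2 = (D ^ 2 - d * U ^ 2 * x ^ 2) / D ^ 2"
    using assms by (simp add: field_simps power2_eq_square)
  have 3: "(1 + d * (U / D) ^ 2 * x ^ 2) * (V / D ^ 2) * w
      + 2 * d * (U / D) * x * ((U / D) ^ 2 + x ^ 2)
    = (V * w * (D ^ 2 + d * U ^ 2 * x ^ 2) + 2 * d * U * x * D * (U ^ 2 + x ^ 2 * D ^ 2)) / D ^ 4"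
    using assms by (simp add: field_simps eval_nat_numeral)
  show ?thesis
    unfolding qadd.simps 1 2 3 using assms by (simp add: power_divide)
qed

section \<open>The group law on the quartic\<close>

locale jacobi_quartic =
  fixes d :: complex
  assumes d_K [simp]: "d \<in> K" and d_nonsquare: "k \<in> K \<Longrightarrow> k ^ 2 \<noteq> d"
begin

lemma quarticD:
  "(u, v) \<in> quartic d \<Longrightarrow> u \<in> K" "(u, v) \<in> quartic d \<Longrightarrow> v \<in> K"
  "(u, v) \<in> quartic d \<Longrightarrow> v ^ 2 = 1 + d * u ^ 4"
  by (simp_all add: quartic_def)

lemma quarticI: "u \<in> K \<Longrightarrow> v \<in> K \<Longrightarrow> v ^ 2 = 1 + d * u ^ 4 \<Longrightarrow> (u, v) \<in> quartic d"
  by (simp add: quartic_def)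

lemma d_nonzero: "d \<noteq> 0"
  using d_nonsquare[of 0] by simp

lemma den_nonzero:
  assumes "x \<in> K" "y \<in> K"
  shows "1 - d * x ^ 2 * y ^ 2 \<noteq> 0"
proof
  assume "1 - d * x ^ 2 * y ^ 2 = 0"
  then have *: "d * (x * y) ^ 2 = 1" by (simp add: power_mult_distrib algebra_simps)
  then have "x * y \<noteq> 0" by auto
  then have "(1 / (x * y)) ^ 2 = d" using * by (simp add: field_simps)
  then show False using d_nonsquare[of "1 / (x * y)"] assms by simp
qed

text \<open>\<open>v^2\<close> is itself an addition denominator, that of \<open>(u, v)\<close> and
  \<open>(i u, v)\<close>.\<close>

lemma v_nonzero:
  assumes "(u, v) \<in> quartic d"
  shows "v \<noteq> 0"
proof
  assume "v = 0"
  have "1 - d * u ^ 2 * (\<i> * u) ^ 2 = 1 + d * u ^ 4"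
    by (simp add: power_mult_distrib eval_nat_numeral algebra_simps)
  also have "\<dots> = 0" using quarticD(3)[OF assms] \<open>v = 0\<close> by simp
  finally show False using den_nonzero[of u "\<i> * u"] quarticD(1)[OF assms] by simp
qed

lemma neg_closed: "(u, v) \<in> quartic d \<Longrightarrow> (- u, v) \<in> quartic d"
  by (simp add: quartic_def)

lemma rot_closed: "(u, v) \<in> quartic d \<Longrightarrow> (\<i> * u, v) \<in> quartic d"
  by (simp add: quartic_def power_mult_distrib)

lemma zero_closed: "(0, 1) \<in> quartic d" and two_torsion_closed: "(0, - 1) \<in> quartic d"
  by (simp_all add: quartic_def)

lemma qadd_closed:
  assumes "P \<in> quartic d" "Q \<in> quartic d"
  shows "qadd d P Q \<in> quartic d"
proof -
  obtain u1 v1 u2 v2 where PQ: "P = (u1, v1)" "Q = (u2, v2)" by (cases P; cases Q)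
  note facts = quarticD[OF assms(1)[unfolded PQ]] quarticD[OF assms(2)[unfolded PQ]]
  define D where "D = 1 - d * u1 ^ 2 * u2 ^ 2"
  define U where "U = u1 * v2 + u2 * v1"
  define V where "V = (1 + d * u1 ^ 2 * u2 ^ 2) * v1 * v2 + 2 * d * u1 * u2 * (u1 ^ 2 + u2 ^ 2)"
  have D: "D \<noteq> 0" unfolding D_def using den_nonzero facts by blast
  have "V ^ 2 = D ^ 4 + d * U ^ 4"
    unfolding V_def D_def U_def by (rule quartic_closed_identity[OF facts(3,6)])
  then have "(V / D ^ 2) ^ 2 = 1 + d * (U / D) ^ 4"
    using D by (simp add: field_simps flip: power_mult)
  moreover have "U \<in> K" "V \<in> K" "D \<in> K" unfolding U_def V_def D_def using facts by simp_all
  ultimately show ?thesis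
    unfolding PQ qadd.simps by (intro quarticI) (simp_all flip: U_def V_def D_def)
qed

lemma qadd_commute: "qadd d P Q = qadd d Q P"
  by (cases P; cases Q) (simp add: algebra_simps)

lemma qadd_zero: "qadd d (0, 1) P = P"
  by (cases P) simp

lemma qadd_neg:
  assumes "(u, v) \<in> quartic d"
  shows "qadd d (- u, v) (u, v) = (0, 1)"
proof -
  note facts = quarticD[OF assms]
  have "(1 + d * u ^ 2 * u ^ 2) * v * v + 2 * d * (- u) * u * (u ^ 2 + u ^ 2)
      = (1 - d * u ^ 2 * u ^ 2) ^ 2"
    by (simp add: quartic_simps quartic_sq[OF facts(3)])
  then show ?thesis using den_nonzero[OF facts(1,1)] by simp
qed

text \<open>Obtained by direct computation because associativity is not yet available; the proof of
  associativity relies on this cancellation.\<close>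

lemma qadd_cancel:
  assumes "P \<in> quartic d" "(u, v) \<in> quartic d"
  shows "qadd d (qadd d P (u, v)) (- u, v) = P"
proof -
  obtain u1 v1 where P: "P = (u1, v1)" by (cases P)
  note facts = quarticD[OF assms(1)[unfolded P]] quarticD[OF assms(2)]
  define D where "D = 1 - d * u1 ^ 2 * u ^ 2"
  define U where "U = u1 * v + u * v1"
  define V where "V = (1 + d * u1 ^ 2 * u ^ 2) * v1 * v + 2 * d * u1 * u * (u1 ^ 2 + u ^ 2)"
  have D: "D \<noteq> 0" unfolding D_def using den_nonzero facts by blast
  have UD: "U / D \<in> K" unfolding U_def D_def using facts by simp
  have E: "D ^ 2 - d * U ^ 2 * u ^ 2 \<noteq> 0"
    using den_nonzero[OF UD facts(4)] D by (auto simp: field_simps)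
  have *: "qadd d P (u, v) = (U / D, V / D ^ 2)"
    by (simp add: P U_def V_def D_def)
  have 1: "U * D * v - u * V = u1 * (D ^ 2 - d * U ^ 2 * u ^ 2)"
    and 2: "V * v * (D ^ 2 + d * U ^ 2 * u ^ 2) - 2 * d * U * u * D * (U ^ 2 + u ^ 2 * D ^ 2)
      = v1 * (D ^ 2 - d * U ^ 2 * u ^ 2) ^ 2"
    unfolding D_def U_def V_def by (fact quartic_cancel_identities[OF facts(3,6)])+
  show ?thesis
    unfolding * qadd_fractions[OF D] using 1 2 E by (simp add: P)
qed

definition qtheta :: "complex \<times> complex \<Rightarrow> complex \<times> complex" where
  "qtheta P = qadd d P (\<i> * fst P, snd P)"

text \<open>When \<open>(u, v)\<close> and \<open>(i u, v)\<close> are added, the cross term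
  contains \<open>u^2 + (i u)^2 = 0\<close> and the denominator is \<open>v^2\<close>. The resulting
  formula is simple enough to be inverted.\<close>

lemma qtheta_eq:
  assumes "(u, v) \<in> quartic d"
  shows "qtheta (u, v) = ((1 + \<i>) * u / v, (2 - v ^ 2) / v ^ 2)"
proof -
  note facts = quarticD[OF assms]
  have 1: "1 - d * u ^ 2 * (\<i> * u) ^ 2 = v ^ 2"
    by (simp add: power_mult_distrib quartic_simps quartic_sq[OF facts(3)])
  have 2: "(1 + d * u ^ 2 * (\<i> * u) ^ 2) * v * v + 2 * d * u * (\<i> * u) * (u ^ 2 + (\<i> * u) ^ 2)
    = (2 - v ^ 2) * v ^ 2"
    by (simp add: power_mult_distrib quartic_simps quartic_sq[OF facts(3)])
  show ?thesis
    unfolding qtheta_def qadd.simps fst_conv snd_conv 1 2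
    using v_nonzero[OF assms] by (simp add: field_simps power2_eq_square)
qed

lemma qtheta_closed: "P \<in> quartic d \<Longrightarrow> qtheta P \<in> quartic d"
  unfolding qtheta_def by (cases P) (simp add: qadd_closed rot_closed del: qadd.simps)

text \<open>Checked on coordinates: it is an ingredient of associativity and so cannot be deduced
  from the group laws.\<close>

lemma qtheta_qadd:
  assumes "P \<in> quartic d" "Q \<in> quartic d"
  shows "qtheta (qadd d P Q) = qadd d (qtheta P) (qtheta Q)"
proof -
  obtain u1 v1 u2 v2 where PQ: "P = (u1, v1)" "Q = (u2, v2)" by (cases P; cases Q)
  note facts = quarticD[OF assms(1)[unfolded PQ]] quarticD[OF assms(2)[unfolded PQ]]
  note nz = v_nonzero[OF assms(1)[unfolded PQ]] v_nonzero[OF assms(2)[unfolded PQ]]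
  define D where "D = 1 - d * u1 ^ 2 * u2 ^ 2"
  define U where "U = u1 * v2 + u2 * v1"
  define V where "V = (1 + d * u1 ^ 2 * u2 ^ 2) * v1 * v2 + 2 * d * u1 * u2 * (u1 ^ 2 + u2 ^ 2)"
  define G where "G = v1 ^ 2 * v2 ^ 2 + 4 * d * u1 ^ 2 * u2 ^ 2"
  define A where "A = u1 * v1 * (2 - v2 ^ 2) + u2 * v2 * (2 - v1 ^ 2)"
  define B where "B = (v1 ^ 2 * v2 ^ 2 - 4 * d * u1 ^ 2 * u2 ^ 2) * (2 - v1 ^ 2) * (2 - v2 ^ 2)
          - 8 * d * u1 * u2 * v1 * v2 * (u1 ^ 2 * v2 ^ 2 + u2 ^ 2 * v1 ^ 2)"
  have D: "D \<noteq> 0" unfolding D_def using den_nonzero facts by blast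
  have sum: "qadd d P Q = (U / D, V / D ^ 2)"
    by (simp add: PQ U_def V_def D_def)
  have sumC: "(U / D, V / D ^ 2) \<in> quartic d"
    using qadd_closed[OF assms] by (simp add: sum)
  then have V: "V \<noteq> 0" using v_nonzero by fastforce
  have id1: "U * D * G = V * A" and id2: "(2 * D ^ 4 - V ^ 2) * G ^ 2 = V ^ 2 * B"
    unfolding U_def V_def D_def G_def A_def B_def
    by (fact quartic_theta_identities[OF facts(3,6)])+
  have i2: "(1 + \<i>) ^ 2 = 2 * \<i>" by (simp add: power2_eq_square algebra_simps)
  define x1 where "x1 = (1 + \<i>) * u1 / v1"
  define x2 where "x2 = (1 + \<i>) * u2 / v2"
  have x12: "x1 * x2 = 2 * \<i> * u1 * u2 / (v1 * v2)"
    using i2 by (simp add: x1_def x2_def power2_eq_square)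
  have sq: "x1 ^ 2 = 2 * \<i> * u1 ^ 2 / v1 ^ 2" "x2 ^ 2 = 2 * \<i> * u2 ^ 2 / v2 ^ 2"
    using i2 by (simp_all add: x1_def x2_def power_divide power_mult_distrib)
  have den: "1 - d * x1 ^ 2 * x2 ^ 2 = G / (v1 ^ 2 * v2 ^ 2)"
    using nz by (simp add: sq G_def field_simps)
  have "x1 \<in> K" "x2 \<in> K" unfolding x1_def x2_def using facts by simp_all
  then have G: "G \<noteq> 0" using den_nonzero[of x1 x2] den by auto
  define m1 m2 where "m1 = 2 - v1 ^ 2" and "m2 = 2 - v2 ^ 2"
  define M where "M = u1 ^ 2 * v2 ^ 2 + u2 ^ 2 * v1 ^ 2"
  define N where "N = v1 ^ 2 * v2 ^ 2 - 4 * d * u1 ^ 2 * u2 ^ 2"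
  have "x1 * (m2 / v2 ^ 2) = (1 + \<i>) * (u1 * v1 * m2) / (v1 ^ 2 * v2 ^ 2)"
    "x2 * (m1 / v1 ^ 2) = (1 + \<i>) * (u2 * v2 * m1) / (v1 ^ 2 * v2 ^ 2)"
    using nz by (simp_all add: x1_def x2_def power2_eq_square ac_simps)
  then have num1: "x1 * (m2 / v2 ^ 2) + x2 * (m1 / v1 ^ 2) = (1 + \<i>) * A / (v1 ^ 2 * v2 ^ 2)"
    by (simp add: A_def m1_def m2_def flip: add_divide_distrib distrib_left)
  have "1 + d * x1 ^ 2 * x2 ^ 2 = N / (v1 ^ 2 * v2 ^ 2)"
    using nz by (simp add: sq N_def field_simps)
  then have "(1 + d * x1 ^ 2 * x2 ^ 2) * (m1 / v1 ^ 2) * (m2 / v2 ^ 2) = N * m1 * m2 / (v1 ^ 4 * v2 ^ 4)"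
    by (simp add: eval_nat_numeral ac_simps)
  moreover have "x1 ^ 2 + x2 ^ 2 = 2 * \<i> * M / (v1 ^ 2 * v2 ^ 2)"
    using nz by (simp add: sq M_def divide_simps) (simp add: algebra_simps)
  then have "2 * d * (x1 * x2) * (x1 ^ 2 + x2 ^ 2) = - (8 * d * u1 * u2 * v1 * v2 * M) / (v1 ^ 4 * v2 ^ 4)"
    unfolding x12 using nz by (simp add: eval_nat_numeral ac_simps)
  ultimately have num2: "(1 + d * x1 ^ 2 * x2 ^ 2) * (m1 / v1 ^ 2) * (m2 / v2 ^ 2)
      + 2 * d * x1 * x2 * (x1 ^ 2 + x2 ^ 2) = B / (v1 ^ 4 * v2 ^ 4)"
    by (simp add: B_def N_def m1_def m2_def M_def diff_divide_distrib mult.assoc)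
  have "qadd d (qtheta P) (qtheta Q) = ((1 + \<i>) * A / G, B / G ^ 2)"
    unfolding PQ qtheta_eq[OF assms(1)[unfolded PQ]] qtheta_eq[OF assms(2)[unfolded PQ]] qadd.simps
    unfolding x1_def[symmetric] x2_def[symmetric] m1_def[symmetric] m2_def[symmetric] num1 num2 den
    using nz G by (simp add: power_divide power_mult_distrib flip: power_mult)
  moreover have "(1 + \<i>) * (U / D) / (V / D ^ 2) = (1 + \<i>) * (U * D) / V"
    using D V by (simp add: power2_eq_square)
  moreover have "(V / D ^ 2) ^ 2 = V ^ 2 / D ^ 4"
    by (simp add: power_divide flip: power_mult)
  then have "(2 - (V / D ^ 2) ^ 2) / (V / D ^ 2) ^ 2 = (2 * D ^ 4 - V ^ 2) / V ^ 2"
    using D V by (simp add: divide_simps)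
  ultimately have "qtheta (qadd d P Q) = ((1 + \<i>) * (U * D) / V, (2 * D ^ 4 - V ^ 2) / V ^ 2)"
    "qadd d (qtheta P) (qtheta Q) = ((1 + \<i>) * A / G, B / G ^ 2)"
    unfolding sum qtheta_eq[OF sumC] by simp_all
  moreover have "(1 + \<i>) * (U * D) / V = (1 + \<i>) * A / G"
    using id1 V G by (simp add: field_simps)
  moreover have "(2 * D ^ 4 - V ^ 2) / V ^ 2 = B / G ^ 2"
    using id2 V G by (simp add: field_simps)
  ultimately show ?thesis by simp
qed

lemma fst_triple_sum:
  assumes "(u1, v1) \<in> quartic d" "(u2, v2) \<in> quartic d" "(u3, v3) \<in> quartic d"
  shows "fst (qadd d (qadd d (u1, v1) (u2, v2)) (u3, v3))
    = triple_num d u1 v1 u2 v2 u3 v3 / triple_den d u1 u2 u3"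
proof -
  note facts = quarticD[OF assms(1)] quarticD[OF assms(2)] quarticD[OF assms(3)]
  define D where "D = 1 - d * u1 ^ 2 * u2 ^ 2"
  define U where "U = u1 * v2 + u2 * v1"
  define V where "V = (1 + d * u1 ^ 2 * u2 ^ 2) * v1 * v2 + 2 * d * u1 * u2 * (u1 ^ 2 + u2 ^ 2)"
  define E where "E = D ^ 2 - d * U ^ 2 * u3 ^ 2"
  define E' where "E' = D ^ 2 - d * (u1 * v2 - u2 * v1) ^ 2 * u3 ^ 2"
  have D: "D \<noteq> 0" unfolding D_def using den_nonzero facts by blast
  have K': "U / D \<in> K" "(u1 * v2 - u2 * v1) / D \<in> K"
    unfolding U_def D_def using facts by simp_all
  \<comment> \<open>\<open>E'\<close> is the analogue of \<open>E\<close> for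
    \<open>P1 - P2\<close>. Neither vanishes, hence neither does \<open>triple_den\<close>, which
    divides their product.\<close>
  have "E \<noteq> 0" "E' \<noteq> 0"
    unfolding E_def E'_def
    using den_nonzero[OF K'(1) facts(7)] den_nonzero[OF K'(2) facts(7)] D by (auto simp: field_simps)
  moreover have "E * E' = D ^ 2 * triple_den d u1 u2 u3"
    unfolding E_def E'_def D_def U_def by (rule triple_identities(2)[OF facts(3,6,9)])
  ultimately have S: "triple_den d u1 u2 u3 \<noteq> 0" by auto
  have "(U * D * v3 + u3 * V) * triple_den d u1 u2 u3 = triple_num d u1 v1 u2 v2 u3 v3 * E"
    unfolding E_def D_def U_def V_def by (rule triple_identities(1)[OF facts(3,6,9)])
  then have "(U * D * v3 + u3 * V) / E = triple_num d u1 v1 u2 v2 u3 v3 / triple_den d u1 u2 u3"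
    using S \<open>E \<noteq> 0\<close> by (simp add: field_simps)
  moreover have "qadd d (u1, v1) (u2, v2) = (U / D, V / D ^ 2)"
    by (simp add: U_def V_def D_def)
  ultimately show ?thesis by (simp add: qadd_fractions[OF D] E_def del: qadd.simps)
qed

lemma fst_qadd_assoc:
  assumes "P \<in> quartic d" "Q \<in> quartic d" "R \<in> quartic d"
  shows "fst (qadd d (qadd d P Q) R) = fst (qadd d P (qadd d Q R))"
proof -
  obtain u1 v1 u2 v2 u3 v3 where *: "P = (u1, v1)" "Q = (u2, v2)" "R = (u3, v3)"
    by (cases P; cases Q; cases R)
  have "fst (qadd d P (qadd d Q R)) = fst (qadd d (qadd d Q R) P)"
    by (subst qadd_commute) simp
  also have "\<dots> = triple_num d u2 v2 u3 v3 u1 v1 / triple_den d u2 u3 u1"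
    using assms unfolding * by (intro fst_triple_sum)
  also have "triple_num d u2 v2 u3 v3 u1 v1 = triple_num d u1 v1 u2 v2 u3 v3"
    by (simp add: triple_num_def algebra_simps)
  also have "triple_den d u2 u3 u1 = triple_den d u1 u2 u3"
    by (simp add: triple_den_def algebra_simps)
  also have "triple_num d u1 v1 u2 v2 u3 v3 / triple_den d u1 u2 u3 = fst (qadd d (qadd d P Q) R)"
    using assms unfolding * by (intro fst_triple_sum[symmetric])
  finally show ?thesis by simp
qed

text \<open>From \<open>(P + Q) + R = 0\<close> cancellation gives \<open>P + Q = - R\<close>, then
  \<open>Q = - R - P\<close>, then \<open>Q + R = - P\<close>.\<close>

lemma qadd_assoc_zero:
  assumes "P \<in> quartic d" "Q \<in> quartic d" "R \<in> quartic d"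
    and "qadd d (qadd d P Q) R = (0, 1)"
  shows "qadd d P (qadd d Q R) = (0, 1)"
proof -
  obtain u1 v1 u2 v2 u3 v3 where *: "P = (u1, v1)" "Q = (u2, v2)" "R = (u3, v3)"
    by (cases P; cases Q; cases R)
  note C = assms(1-3)[unfolded *]
  have "qadd d (u1, v1) (u2, v2) = qadd d (qadd d (qadd d P Q) R) (- u3, v3)"
    using qadd_cancel[OF qadd_closed[OF assms(1,2)] C(3)] by (simp add: * del: qadd.simps)
  also have "\<dots> = (- u3, v3)"
    unfolding assms(4) by (rule qadd_zero)
  finally have "qadd d (u2, v2) (u1, v1) = (- u3, v3)"
    by (subst qadd_commute)
  then have "(u2, v2) = qadd d (- u3, v3) (- u1, v1)"
    using qadd_cancel[OF C(2,1)] by simp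
  then have "qadd d (u2, v2) (u3, v3) = qadd d (qadd d (- u1, v1) (- u3, v3)) (- (- u3), v3)"
    by (simp add: qadd_commute[of "(- u3, v3)"] del: qadd.simps)
  also have "\<dots> = (- u1, v1)"
    by (rule qadd_cancel) (use C neg_closed in auto)
  finally show ?thesis
    using qadd_neg[OF C(1)] unfolding * by (simp add: qadd_commute[of "(u1, v1)"] del: qadd.simps)
qed

text \<open>The first coordinates agree because the triple sum is symmetric. Applied to the images
  under \<open>qtheta\<close>, the same fact shows that the values \<open>(1 + i) u / v\<close>
  agree, which determines \<open>v\<close> when \<open>u\<close> is nonzero. For
  \<open>u = 0\<close> only \<open>v = 1\<close> and \<open>v = - 1\<close> are possible, and it
  suffices that one sum is zero exactly when the other is.\<close>

lemma qadd_assoc: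
  assumes "P \<in> quartic d" "Q \<in> quartic d" "R \<in> quartic d"
  shows "qadd d (qadd d P Q) R = qadd d P (qadd d Q R)"
proof -
  define X where "X = qadd d (qadd d P Q) R"
  define Y where "Y = qadd d P (qadd d Q R)"
  have XC: "X \<in> quartic d" and YC: "Y \<in> quartic d"
    using assms by (simp_all add: X_def Y_def qadd_closed)
  have fst: "fst X = fst Y" unfolding X_def Y_def by (rule fst_qadd_assoc[OF assms])
  obtain u v v' where XY: "X = (u, v)" "Y = (u, v')" using fst by (cases X; cases Y) auto
  note facts = quarticD[OF XC[unfolded XY]] quarticD[OF YC[unfolded XY]]
  note nz = v_nonzero[OF XC[unfolded XY]] v_nonzero[OF YC[unfolded XY]]
  show ?thesis
  proof (cases "u = 0")
    case False
    have "fst (qtheta X) = fst (qtheta Y)"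
      unfolding X_def Y_def using assms
      by (simp add: qtheta_qadd qadd_closed fst_qadd_assoc qtheta_closed)
    then have "(1 + \<i>) * u / v = (1 + \<i>) * u / v'"
      using XC YC by (simp add: XY qtheta_eq)
    moreover have "1 + \<i> \<noteq> 0" by (simp add: complex_eq_iff)
    then have "(1 + \<i>) * u \<noteq> 0" using False by simp
    ultimately have "v = v'" by (simp only: divide_cancel_left) simp
    then show ?thesis using XY by (simp add: X_def Y_def)
  next
    case True
    then have vv: "v = 1 \<or> v = - 1" "v' = 1 \<or> v' = - 1"
      using facts by (simp_all add: power2_eq_1_iff)
    have "Y = (0, 1)" if "X = (0, 1)"
      using qadd_assoc_zero[OF assms] that by (simp add: X_def Y_def)
    moreover have "X = (0, 1)" if "Y = (0, 1)"
    proof -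
      have "qadd d (qadd d R Q) P = (0, 1)"
        using that by (simp add: Y_def qadd_commute[of R] qadd_commute[of _ P])
      then have "qadd d R (qadd d Q P) = (0, 1)"
        by (intro qadd_assoc_zero assms)
      then show ?thesis by (simp add: X_def qadd_commute[of R] qadd_commute[of Q P])
    qed
    ultimately have "X = Y" using vv True by (auto simp: XY)
    then show ?thesis by (simp add: X_def Y_def)
  qed
qed

definition qgroup :: "(complex \<times> complex) monoid" where
  "qgroup = \<lparr>carrier = quartic d, monoid.mult = qadd d, one = (0, 1)\<rparr>"

lemma qgroup_sel [simp]:
  "carrier qgroup = quartic d" "monoid.mult qgroup = qadd d" "one qgroup = (0, 1)"
  by (simp_all add: qgroup_def)

lemma comm_group_qgroup: "comm_group qgroup"
proof (rule comm_groupI)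
  fix P assume P: "P \<in> carrier qgroup"
  then obtain u v where "P = (u, v)" "(u, v) \<in> quartic d" by (cases P) auto
  then show "\<exists>Q \<in> carrier qgroup. Q \<otimes>\<^bsub>qgroup\<^esub> P = \<one>\<^bsub>qgroup\<^esub>"
    using qadd_neg[of u v] neg_closed[of u v] by (auto simp del: qadd.simps)
next
  fix P Q assume "P \<in> carrier qgroup" "Q \<in> carrier qgroup"
  show "P \<otimes>\<^bsub>qgroup\<^esub> Q = Q \<otimes>\<^bsub>qgroup\<^esub> P"
    unfolding qgroup_sel by (rule qadd_commute)
qed (auto simp: qadd_closed zero_closed qadd_assoc qadd_zero simp del: qadd.simps)

text \<open>The image of \<open>(u', w)\<close> has second coordinate \<open>2 / w^2 - 1\<close>, so
  \<open>w^2 = 2 / (1 + v)\<close> is forced; this is solved by \<open>w = 2 / s\<close>, and then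
  \<open>u' = u w / (1 + i)\<close>. Thus a trivial square class means divisibility by
  \<open>1 + i\<close>.\<close>

lemma qtheta_surj:
  assumes "(u, v) \<in> quartic d" "s \<in> K" "s \<noteq> 0" "2 * (1 + v) = s ^ 2"
  obtains P where "P \<in> quartic d" "qtheta P = (u, v)"
proof -
  note facts = quarticD[OF assms(1)]
  define w where "w = 2 / s"
  have w: "w \<in> K" "w \<noteq> 0" using assms by (simp_all add: w_def)
  define c where "c = 1 + v"
  have v: "v = c - 1" by (simp add: c_def)
  have s2: "s ^ 2 = 2 * c" using assms(4) by (simp add: c_def)
  then have c: "c \<noteq> 0" using assms(3) by auto
  have w2: "w ^ 2 = 2 / c"
    unfolding w_def power_divide s2 by (simp add: power2_eq_square)
  have i4: "(1 + \<i>) ^ 4 = - 4" by (simp add: eval_nat_numeral algebra_simps)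
  have "d * (u * w / (1 + \<i>)) ^ 4 = - (d * u ^ 4) * (w ^ 2) ^ 2 / 4"
    by (simp add: power_divide power_mult_distrib i4 flip: power_mult)
  also have "d * u ^ 4 = (c - 2) * c"
    using facts(3) by (simp add: v algebra_simps power2_eq_square)
  finally have "d * (u * w / (1 + \<i>)) ^ 4 = - ((c - 2) * c) * (2 / c) ^ 2 / 4"
    unfolding w2 .
  moreover have "1 + - ((c - 2) * c) * (2 / c) ^ 2 / 4 = 2 / c"
    using c by (simp add: field_simps power2_eq_square)
  ultimately have "1 + d * (u * w / (1 + \<i>)) ^ 4 = w ^ 2"
    by (simp only: w2)
  then have C: "(u * w / (1 + \<i>), w) \<in> quartic d"
    using facts w by (intro quarticI) simp_all
  have "1 + \<i> \<noteq> 0" by (simp add: complex_eq_iff)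
  moreover have "(2 - w ^ 2) / w ^ 2 = v"
    unfolding w2 v using c by (simp add: field_simps)
  ultimately have "qtheta (u * w / (1 + \<i>), w) = (u, v)"
    unfolding qtheta_eq[OF C] using w(2) by simp
  then show thesis using that C by blast
qed

lemma alpha_mult:
  assumes "(u1, v1) \<in> quartic d" "(u2, v2) \<in> quartic d"
  shows "\<exists>k \<in> K. 2 * (1 + v1) * (2 * (1 + v2)) * (2 * (1 + snd (qadd d (u1, v1) (u2, v2)))) = k ^ 2"
proof -
  note facts = quarticD[OF assms(1)] quarticD[OF assms(2)]
  define D where "D = 1 - d * u1 ^ 2 * u2 ^ 2"
  define V where "V = (1 + d * u1 ^ 2 * u2 ^ 2) * v1 * v2 + 2 * d * u1 * u2 * (u1 ^ 2 + u2 ^ 2)"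
  define R where
    "R = (1 + v1) * (1 + v2) + d * u1 * u2 * (u2 ^ 2 * (1 + v1) + u1 ^ 2 * (1 + v2) - u1 * u2)"
  have D: "D \<noteq> 0" unfolding D_def using den_nonzero facts by blast
  have "2 * (1 + v1) * (1 + v2) * (D ^ 2 + V) = R ^ 2"
    unfolding D_def V_def R_def by (rule quartic_alpha_identity[OF facts(3,6)])
  moreover have "2 * (1 + v1) * (2 * (1 + v2)) * (2 * (1 + V / D ^ 2))
      = 4 * (2 * (1 + v1) * (1 + v2) * (D ^ 2 + V)) / D ^ 2"
    using D by (simp add: divide_simps) (simp add: algebra_simps)
  ultimately have "2 * (1 + v1) * (2 * (1 + v2)) * (2 * (1 + V / D ^ 2)) = (2 * R / D) ^ 2"
    by (simp add: power_divide power_mult_distrib)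
  moreover have "2 * R / D \<in> K" unfolding R_def D_def using facts by simp
  ultimately show ?thesis by (auto simp: V_def D_def)
qed

end

section \<open>Comparison with the chord-tangent law\<close>

lemma weierstrass_sq:
  fixes A x w t :: complex
  assumes "w ^ 2 * x = x ^ 2 + A"
  shows "x * x = w * (w * x) - A" "x * (x * t) = (w * (w * x) - A) * t"
proof -
  show *: "x * x = w * (w * x) - A"
    using assms by (simp add: power2_eq_square algebra_simps)
  show "x * (x * t) = (w * (w * x) - A) * t"
    using * by (simp flip: mult.assoc)
qed

text \<open>Points with nonzero \<open>x\<close> are written \<open>(x, w x)\<close> with
  \<open>w = y / x = 1 / u\<close>, which turns the curve equation into
  \<open>w^2 x = x^2 + A\<close>. With \<open>x3 = x1 x2 (w1 - w2)^2 / e^2\<close> and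
  \<open>(M / D, V / D^2)\<close> the sum on the quartic, the identities say that \<open>x3\<close>
  is the abscissa of the chord sum, that \<open>2 x3 M^2 = D^2 + V\<close>, and that
  \<open>y3 M = x3 D\<close>.\<close>

lemma chord_identities:
  fixes A x1 w1 x2 w2 :: complex
  assumes "w1 ^ 2 * x1 = x1 ^ 2 + A" "w2 ^ 2 * x2 = x2 ^ 2 + A"
  defines "e \<equiv> x2 - x1" and "D \<equiv> w1 ^ 2 * w2 ^ 2 + 4 * A"
    and "M \<equiv> w1 * (2 * x2 - w2 ^ 2) + w2 * (2 * x1 - w1 ^ 2)"
    and "V \<equiv> (w1 ^ 2 * w2 ^ 2 - 4 * A) * (2 * x1 - w1 ^ 2) * (2 * x2 - w2 ^ 2)
              - 8 * A * w1 * w2 * (w1 ^ 2 + w2 ^ 2)"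
  shows "(w2 * x2 - w1 * x1) ^ 2 - (x1 + x2) * e ^ 2 = x1 * x2 * (w1 - w2) ^ 2"
    and "2 * x1 * x2 * (w1 - w2) ^ 2 * M ^ 2 = e ^ 2 * (D ^ 2 + V)"
    and "M * ((w2 * x2 - w1 * x1) * (x1 * e ^ 2 - x1 * x2 * (w1 - w2) ^ 2) - w1 * x1 * e ^ 3)
      = x1 * x2 * (w1 - w2) ^ 2 * D * e"
  unfolding e_def D_def M_def V_def
  by (simp_all add: quartic_simps weierstrass_sq[OF assms(1)] weierstrass_sq[OF assms(2)])

context jacobi_quartic
begin

definition coeffA :: complex where "coeffA = - d / 4"

lemma ec_add_Affine:
  assumes "\<not> (x1 = x2 \<and> y1 = - y2)"
    and "m = (if x1 = x2 then (3 * x1 ^ 2 + A) / (2 * y1) else (y2 - y1) / (x2 - x1))"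
    and "x3 = m ^ 2 - x1 - x2" "y3 = m * (x1 - x3) - y1"
  shows "ec_add A (Affine x1 y1) (Affine x2 y2) = Affine x3 y3"
  unfolding assms(4,3,2) ec_add.simps Let_def using assms(1) by (simp only: if_False)

lemma minus_coeffA_nonsquare: "k \<in> K \<Longrightarrow> k ^ 2 \<noteq> - coeffA"
  using d_nonsquare[of "2 * k"] by (auto simp: coeffA_def power_mult_distrib)

text \<open>The point \<open>(0, 0)\<close> of order two needs its own value because
  \<open>x / y\<close> is meaningless there. No point over \<open>K\<close> with nonzero
  \<open>x\<close> has \<open>y = 0\<close>, since \<open>- coeffA\<close> is not a square in
  \<open>K\<close>.\<close>

fun to_quartic :: "complex ec_point \<Rightarrow> complex \<times> complex" where
  "to_quartic Infinity = (0, 1)"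
| "to_quartic (Affine x y) = (if x = 0 then (0, - 1) else (x / y, 2 * x * (x / y) ^ 2 - 1))"

fun of_quartic :: "complex \<times> complex \<Rightarrow> complex ec_point" where
  "of_quartic (u, v) =
    (if u = 0 then if v = 1 then Infinity else Affine 0 0
     else Affine ((1 + v) / (2 * u ^ 2)) ((1 + v) / (2 * u ^ 3)))"

lemma ec_points_cases:
  assumes "P \<in> ec_points K coeffA 0"
  obtains "P = Infinity" | "P = Affine 0 0"
  | x w where "P = Affine x (w * x)" "x \<in> K" "w \<in> K" "x \<noteq> 0" "w \<noteq> 0" "w ^ 2 * x = x ^ 2 + coeffA"
proof (cases P)
  case (Affine x y)
  with assms have xy: "x \<in> K" "y \<in> K" "y ^ 2 = x ^ 3 + coeffA * x" by (auto simp: ec_points_def)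
  show thesis
  proof (cases "x = 0")
    case False
    have *: "(y / x) ^ 2 * x = x ^ 2 + coeffA"
      using xy(3) False by (simp add: field_simps eval_nat_numeral)
    moreover have "y / x \<noteq> 0"
      using * minus_coeffA_nonsquare[OF xy(1)] False by (auto simp: eq_neg_iff_add_eq_0)
    ultimately show thesis using that(3)[of x "y / x"] xy False by (simp add: Affine)
  qed (use that xy Affine in simp)
qed (use that in simp)

lemma slope_to_quartic:
  "x \<noteq> 0 \<Longrightarrow> w \<noteq> 0 \<Longrightarrow> to_quartic (Affine x (w * x)) = (1 / w, (2 * x - w ^ 2) / w ^ 2)"
  by (simp add: field_simps)

lemma to_quartic_closed:
  assumes "P \<in> ec_points K coeffA 0"
  shows "to_quartic P \<in> quartic d"
  using assms
proof (cases rule: ec_points_cases)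
  case (3 x w)
  have "(2 * x - w ^ 2) ^ 2 = w ^ 4 - 4 * coeffA"
    by (simp add: quartic_simps weierstrass_sq[OF 3(6)])
  then have "(2 * x - w ^ 2) ^ 2 = w ^ 4 + d" by (simp add: coeffA_def)
  then have "((2 * x - w ^ 2) / w ^ 2) ^ 2 = 1 + d * (1 / w) ^ 4"
    using 3(5) by (simp add: power_divide add_divide_distrib flip: power_mult)
  then show ?thesis
    unfolding 3(1) slope_to_quartic[OF 3(4,5)] using 3 by (intro quarticI) simp_all
qed (simp_all add: zero_closed two_torsion_closed)

lemma of_quartic_to_quartic:
  assumes "P \<in> ec_points K coeffA 0"
  shows "of_quartic (to_quartic P) = P"
  using assms
proof (cases rule: ec_points_cases)
  case (3 x w)
  have "1 + (2 * x - w ^ 2) / w ^ 2 = 2 * x / w ^ 2" using 3 by (simp add: field_simps)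
  then show ?thesis
    unfolding 3(1) slope_to_quartic[OF 3(4,5)] of_quartic.simps
    using 3(4,5) by (simp add: field_simps eval_nat_numeral)
qed simp_all

lemma quartic_u0: "(0, v) \<in> quartic d \<Longrightarrow> v = 1 \<or> v = - 1"
  by (simp add: quartic_def power2_eq_1_iff)

lemma quartic_v_ne: "(u, v) \<in> quartic d \<Longrightarrow> u \<noteq> 0 \<Longrightarrow> 1 + v \<noteq> 0"
proof
  assume *: "(u, v) \<in> quartic d" "u \<noteq> 0" "1 + v = 0"
  then have "v = - 1" by (simp add: add_eq_0_iff)
  then show False using quarticD(3)[OF *(1)] *(2) d_nonzero by simp
qed

lemma of_quartic_closed:
  assumes "Q \<in> quartic d"
  shows "of_quartic Q \<in> ec_points K coeffA 0"
proof -
  obtain u v where Q: "Q = (u, v)" by (cases Q)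
  note facts = quarticD[OF assms[unfolded Q]]
  show ?thesis
  proof (cases "u = 0")
    case False
    define x where "x = (1 + v) / (2 * u ^ 2)"
    have "(1 + v) ^ 2 = 2 * (1 + v) + d * u ^ 4"
      using facts(3) by (simp add: power2_eq_square algebra_simps)
    then have "x ^ 2 = (2 * (1 + v) + d * u ^ 4) / (4 * u ^ 4)"
      by (simp add: x_def power_divide power_mult_distrib flip: power_mult)
    also have "\<dots> = x / u ^ 2 - coeffA"
      using False by (simp add: x_def coeffA_def add_divide_distrib) (simp add: eval_nat_numeral mult.assoc)
    finally have *: "x / u ^ 2 = x ^ 2 + coeffA" by simp
    have "(x / u) ^ 2 = x * (x / u ^ 2)" by (simp add: power2_eq_square)
    also have "\<dots> = x ^ 3 + coeffA * x" unfolding * by (simp add: eval_nat_numeral algebra_simps)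
    finally have "(x / u) ^ 2 = x ^ 3 + coeffA * x" .
    moreover have "(1 + v) / (2 * u ^ 3) = x / u" using False by (simp add: x_def eval_nat_numeral)
    ultimately show ?thesis using False facts by (simp add: Q ec_points_def x_def[symmetric]) (simp add: x_def)
  qed (auto simp: Q ec_points_def)
qed

lemma to_quartic_of_quartic:
  assumes "Q \<in> quartic d"
  shows "to_quartic (of_quartic Q) = Q"
proof -
  obtain u v where Q: "Q = (u, v)" by (cases Q)
  show ?thesis
  proof (cases "u = 0")
    case True
    then show ?thesis using quartic_u0[of v] assms by (auto simp: Q)
  next
    case False
    define x where "x = (1 + v) / (2 * u ^ 2)"
    have "1 + v \<noteq> 0" using False quartic_v_ne assms by (simp add: Q)
    then have "x \<noteq> 0" using False by (simp add: x_def)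
    moreover have y: "(1 + v) / (2 * u ^ 3) = x / u" using False by (simp add: x_def eval_nat_numeral)
    moreover have "2 * x * u ^ 2 = 1 + v" using False by (simp add: x_def del: distrib_left_numeral)
    then have "2 * x * u ^ 2 - 1 = v" by simp
    ultimately show ?thesis using False by (simp add: Q y x_def[symmetric])
  qed
qed

lemma qadd_two_torsion: "qadd d (u, v) (0, - 1) = (- u, - v)" "qadd d (0, - 1) (u, v) = (- u, - v)"
  by simp_all

lemma ec_add_two_torsion:
  assumes "x \<noteq> 0" "w \<noteq> 0" "w ^ 2 * x = x ^ 2 + coeffA"
  shows "ec_add coeffA (Affine x (w * x)) (Affine 0 0) = of_quartic (qadd d (to_quartic (Affine x (w * x))) (0, - 1))"
    and "ec_add coeffA (Affine 0 0) (Affine x (w * x)) = of_quartic (qadd d (0, - 1) (to_quartic (Affine x (w * x))))"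
proof -
  have A: "coeffA = w ^ 2 * x - x ^ 2" using assms(3) by simp
  have q: "of_quartic (- (1 / w), - ((2 * x - w ^ 2) / w ^ 2)) = Affine (w ^ 2 - x) (- w * (w ^ 2 - x))"
    using assms(2) by (simp add: field_simps eval_nat_numeral)
  have "w * x / x = w" using assms(1) by simp
  then show "ec_add coeffA (Affine x (w * x)) (Affine 0 0) = of_quartic (qadd d (to_quartic (Affine x (w * x))) (0, - 1))"
    unfolding slope_to_quartic[OF assms(1,2)] qadd_two_torsion q
    using assms(1) by (simp add: Let_def algebra_simps)
  show "ec_add coeffA (Affine 0 0) (Affine x (w * x)) = of_quartic (qadd d (0, - 1) (to_quartic (Affine x (w * x))))"
    unfolding slope_to_quartic[OF assms(1,2)] qadd_two_torsion q
    using assms(1) by (simp add: Let_def algebra_simps)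
qed

lemma qadd_slopes:
  fixes w1 w2 x1 x2 :: complex
  assumes "w1 \<noteq> 0" "w2 \<noteq> 0"
  defines "D \<equiv> w1 ^ 2 * w2 ^ 2 + 4 * coeffA"
    and "M \<equiv> w1 * (2 * x2 - w2 ^ 2) + w2 * (2 * x1 - w1 ^ 2)"
    and "V \<equiv> (w1 ^ 2 * w2 ^ 2 - 4 * coeffA) * (2 * x1 - w1 ^ 2) * (2 * x2 - w2 ^ 2)
              - 8 * coeffA * w1 * w2 * (w1 ^ 2 + w2 ^ 2)"
  shows "qadd d (1 / w1, (2 * x1 - w1 ^ 2) / w1 ^ 2) (1 / w2, (2 * x2 - w2 ^ 2) / w2 ^ 2) = (M / D, V / D ^ 2)"
proof -
  define a b where "a = 2 * x1 - w1 ^ 2" and "b = 2 * x2 - w2 ^ 2"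
  have 1: "1 - d * (1 / w1) ^ 2 * (1 / w2) ^ 2 = D / (w1 ^ 2 * w2 ^ 2)"
    using assms(1,2) by (simp add: D_def coeffA_def field_simps)
  have 2: "1 / w1 * (b / w2 ^ 2) + 1 / w2 * (a / w1 ^ 2) = M / (w1 ^ 2 * w2 ^ 2)"
    using assms(1,2) unfolding M_def a_def[symmetric] b_def[symmetric]
    by (simp add: divide_simps) (simp add: power2_eq_square algebra_simps)
  have 3: "(1 + d * (1 / w1) ^ 2 * (1 / w2) ^ 2) * (a / w1 ^ 2) * (b / w2 ^ 2)
      + 2 * d * (1 / w1) * (1 / w2) * ((1 / w1) ^ 2 + (1 / w2) ^ 2) = V / (w1 ^ 4 * w2 ^ 4)"
    using assms(1,2) unfolding V_def a_def[symmetric] b_def[symmetric]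
    by (simp add: coeffA_def divide_simps) (simp add: quartic_simps)
  show ?thesis
    unfolding a_def[symmetric] b_def[symmetric] qadd.simps 1 2 3
    using assms(1,2) by (simp add: power_divide power_mult_distrib flip: power_mult)
qed

lemma slope_den_nonzero:
  assumes "w1 \<in> K" "w2 \<in> K" "w1 \<noteq> 0" "w2 \<noteq> 0"
  shows "w1 ^ 2 * w2 ^ 2 + 4 * coeffA \<noteq> 0"
  using den_nonzero[of "1 / w1" "1 / w2"] assms by (auto simp: coeffA_def field_simps)

lemma ec_add_chord:
  assumes "x1 \<in> K" "w1 \<in> K" "x1 \<noteq> 0" "w1 \<noteq> 0" "w1 ^ 2 * x1 = x1 ^ 2 + coeffA"
    and "x2 \<in> K" "w2 \<in> K" "x2 \<noteq> 0" "w2 \<noteq> 0" "w2 ^ 2 * x2 = x2 ^ 2 + coeffA"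
    and "x1 \<noteq> x2" "w1 \<noteq> w2"
  shows "ec_add coeffA (Affine x1 (w1 * x1)) (Affine x2 (w2 * x2))
    = of_quartic (qadd d (1 / w1, (2 * x1 - w1 ^ 2) / w1 ^ 2) (1 / w2, (2 * x2 - w2 ^ 2) / w2 ^ 2))"
proof -
  define e where "e = x2 - x1"
  define D where "D = w1 ^ 2 * w2 ^ 2 + 4 * coeffA"
  define M where "M = w1 * (2 * x2 - w2 ^ 2) + w2 * (2 * x1 - w1 ^ 2)"
  define V where "V = (w1 ^ 2 * w2 ^ 2 - 4 * coeffA) * (2 * x1 - w1 ^ 2) * (2 * x2 - w2 ^ 2)
              - 8 * coeffA * w1 * w2 * (w1 ^ 2 + w2 ^ 2)"
  define m where "m = (w2 * x2 - w1 * x1) / e"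
  define Z where "Z = x1 * x2 * (w1 - w2) ^ 2"
  define x3 where "x3 = Z / e ^ 2"
  define y3 where "y3 = m * (x1 - x3) - w1 * x1"
  have e: "e \<noteq> 0" and Z: "Z \<noteq> 0" using assms by (simp_all add: e_def Z_def)
  have D: "D \<noteq> 0" unfolding D_def using slope_den_nonzero assms by blast
  note ids = chord_identities[OF assms(5,10), folded e_def D_def M_def V_def]
  have "m ^ 2 - x1 - x2 = ((w2 * x2 - w1 * x1) ^ 2 - (x1 + x2) * e ^ 2) / e ^ 2"
    using e by (simp add: m_def power_divide field_simps)
  then have x3: "m ^ 2 - x1 - x2 = x3" by (simp add: ids(1) x3_def Z_def)
  have sum: "ec_add coeffA (Affine x1 (w1 * x1)) (Affine x2 (w2 * x2)) = Affine x3 y3"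
    by (rule ec_add_Affine[where m = m]) (use assms(11) in \<open>simp_all add: x3[symmetric] y3_def m_def e_def\<close>)
  have y3: "y3 = ((w2 * x2 - w1 * x1) * (x1 * e ^ 2 - Z) - w1 * x1 * e ^ 3) / e ^ 3"
    using e by (simp add: y3_def m_def x3_def field_simps eval_nat_numeral)
  have yM: "y3 * M = x3 * D"
    using ids(3) e unfolding y3 x3_def Z_def[symmetric] by (simp add: field_simps eval_nat_numeral)
  have xM: "2 * x3 * M ^ 2 = D ^ 2 + V"
    using ids(2) e unfolding x3_def by (simp add: Z_def field_simps)
  have "x3 \<noteq> 0" using Z e by (simp add: x3_def)
  then have M: "M \<noteq> 0" using yM D by auto
  have "1 + V / D ^ 2 = 2 * x3 * M ^ 2 / D ^ 2"
    unfolding xM using D by (simp add: field_simps)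
  then have "(1 + V / D ^ 2) / (2 * (M / D) ^ 2) = x3"
    using D M by (simp add: power_divide)
  moreover have "(1 + V / D ^ 2) / (2 * (M / D) ^ 3) = (1 + V / D ^ 2) / (2 * (M / D) ^ 2) / (M / D)"
    by (simp add: power3_eq_cube power2_eq_square mult.assoc)
  moreover have "x3 / (M / D) = y3"
    using yM M by (simp add: field_simps)
  ultimately show ?thesis
    unfolding sum qadd_slopes[OF assms(4,9)] D_def[symmetric] M_def[symmetric] V_def[symmetric]
    using M D by simp
qed

text \<open>Points of equal slope lie on a line through \<open>(0, 0)\<close>, which is therefore
  the third intersection point. The abscissas are the two roots of
  \<open>x^2 - w^2 x + coeffA\<close>, hence \<open>w^2 = x1 + x2\<close> and
  \<open>coeffA = x1 x2\<close>.\<close>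

lemma ec_add_vertical_slopes:
  assumes "x1 \<noteq> 0" "w \<noteq> 0" "w ^ 2 * x1 = x1 ^ 2 + coeffA" "x2 \<noteq> 0" "w ^ 2 * x2 = x2 ^ 2 + coeffA"
    and "x1 \<noteq> x2" "w \<in> K"
  shows "ec_add coeffA (Affine x1 (w * x1)) (Affine x2 (w * x2))
    = of_quartic (qadd d (1 / w, (2 * x1 - w ^ 2) / w ^ 2) (1 / w, (2 * x2 - w ^ 2) / w ^ 2))"
proof -
  have "(x1 - x2) * (w ^ 2 - x1 - x2) = 0"
    using assms(3,5) by (simp add: power2_eq_square algebra_simps)
  then have w2: "w ^ 2 = x1 + x2" using assms(6) by (simp add: diff_diff_eq)
  then have ww: "w * w = x1 + x2" "w * (w * t) = (x1 + x2) * t" for t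
    by (simp_all add: power2_eq_square flip: mult.assoc)
  then have A: "coeffA = x1 * x2" using assms(3) by (simp add: power2_eq_square algebra_simps)
  have "(w * x2 - w * x1) / (x2 - x1) = w"
    using assms(6) by (simp flip: right_diff_distrib)
  then have sum: "ec_add coeffA (Affine x1 (w * x1)) (Affine x2 (w * x2)) = Affine 0 0"
    using assms(6) by (simp add: Let_def w2)
  have D: "w ^ 2 * w ^ 2 + 4 * coeffA \<noteq> 0" using slope_den_nonzero assms by blast
  have "(w ^ 2 * w ^ 2 - 4 * coeffA) * (2 * x1 - w ^ 2) * (2 * x2 - w ^ 2)
      - 8 * coeffA * w * w * (w ^ 2 + w ^ 2) = - ((w ^ 2 * w ^ 2 + 4 * coeffA) ^ 2)"
    by (simp add: A quartic_simps ww)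
  moreover have "w * (2 * x2 - w ^ 2) + w * (2 * x1 - w ^ 2) = 0"
    by (simp add: quartic_simps ww)
  ultimately show ?thesis unfolding sum qadd_slopes[OF assms(2,2)] using D by simp
qed

lemma ec_add_double:
  assumes "x \<noteq> 0" "w \<noteq> 0" "w ^ 2 * x = x ^ 2 + coeffA" "x \<in> K" "w \<in> K"
  shows "ec_add coeffA (Affine x (w * x)) (Affine x (w * x))
    = of_quartic (qadd d (1 / w, (2 * x - w ^ 2) / w ^ 2) (1 / w, (2 * x - w ^ 2) / w ^ 2))"
proof -
  define a where "a = 2 * x - w ^ 2"
  define D where "D = w ^ 4 + 4 * w ^ 2 * x - 4 * x ^ 2"
  define m where "m = (2 * x + w ^ 2) / (2 * w)"
  have A: "coeffA = w ^ 2 * x - x ^ 2" using assms(3) by simp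
  have "(w * x) ^ 2 = x * (w ^ 2 * x)" by (simp add: power2_eq_square)
  also have "\<dots> = x ^ 3 + coeffA * x"
    unfolding assms(3) by (simp add: eval_nat_numeral algebra_simps)
  finally have "Affine x (w * x) \<in> ec_points K coeffA 0"
    using assms(4,5) by (simp add: ec_points_def)
  from to_quartic_closed[OF this] have P: "(1 / w, a / w ^ 2) \<in> quartic d"
    unfolding slope_to_quartic[OF assms(1,2)] a_def .
  have a: "a \<noteq> 0" using v_nonzero[OF P] by auto
  have D: "D \<noteq> 0" using slope_den_nonzero[OF assms(5,5,2,2)] by (simp add: D_def A eval_nat_numeral algebra_simps)
  have m: "(3 * x ^ 2 + coeffA) / (2 * (w * x)) = m"
    using assms(1,2) by (simp add: m_def A field_simps power2_eq_square)
  have x3: "m ^ 2 - x - x = a ^ 2 / (4 * w ^ 2)"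
    using assms(2) by (simp add: m_def a_def power_divide field_simps) (simp add: eval_nat_numeral algebra_simps)
  have y3: "m * (x - a ^ 2 / (4 * w ^ 2)) - w * x = a * D / (8 * w ^ 3)"
    using assms(2) unfolding m_def a_def D_def by (simp add: divide_simps) (simp add: eval_nat_numeral algebra_simps)
  have "w * x \<noteq> - (w * x)" using assms(1,2) by simp
  then have sum: "ec_add coeffA (Affine x (w * x)) (Affine x (w * x)) = Affine (a ^ 2 / (4 * w ^ 2)) (a * D / (8 * w ^ 3))"
    by (intro ec_add_Affine[where m = m]) (simp_all add: m x3 y3)
  have id: "(w ^ 2 * w ^ 2 - 4 * coeffA) * a * a - 8 * coeffA * w * w * (w ^ 2 + w ^ 2) = 2 * a ^ 4 - D ^ 2"
    unfolding A a_def D_def by (simp add: eval_nat_numeral algebra_simps)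
  have "w ^ 2 * w ^ 2 + 4 * coeffA = D" "w * a + w * a = 2 * w * a"
    unfolding A D_def by (simp_all add: eval_nat_numeral algebra_simps)
  then have q: "qadd d (1 / w, a / w ^ 2) (1 / w, a / w ^ 2) = (2 * w * a / D, (2 * a ^ 4 - D ^ 2) / D ^ 2)"
    using qadd_slopes[OF assms(2,2), of x x] unfolding a_def[symmetric] id by simp
  have "1 + (2 * a ^ 4 - D ^ 2) / D ^ 2 = 2 * a ^ 4 / D ^ 2" using D by (simp add: field_simps)
  then show ?thesis
    unfolding sum a_def[symmetric] q of_quartic.simps using a D assms(2)
    by (simp add: power_divide power_mult_distrib) (simp add: eval_nat_numeral)
qed

lemma ec_add_eq:
  assumes "P \<in> ec_points K coeffA 0" "Q \<in> ec_points K coeffA 0"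
  shows "ec_add coeffA P Q = of_quartic (qadd d (to_quartic P) (to_quartic Q))"
  using assms(1)
proof (cases rule: ec_points_cases)
  case 1
  then show ?thesis using of_quartic_to_quartic[OF assms(2)] qadd_zero[of "to_quartic Q"] by simp
next
  case 2
  from assms(2) show ?thesis
  proof (cases rule: ec_points_cases)
    case (3 x w)
    show ?thesis unfolding \<open>P = _\<close> 3(1) using ec_add_two_torsion(2)[OF 3(4-6)] by (simp del: qadd.simps)
  qed (simp_all add: 2)
next
  case (3 x1 w1)
  note P = 3
  from assms(2) show ?thesis
  proof (cases rule: ec_points_cases)
    case 1
    then show ?thesis using of_quartic_to_quartic[OF assms(1)] qadd_zero[of "to_quartic P"] qadd_commute[of "to_quartic P"]
      by (simp add: P(1))
  next
    case 2
    then show ?thesis unfolding P(1) 2 using ec_add_two_torsion(1)[OF P(4-6)] by (simp del: qadd.simps)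
  next
    case (3 x2 w2)
    note slopes = slope_to_quartic[OF P(4,5)] slope_to_quartic[OF 3(4,5)]
    consider "x1 \<noteq> x2" "w1 \<noteq> w2" | "x1 \<noteq> x2" "w1 = w2" | "x1 = x2" "w1 = w2" | "x1 = x2" "w1 \<noteq> w2" by blast
    then show ?thesis
    proof cases
      case 1
      then show ?thesis unfolding P(1) 3(1) slopes by (intro ec_add_chord P 3)
    next
      case 2
      then show ?thesis unfolding P(1) 3(1) slopes using ec_add_vertical_slopes[of x1 w1 x2] P 3 by simp
    next
      case c: 3
      then show ?thesis unfolding P(1) 3(1) slopes using ec_add_double[of x1 w1] P 3 by simp
    next
      case 4
      have "x1 * (w1 - w2) * (w1 + w2) = 0" using P(6) 3(6) 4 by (simp add: algebra_simps power2_eq_square)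
      then have w: "w1 = - w2" using 4 P by (simp add: add_eq_0_iff)
      have "to_quartic Q \<in> quartic d" using to_quartic_closed assms by blast
      then have "qadd d (- (1 / w2), (2 * x2 - w2 ^ 2) / w2 ^ 2) (1 / w2, (2 * x2 - w2 ^ 2) / w2 ^ 2) = (0, 1)"
        unfolding 3(1) slopes by (rule qadd_neg)
      then show ?thesis unfolding P(1) 3(1) slopes using 4 w by simp
    qed
  qed
qed

lemma ec_group_iso: "to_quartic \<in> iso (ec_group K coeffA 0) qgroup"
  unfolding iso_def hom_def
proof (intro CollectI conjI ballI)
  show "to_quartic \<in> carrier (ec_group K coeffA 0) \<rightarrow> carrier qgroup"
    by (auto simp: ec_group_def to_quartic_closed)
  show "bij_betw to_quartic (carrier (ec_group K coeffA 0)) (carrier qgroup)"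
    by (rule bij_betw_byWitness[where f' = of_quartic])
      (auto simp: ec_group_def of_quartic_to_quartic to_quartic_of_quartic to_quartic_closed of_quartic_closed
        simp del: of_quartic.simps)
next
  fix P Q assume "P \<in> carrier (ec_group K coeffA 0)" "Q \<in> carrier (ec_group K coeffA 0)"
  then show "to_quartic (P \<otimes>\<^bsub>ec_group K coeffA 0\<^esub> Q) = to_quartic P \<otimes>\<^bsub>qgroup\<^esub> to_quartic Q"
    by (simp add: ec_group_def ec_add_eq to_quartic_of_quartic qadd_closed to_quartic_closed)
qed

text \<open>The axioms are carried over from the quartic, so associativity of the chord-tangent law
  is never computed.\<close>

lemma group_ec_group: "group (ec_group K coeffA 0)"
proof -
  have "of_quartic \<in> iso qgroup (ec_group K coeffA 0)"
    unfolding iso_def hom_def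
  proof (intro CollectI conjI ballI)
    show "of_quartic \<in> carrier qgroup \<rightarrow> carrier (ec_group K coeffA 0)"
      unfolding ec_group_def by (simp add: of_quartic_closed del: of_quartic.simps)
    show "bij_betw of_quartic (carrier qgroup) (carrier (ec_group K coeffA 0))"
      by (rule bij_betw_byWitness[where f' = to_quartic])
        (auto simp: ec_group_def of_quartic_to_quartic to_quartic_of_quartic to_quartic_closed of_quartic_closed
          simp del: of_quartic.simps)
    fix P Q assume "P \<in> carrier qgroup" "Q \<in> carrier qgroup"
    then show "of_quartic (P \<otimes>\<^bsub>qgroup\<^esub> Q) = of_quartic P \<otimes>\<^bsub>ec_group K coeffA 0\<^esub> of_quartic Q"
      by (simp add: ec_group_def ec_add_eq of_quartic_closed to_quartic_of_quartic
          del: of_quartic.simps qadd.simps)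
  qed
  then have "group (ec_group K coeffA 0\<lparr>one := of_quartic \<one>\<^bsub>qgroup\<^esub>\<rparr>)"
    by (rule group.iso_imp_img_group[OF comm_group.axioms(2)[OF comm_group_qgroup]])
  then show ?thesis by (simp add: ec_group_def)
qed

end

section \<open>Abelian groups with an action of the Gaussian integers\<close>

locale gauss_module = comm_group G for G (structure) +
  fixes rot :: "'a \<Rightarrow> 'a"
  assumes rot_hom: "rot \<in> hom G G" and rot_rot: "x \<in> carrier G \<Longrightarrow> rot (rot x) = inv x"
begin

lemma rot_closed [simp]: "x \<in> carrier G \<Longrightarrow> rot x \<in> carrier G"
  using rot_hom by (auto simp: hom_def)

lemma rot_mult: "x \<in> carrier G \<Longrightarrow> y \<in> carrier G \<Longrightarrow> rot (x \<otimes> y) = rot x \<otimes> rot y"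
  using rot_hom by (auto simp: hom_def)

lemma rot_int_pow: "x \<in> carrier G \<Longrightarrow> rot (x [^] (n::int)) = rot x [^] n"
  using int_pow_consistent hom_int_pow[OF rot_hom _ is_group is_group] by simp

definition act :: "gint \<Rightarrow> 'a \<Rightarrow> 'a" where
  "act z x = x [^] gre z \<otimes> rot x [^] gim z"

lemma act_closed [simp]: "x \<in> carrier G \<Longrightarrow> act z x \<in> carrier G"
  by (simp add: act_def)

lemma act_distrib: "x \<in> carrier G \<Longrightarrow> y \<in> carrier G \<Longrightarrow> act z (x \<otimes> y) = act z x \<otimes> act z y"
  by (simp add: act_def rot_mult int_pow_distrib m_ac)

lemma act_add: "x \<in> carrier G \<Longrightarrow> act (z + w) x = act z x \<otimes> act w x"
  by (simp add: act_def int_pow_mult m_ac)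

lemma act_0 [simp]: "act 0 x = \<one>"
  by (simp add: act_def)

lemma act_1 [simp]: "x \<in> carrier G \<Longrightarrow> act 1 x = x"
  by (simp add: act_def)

lemma act_one [simp]: "act z \<one> = \<one>"
  using act_distrib[of \<one> \<one> z] by (metis act_closed l_cancel_one' one_closed r_one)

lemma act_minus: "x \<in> carrier G \<Longrightarrow> act (- z) x = inv (act z x)"
  using act_add[of x z "- z"] by (metis act_0 act_closed add.right_inverse inv_equality m_comm)

lemma act_inv: "x \<in> carrier G \<Longrightarrow> act z (inv x) = inv (act z x)"
  by (metis act_closed act_distrib act_one inv_closed inv_equality l_inv)

lemma act_diff: "x \<in> carrier G \<Longrightarrow> act (z - w) x = act z x \<otimes> inv (act w x)"
  using act_add[of x z "- w"] by (simp add: act_minus)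

lemma act_mult: "x \<in> carrier G \<Longrightarrow> act (z * w) x = act z (act w x)"
proof -
  assume x: "x \<in> carrier G"
  have "act z (act w x) = (x [^] gre w) [^] gre z \<otimes> (rot x [^] gim w) [^] gre z
     \<otimes> ((rot x [^] gre w) [^] gim z \<otimes> (inv x [^] gim w) [^] gim z)"
    using x by (simp add: act_def rot_mult rot_int_pow rot_rot int_pow_distrib)
  also have "\<dots> = x [^] (gre w * gre z) \<otimes> rot x [^] (gim w * gre z)
     \<otimes> (rot x [^] (gre w * gim z) \<otimes> x [^] (- (gim w * gim z)))"
    using x by (simp add: int_pow_pow int_pow_inv int_pow_neg)
  also have "\<dots> = x [^] (gre w * gre z) \<otimes> x [^] (- (gim w * gim z))
     \<otimes> (rot x [^] (gim w * gre z) \<otimes> rot x [^] (gre w * gim z))"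
    using x by (simp add: m_ac)
  also have "\<dots> = act (z * w) x"
    unfolding int_pow_mult[OF x, symmetric] int_pow_mult[OF rot_closed[OF x], symmetric] act_def
    by (simp add: algebra_simps)
  finally show ?thesis by simp
qed

lemma act_of_nat: "x \<in> carrier G \<Longrightarrow> act (of_nat n) x = x [^] n"
  by (simp add: act_def int_pow_int)

lemma act_gnorm: "x \<in> carrier G \<Longrightarrow> act (gcnj z) (act z x) = x [^] gnorm z"
  by (metis act_mult act_of_nat mult.commute of_nat_gnorm)

abbreviation T :: "'a set" where "T \<equiv> torsion_set G"

lemma T_carrier [simp]: "x \<in> T \<Longrightarrow> x \<in> carrier G"
  by (simp add: torsion_set_def)

text \<open>What \<open>z\<close> kills is killed by \<open>gcnj z * z\<close>, which is the
  positive integer \<open>gnorm z\<close>; torsion over the Gaussian integers is ordinary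
  torsion.\<close>

lemma T_I: "x \<in> carrier G \<Longrightarrow> z \<noteq> 0 \<Longrightarrow> act z x = \<one> \<Longrightarrow> x \<in> T"
proof -
  assume *: "x \<in> carrier G" "z \<noteq> 0" "act z x = \<one>"
  have "x [^] gnorm z = \<one>" using act_gnorm[OF *(1), of z] unfolding *(3) by simp
  moreover have "gnorm z > 0" using *(2) by (metis gnorm_eq_0_iff neq0_conv)
  ultimately show ?thesis unfolding torsion_set_def using *(1) by blast
qed

lemma T_iff: "x \<in> T \<longleftrightarrow> x \<in> carrier G \<and> (\<exists>z. z \<noteq> 0 \<and> act z x = \<one>)"
proof
  assume "x \<in> T"
  then obtain n where n: "x \<in> carrier G" "n > 0" "x [^] (n::nat) = \<one>"
    unfolding torsion_set_def by blast
  then have "act (of_nat n) x = \<one>" by (simp add: act_of_nat)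
  moreover have "(of_nat n :: gint) \<noteq> 0"
  proof
    assume "(of_nat n :: gint) = 0"
    then have "gre (of_nat n) = 0" by simp
    then show False using n(2) by simp
  qed
  ultimately show "x \<in> carrier G \<and> (\<exists>z. z \<noteq> 0 \<and> act z x = \<one>)" using n(1) by blast
qed (blast intro: T_I)

lemma one_T [simp]: "\<one> \<in> T"
  unfolding T_iff by (auto intro: exI[of _ 1])

lemma T_mult [simp]: "x \<in> T \<Longrightarrow> y \<in> T \<Longrightarrow> x \<otimes> y \<in> T"
proof -
  assume "x \<in> T" "y \<in> T"
  then obtain z w where "x \<in> carrier G" "y \<in> carrier G" "z \<noteq> 0" "w \<noteq> 0" "act z x = \<one>" "act w y = \<one>"
    unfolding T_iff by blast
  then have "act (z * w) (x \<otimes> y) = \<one>" "z * w \<noteq> 0"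
    by (simp_all add: act_distrib act_mult[of y]) (metis act_mult act_one mult.commute one_closed r_one)
  then show ?thesis using \<open>x \<in> carrier G\<close> \<open>y \<in> carrier G\<close> unfolding T_iff by blast
qed

lemma T_act [simp]: "x \<in> T \<Longrightarrow> act z x \<in> T"
  unfolding T_iff by (metis act_closed act_mult act_one mult.commute)

lemma T_inv [simp]: "x \<in> T \<Longrightarrow> inv x \<in> T"
  using T_act[of x "- 1"] by (simp add: act_minus)

lemma T_act_iff: "z \<noteq> 0 \<Longrightarrow> x \<in> carrier G \<Longrightarrow> act z x \<in> T \<longleftrightarrow> x \<in> T"
proof
  assume "z \<noteq> 0" "x \<in> carrier G" "act z x \<in> T"
  then obtain w where "w \<noteq> 0" "act w (act z x) = \<one>" unfolding T_iff by blast
  then show "x \<in> T"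
    using \<open>z \<noteq> 0\<close> \<open>x \<in> carrier G\<close> unfolding T_iff by (metis act_mult mult_eq_0_iff)
qed simp

text \<open>Equality in the quotient by torsion, kept as a relation on representatives.\<close>

definition eqT :: "'a \<Rightarrow> 'a \<Rightarrow> bool" where
  "eqT x y \<longleftrightarrow> x \<in> carrier G \<and> y \<in> carrier G \<and> x \<otimes> inv y \<in> T"

lemma eqTD: "eqT x y \<Longrightarrow> x \<in> carrier G" "eqT x y \<Longrightarrow> y \<in> carrier G"
  by (simp_all add: eqT_def)

lemma eqT_refl: "x \<in> carrier G \<Longrightarrow> eqT x x"
  by (simp add: eqT_def)

lemma eqT_sym: "eqT x y \<Longrightarrow> eqT y x"
  using T_inv[of "x \<otimes> inv y"] by (auto simp: eqT_def inv_mult_group)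

lemma eqT_trans [trans]: "eqT x y \<Longrightarrow> eqT y z \<Longrightarrow> eqT x z"
proof -
  assume *: "eqT x y" "eqT y z"
  then have "(x \<otimes> inv y) \<otimes> (y \<otimes> inv z) \<in> T" by (simp add: eqT_def)
  also have "(x \<otimes> inv y) \<otimes> (y \<otimes> inv z) = x \<otimes> inv z"
    using * by (metis eqTD inv_closed inv_solve_left m_assoc m_closed)
  finally show ?thesis using * by (simp add: eqT_def)
qed

lemma eqT_mult: "eqT x y \<Longrightarrow> eqT x' y' \<Longrightarrow> eqT (x \<otimes> x') (y \<otimes> y')"
proof -
  assume *: "eqT x y" "eqT x' y'"
  then have "(x \<otimes> inv y) \<otimes> (x' \<otimes> inv y') \<in> T" by (simp add: eqT_def)
  also have "(x \<otimes> inv y) \<otimes> (x' \<otimes> inv y') = (x \<otimes> x') \<otimes> inv (y \<otimes> y')"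
    using * by (simp add: eqT_def inv_mult m_ac)
  finally show ?thesis using * by (simp add: eqT_def)
qed

lemma eqT_act: "eqT x y \<Longrightarrow> eqT (act z x) (act z y)"
proof -
  assume *: "eqT x y"
  then have "act z (x \<otimes> inv y) \<in> T" by (simp add: eqT_def)
  then show ?thesis using * by (simp add: eqT_def act_distrib act_inv)
qed

lemma eqT_inv: "eqT x y \<Longrightarrow> eqT (inv x) (inv y)"
  using eqT_act[of x y "- 1"] by (auto simp: act_minus eqTD)

lemma eqT_T: "eqT x y \<Longrightarrow> x \<in> T \<longleftrightarrow> y \<in> T"
proof -
  have *: "x \<in> T" if "eqT x y" "y \<in> T" for x y
  proof -
    have "(x \<otimes> inv y) \<otimes> y \<in> T" using that by (simp add: eqT_def)
    then show ?thesis using that by (simp add: eqT_def m_assoc)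
  qed
  then show "eqT x y \<Longrightarrow> x \<in> T \<longleftrightarrow> y \<in> T" using eqT_sym by blast
qed

lemma eqT_act_cancel: "z \<noteq> 0 \<Longrightarrow> x \<in> carrier G \<Longrightarrow> y \<in> carrier G \<Longrightarrow> eqT (act z x) (act z y) \<Longrightarrow> eqT x y"
  using T_act_iff[of z "x \<otimes> inv y"] by (simp add: eqT_def act_distrib act_inv)

lemma eqT_diff:
  assumes "eqT x (a \<otimes> b)" "a \<in> carrier G" "b \<in> carrier G"
  shows "eqT (x \<otimes> inv a) b"
proof -
  have "eqT (x \<otimes> inv a) ((a \<otimes> b) \<otimes> inv a)"
    using assms by (intro eqT_mult eqT_refl) auto
  also have "(a \<otimes> b) \<otimes> inv a = b" using assms(2,3) by (metis inv_closed m_assoc m_comm r_inv r_one)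
  finally show ?thesis .
qed

lemma has_rank_0I:
  assumes "carrier G \<subseteq> T"
  shows "has_rank G 0"
proof -
  \<comment> \<open>The only element of a product over the empty index set is the function that is
    \<open>undefined\<close> everywhere.\<close>
  define f where "f x = ((\<lambda>i::nat. undefined :: int), x)" for x :: 'a
  have "f \<in> iso G (product_group {..<0} (\<lambda>_. integer_group) \<times>\<times> torsion_group G)"
    unfolding iso_def hom_def
    using assms by (auto simp: f_def torsion_group_def bij_betw_def inj_on_def mult_DirProd' restrict_def)
  then show ?thesis unfolding has_rank_def is_iso_def by blast
qed

text \<open>Modulo torsion the group is free of rank one over the Gaussian integers, with basis
  \<open>g\<close>. The coefficient \<open>c x\<close> is unique and additive, so \<open>x\<close>
  corresponds to the pair consisting of \<open>c x\<close>, read as two integers, and the torsion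
  remainder of \<open>x\<close> after subtracting \<open>c x\<close> times \<open>g\<close>.\<close>

lemma has_rank_2I:
  assumes g: "g \<in> carrier G" "g \<notin> T" and gen: "\<And>x. x \<in> carrier G \<Longrightarrow> \<exists>k. eqT x (act k g)"
  shows "has_rank G 2"
proof -
  have uniq: "k = l" if "eqT (act k g) (act l g)" for k l
  proof (rule ccontr)
    assume "k \<noteq> l"
    have "act (k - l) g \<in> T" using that g(1) by (simp add: eqT_def act_diff)
    then show False using T_act_iff[of "k - l" g] g \<open>k \<noteq> l\<close> by simp
  qed
  define c where "c x = (SOME k. eqT x (act k g))" for x
  have c: "eqT x (act (c x) g)" if "x \<in> carrier G" for x
    unfolding c_def by (rule someI_ex) (rule gen[OF that])
  have c_eq: "c x = k" if "eqT x (act k g)" for x k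
    by (rule uniq) (rule eqT_trans[OF eqT_sym[OF c[OF eqTD(1)[OF that]]] that])
  have c_mult: "c (x \<otimes> y) = c x + c y" if "x \<in> carrier G" "y \<in> carrier G" for x y
    using eqT_mult[OF c c] that g(1) by (intro c_eq) (simp add: act_add)
  define r where "r x = x \<otimes> inv (act (c x) g)" for x
  have r_T: "r x \<in> T" if "x \<in> carrier G" for x
    using c[OF that] by (simp add: r_def eqT_def)
  have r_mult: "r (x \<otimes> y) = r x \<otimes> r y" if "x \<in> carrier G" "y \<in> carrier G" for x y
    using that g(1) by (simp add: r_def c_mult act_add inv_mult m_ac)
  have decomp: "x = act (c x) g \<otimes> r x" if "x \<in> carrier G" for x
  proof -
    have "act (c x) g \<otimes> (x \<otimes> inv (act (c x) g)) = x \<otimes> (act (c x) g \<otimes> inv (act (c x) g))"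
      using that g(1) by (intro m_lcomm) simp_all
    then show ?thesis using that g(1) by (simp add: r_def)
  qed
  define e where "e k = (\<lambda>i\<in>{..<2::nat}. if i = 0 then gre k else gim k)" for k
  have e_PiE: "e k \<in> {..<2} \<rightarrow>\<^sub>E UNIV" for k by (simp add: e_def)
  have e_add: "e (k + l) = (\<lambda>i\<in>{..<2}. e k i + e l i)" for k l by (auto simp: e_def)
  have e_inj: "k = l" if "e k = e l" for k l
  proof -
    have "e k 0 = e l 0" "e k 1 = e l 1" using that by simp_all
    then show ?thesis by (simp add: e_def gint_eq_iff)
  qed
  have e_surj: "e (Gint (h 0) (h 1)) = h" if "h \<in> {..<2} \<rightarrow>\<^sub>E UNIV" for h
  proof
    fix i :: nat
    consider "i = 0" | "i = 1" | "i \<notin> {..<2}" unfolding lessThan_iff by linarith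
    then show "e (Gint (h 0) (h 1)) i = h i"
      by cases (simp_all add: e_def PiE_arb[OF that])
  qed
  define f where "f x = (e (c x), r x)" for x
  let ?H = "product_group {..<2::nat} (\<lambda>_. integer_group) \<times>\<times> torsion_group G"
  have H: "carrier ?H = ({..<2} \<rightarrow>\<^sub>E UNIV) \<times> T"
    by (simp add: torsion_group_def)
  have "f \<in> iso G ?H"
    unfolding iso_def hom_def
  proof (intro CollectI conjI ballI)
    show "f \<in> carrier G \<rightarrow> carrier ?H"
      unfolding H using e_PiE r_T by (simp add: f_def)
    fix x y assume "x \<in> carrier G" "y \<in> carrier G"
    then show "f (x \<otimes> y) = f x \<otimes>\<^bsub>?H\<^esub> f y"
      by (simp add: f_def c_mult r_mult e_add torsion_group_def)
  next
    show "bij_betw f (carrier G) (carrier ?H)"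
      unfolding bij_betw_def
    proof (rule conjI; (intro inj_onI equalityI subsetI)?)
      fix x y assume "x \<in> carrier G" "y \<in> carrier G" "f x = f y"
      then have "c x = c y" "r x = r y" using e_inj by (simp_all add: f_def)
      then show "x = y"
        using decomp[OF \<open>x \<in> carrier G\<close>] decomp[OF \<open>y \<in> carrier G\<close>] by simp
    next
      fix p assume "p \<in> f ` carrier G"
      then show "p \<in> carrier ?H"
        unfolding H f_def using e_PiE r_T by blast
    next
      fix p assume "p \<in> carrier ?H"
      then obtain h t where p: "p = (h, t)" "h \<in> {..<2} \<rightarrow>\<^sub>E UNIV" "t \<in> T"
        unfolding H by blast
      define k where "k = Gint (h 0) (h 1)"
      define x where "x = act k g \<otimes> t"
      have x: "x \<in> carrier G" using p g by (simp add: x_def)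
      have *: "x \<otimes> inv (act k g) = t"
        using p g by (simp add: x_def m_comm[of _ t] m_assoc)
      then have "eqT x (act k g)" using x p g by (simp add: eqT_def)
      then have "c x = k" by (rule c_eq)
      then have "f x = p" using * e_surj[OF p(2)] by (simp add: f_def r_def p(1) k_def)
      then show "p \<in> f ` carrier G" using x by blast
    qed
  qed
  then show ?thesis unfolding has_rank_def is_iso_def by blast
qed

text \<open>Multiplication by \<open>N\<close> embeds the quotient by torsion into the multiples of
  \<open>Q\<close>. The coefficients form an ideal, whose nonzero part is \<open>J\<close>; one of
  least norm generates it by division with remainder, and a point \<open>g\<close> with that
  coefficient generates everything modulo torsion.\<close>

lemma has_rank_2_commensurable:
  assumes Q: "Q \<in> carrier G" "Q \<notin> T" and N: "N \<noteq> 0"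
    and comm: "\<And>x. x \<in> carrier G \<Longrightarrow> \<exists>c. eqT (act N x) (act c Q)"
  shows "has_rank G 2"
proof -
  define J where "J = {c. c \<noteq> 0 \<and> (\<exists>x \<in> carrier G. eqT (act N x) (act c Q))}"
  have "N \<in> J" using N Q by (auto simp: J_def intro!: bexI[of _ Q] eqT_refl)
  then obtain c0 where c0: "c0 \<in> J" and min: "\<And>c. c \<in> J \<Longrightarrow> gnorm c0 \<le> gnorm c"
    using ex_has_least_nat[of "\<lambda>c. c \<in> J" N gnorm] by blast
  from c0 obtain g where g: "c0 \<noteq> 0" "g \<in> carrier G" "eqT (act N g) (act c0 Q)" by (auto simp: J_def)
  have "act c0 Q \<notin> T" using T_act_iff g(1) Q by blast
  then have "g \<notin> T" using eqT_T[OF g(3)] T_act by blast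
  then show ?thesis
  proof (rule has_rank_2I[OF g(2)])
    fix x assume x: "x \<in> carrier G"
    from comm[OF x] obtain c where c: "eqT (act N x) (act c Q)" by blast
    define k where "k = c div c0"
    have r: "c mod c0 = c - k * c0" by (simp add: k_def minus_div_mult_eq_mod)
    have 1: "eqT (act N (act k g)) (act (k * c0) Q)"
    proof -
      have "act N (act k g) = act k (act N g)" using g(2) by (metis act_mult mult.commute)
      moreover have "act (k * c0) Q = act k (act c0 Q)" using Q by (simp add: act_mult)
      ultimately show ?thesis using eqT_act[OF g(3)] by simp
    qed
    have "eqT (act N (x \<otimes> inv (act k g))) (act (c mod c0) Q)"
      unfolding r using eqT_mult[OF c eqT_inv[OF 1]] x g(2) Q
      by (simp add: act_distrib act_inv act_diff)
    moreover have "gnorm (c mod c0) < gnorm c0"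
      using mod_size_less[OF g(1), of c] by (simp add: euclidean_size_gint_def)
    moreover have "x \<otimes> inv (act k g) \<in> carrier G" using x g(2) by simp
    ultimately have "c mod c0 = 0"
      using min[of "c mod c0"] unfolding J_def mem_Collect_eq by (meson leD)
    then have "c = k * c0" using r by simp
    then have "eqT (act N x) (act N (act k g))" using c 1 eqT_trans eqT_sym by blast
    then have "eqT x (act k g)" by (rule eqT_act_cancel[OF N x act_closed[OF g(2)]])
    then show "\<exists>k. eqT x (act k g)" ..
  qed
qed

end

lemma torsion_set_iso:
  assumes "group G" "group H" "f \<in> iso G H" "x \<in> carrier G"
  shows "f x \<in> torsion_set H \<longleftrightarrow> x \<in> torsion_set G"
proof -
  have f: "f \<in> hom G H" "inj_on f (carrier G)" "f ` carrier G = carrier H"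
    using assms(3) by (simp_all add: iso_def bij_betw_def)
  have "f x [^]\<^bsub>H\<^esub> n = \<one>\<^bsub>H\<^esub> \<longleftrightarrow> x [^]\<^bsub>G\<^esub> n = \<one>\<^bsub>G\<^esub>" for n :: nat
  proof -
    have "f x [^]\<^bsub>H\<^esub> n = f (x [^]\<^bsub>G\<^esub> n)"
      using hom_nat_pow[OF f(1) assms(4,1,2)] by simp
    moreover have "\<one>\<^bsub>H\<^esub> = f \<one>\<^bsub>G\<^esub>" using hom_one[OF f(1) assms(1,2)] by simp
    moreover have "x [^]\<^bsub>G\<^esub> n \<in> carrier G" "\<one>\<^bsub>G\<^esub> \<in> carrier G"
      using assms(1,4) by (simp_all add: group.is_monoid monoid.nat_pow_closed)
    ultimately show ?thesis using f(2) by (simp add: inj_on_eq_iff)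
  qed
  moreover have "f x \<in> carrier H" using f(3) assms(4) by blast
  ultimately show ?thesis using assms(4) by (simp add: torsion_set_def)
qed

text \<open>The definition of \<open>has_rank\<close> mentions the torsion of the group itself, so
  the torsion factor has to be moved along the isomorphism as well.\<close>

lemma has_rank_iso:
  assumes "group G" "group H" "f \<in> iso G H" "has_rank H r"
  shows "has_rank G r"
proof -
  let ?Z = "product_group {..<r} (\<lambda>_. integer_group)"
  from assms(4) obtain g where g: "g \<in> iso H (?Z \<times>\<times> torsion_group H)"
    unfolding has_rank_def is_iso_def by blast
  define f' where "f' = inv_into (carrier G) f"
  have f': "f' \<in> iso H G" unfolding f'_def by (rule group.iso_set_sym[OF assms(1,3)])
  have bij: "bij_betw f' (torsion_set H) (torsion_set G)"
    unfolding bij_betw_def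
  proof (rule conjI)
    have "torsion_set H \<subseteq> carrier H" by (auto simp: torsion_set_def)
    then show "inj_on f' (torsion_set H)"
      using f' unfolding iso_def bij_betw_def by (auto intro: inj_on_subset)
    show "f' ` torsion_set H = torsion_set G"
    proof (intro equalityI subsetI)
      fix x assume "x \<in> f' ` torsion_set H"
      then obtain y where "x = f' y" "y \<in> torsion_set H" "y \<in> carrier H"
        by (auto simp: torsion_set_def)
      then show "x \<in> torsion_set G" using torsion_set_iso[OF assms(2,1) f'] by simp
    next
      fix x assume x: "x \<in> torsion_set G"
      then have "x \<in> carrier G" by (simp add: torsion_set_def)
      moreover have "carrier G = f' ` carrier H" using f' by (simp add: iso_def bij_betw_def)
      ultimately obtain y where "x = f' y" "y \<in> carrier H" by blast
      then show "x \<in> f' ` torsion_set H" using x torsion_set_iso[OF assms(2,1) f'] by blast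
    qed
  qed
  have "(\<lambda>(z, t). (z, f' t)) \<in> iso (?Z \<times>\<times> torsion_group H) (?Z \<times>\<times> torsion_group G)"
    unfolding iso_def hom_def
  proof (intro CollectI conjI)
    show "bij_betw (\<lambda>(z, t). (z, f' t)) (carrier (?Z \<times>\<times> torsion_group H)) (carrier (?Z \<times>\<times> torsion_group G))"
      using bij unfolding bij_betw_def
      by (auto simp: torsion_group_def inj_on_def) (force simp: image_iff)
    show "(\<lambda>(z, t). (z, f' t)) \<in> carrier (?Z \<times>\<times> torsion_group H) \<rightarrow> carrier (?Z \<times>\<times> torsion_group G)"
      using bij unfolding bij_betw_def by (auto simp: torsion_group_def)
    have "f' (x \<otimes>\<^bsub>H\<^esub> y) = f' x \<otimes>\<^bsub>G\<^esub> f' y" if "x \<in> torsion_set H" "y \<in> torsion_set H" for x y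
      using f' that by (auto simp: iso_def hom_def torsion_set_def)
    then show "\<forall>x\<in>carrier (?Z \<times>\<times> torsion_group H). \<forall>y\<in>carrier (?Z \<times>\<times> torsion_group H).
       (\<lambda>(z, t). (z, f' t)) (x \<otimes>\<^bsub>?Z \<times>\<times> torsion_group H\<^esub> y)
       = (\<lambda>(z, t). (z, f' t)) x \<otimes>\<^bsub>?Z \<times>\<times> torsion_group G\<^esub> (\<lambda>(z, t). (z, f' t)) y"
      by (auto simp: torsion_group_def)
  qed
  then have "?Z \<times>\<times> torsion_group H \<cong> ?Z \<times>\<times> torsion_group G" unfolding is_iso_def by blast
  moreover have "G \<cong> H" "H \<cong> ?Z \<times>\<times> torsion_group H"
    using assms(3) g unfolding is_iso_def by blast+
  ultimately show ?thesis unfolding has_rank_def by (blast intro: iso_trans)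
qed

section \<open>Descent to a common multiple\<close>

context gauss_module
begin

text \<open>Heights above \<open>C\<close> drop strictly, so the descent reaches the finite set
  \<open>S\<close>, and from then on it stays there. Continued long enough inside \<open>S\<close>
  it repeats a point, which forces a relation between \<open>x\<close> and \<open>Q\<close> modulo
  torsion. As every point is a multiple of \<open>Q\<close> plus a power of \<open>t\<close> applied
  to an element of \<open>S\<close>, the product of the annihilators over \<open>S\<close> works for
  all points at once.\<close>

lemma commensurable_descent:
  fixes h :: "'a \<Rightarrow> nat"
  assumes Q: "Q \<in> carrier G" and t: "gnorm t > 1"
    and fin: "\<And>B. finite {x \<in> carrier G. h x \<le> B}"
    and step: "\<And>x. x \<in> carrier G \<Longrightarrow> \<exists>c. \<exists>y \<in> carrier G. eqT x (act c Q \<otimes> act t y) \<and> h y ^ 2 \<le> C * h x"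
  shows "\<exists>N. N \<noteq> 0 \<and> (\<forall>x \<in> carrier G. \<exists>c. eqT (act N x) (act c Q))"
proof -
  define S where "S = {x \<in> carrier G. h x \<le> C}"
  have S: "x \<in> carrier G" if "x \<in> S" for x using that by (simp add: S_def)
  have stepS: "\<exists>c. \<exists>y \<in> S. eqT x (act c Q \<otimes> act t y)" if "x \<in> S" for x
  proof -
    obtain c y where y: "y \<in> carrier G" "eqT x (act c Q \<otimes> act t y)" "h y ^ 2 \<le> C * h x"
      using step[OF S[OF \<open>x \<in> S\<close>]] by blast
    have "h x \<le> C" using that by (simp add: S_def)
    then have "h y ^ 2 \<le> C * C" using y(3) by (meson le_trans mult_le_mono2)
    then have "h y \<le> C" unfolding power2_eq_square[symmetric] by (simp add: power2_nat_le_eq_le)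
    then show ?thesis using y by (auto simp: S_def)
  qed
  have combine: "eqT x (act (c + t ^ n * c') Q \<otimes> act (t ^ (n + m)) z)"
    if "eqT x (act c Q \<otimes> act (t ^ n) y)" "eqT y (act c' Q \<otimes> act (t ^ m) z)" "z \<in> carrier G"
    for x y z c c' n m
  proof -
    note that(1)
    also have "eqT (act c Q \<otimes> act (t ^ n) y) (act c Q \<otimes> act (t ^ n) (act c' Q \<otimes> act (t ^ m) z))"
      using Q that by (intro eqT_mult eqT_refl eqT_act) simp_all
    also have "act c Q \<otimes> act (t ^ n) (act c' Q \<otimes> act (t ^ m) z)
        = act (c + t ^ n * c') Q \<otimes> act (t ^ (n + m)) z"
      using Q that(3) by (simp add: act_distrib act_add act_mult power_add m_assoc)
    finally show ?thesis .
  qed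
  have reach: "\<exists>n c. \<exists>y \<in> S. eqT x (act c Q \<otimes> act (t ^ n) y)" if "x \<in> carrier G" for x
    using that
  proof (induction "h x" arbitrary: x rule: less_induct)
    case less
    show ?case
    proof (cases "h x \<le> C")
      case True
      then have "x \<in> S" "eqT x (act 0 Q \<otimes> act (t ^ 0) x)"
        using less.prems by (simp_all add: S_def eqT_refl)
      then show ?thesis by blast
    next
      case False
      obtain c y where y: "y \<in> carrier G" "eqT x (act c Q \<otimes> act t y)" "h y ^ 2 \<le> C * h x"
        using step[OF less.prems] by blast
      have "h y ^ 2 < h x ^ 2"
        using y(3) False by (metis le_less_trans linorder_not_le mult_less_cancel2 not_less_zero power2_eq_square not_gr_zero)
      then have "h y < h x" by (rule power_less_imp_less_base) simp
      then obtain n c' z where "z \<in> S" "eqT y (act c' Q \<otimes> act (t ^ n) z)"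
        using less.hyps[OF _ y(1)] by blast
      then have "eqT x (act (c + t ^ 1 * c') Q \<otimes> act (t ^ (1 + n)) z)"
        using y(2) by (intro combine[of x c 1 y]) (simp_all add: S)
      then show ?thesis using \<open>z \<in> S\<close> by blast
    qed
  qed
  have iterate: "\<exists>c. \<exists>y \<in> S. eqT x (act c Q \<otimes> act (t ^ n) y)" if "x \<in> S" for x n
  proof (induction n)
    case 0
    have "eqT x (act 0 Q \<otimes> act (t ^ 0) x)" using that by (simp add: S eqT_refl)
    then show ?case using that by blast
  next
    case (Suc n)
    then obtain c y where y: "y \<in> S" "eqT x (act c Q \<otimes> act (t ^ n) y)" by blast
    from stepS[OF y(1)] obtain c' z where z: "z \<in> S" "eqT y (act c' Q \<otimes> act t z)" by blast
    have "eqT x (act (c + t ^ n * c') Q \<otimes> act (t ^ (n + 1)) z)"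
      using y z by (intro combine) (simp_all add: S)
    then show ?case using z(1) by auto
  qed
  have ann: "\<exists>N c. N \<noteq> 0 \<and> eqT (act N x) (act c Q)" if x: "x \<in> S" for x
  proof -
    obtain c y where y: "\<And>n. y n \<in> S" "\<And>n. eqT x (act (c n) Q \<otimes> act (t ^ n) (y n))"
      using iterate[OF x] by metis
    have "finite S" unfolding S_def by (rule fin)
    then have "\<not> inj y" using y(1) by (metis finite_subset image_subsetI infinite_UNIV_nat range_inj_infinite)
    \<comment> \<open>Pigeonhole: with equal remainders at the levels \<open>n < m\<close>, one gets
      \<open>t^(m-n) (x - c n Q) = x - c m Q\<close> modulo torsion, so \<open>t^(m-n) - 1\<close>
      carries \<open>x\<close> to a multiple of \<open>Q\<close>.\<close>
    then obtain n m where nm: "n < m" "y n = y m" by (metis injI linorder_neqE_nat)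
    have d: "eqT (x \<otimes> inv (act (c k) Q)) (act (t ^ k) (y k))" for k
      using y Q S by (intro eqT_diff) simp_all
    have "eqT (act (t ^ (m - n)) (x \<otimes> inv (act (c n) Q))) (act (t ^ (m - n)) (act (t ^ n) (y n)))"
      by (rule eqT_act[OF d])
    also have "act (t ^ (m - n)) (act (t ^ n) (y n)) = act (t ^ m) (y m)"
      using nm y(1) S by (simp flip: act_mult power_add)
    also have "eqT (act (t ^ m) (y m)) (x \<otimes> inv (act (c m) Q))" by (rule eqT_sym[OF d])
    finally have "eqT (act (t ^ (m - n)) (x \<otimes> inv (act (c n) Q))) (x \<otimes> inv (act (c m) Q))" .
    then have e: "eqT (act (t ^ (m - n)) x \<otimes> inv (act (t ^ (m - n) * c n) Q)) (x \<otimes> inv (act (c m) Q))"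
      using S[OF x] Q by (simp add: act_distrib act_inv act_mult)
    define a b b' where "a = act (t ^ (m - n)) x" and "b = act (t ^ (m - n) * c n) Q"
      and "b' = act (c m) Q"
    have C: "x \<in> carrier G" "a \<in> carrier G" "b \<in> carrier G" "b' \<in> carrier G"
      using S[OF x] Q by (simp_all add: a_def b_def b'_def)
    have "eqT ((a \<otimes> inv b) \<otimes> (b \<otimes> inv x)) ((x \<otimes> inv b') \<otimes> (b \<otimes> inv x))"
      using e C unfolding a_def[symmetric] b_def[symmetric] b'_def[symmetric]
      by (rule_tac eqT_mult[OF _ eqT_refl]) simp_all
    moreover have "(a \<otimes> inv b) \<otimes> (b \<otimes> inv x) = (inv b \<otimes> b) \<otimes> (a \<otimes> inv x)"
      using C by (simp only: m_ac inv_closed m_closed)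
    moreover have "(x \<otimes> inv b') \<otimes> (b \<otimes> inv x) = (inv x \<otimes> x) \<otimes> (b \<otimes> inv b')"
      using C by (simp only: m_ac inv_closed m_closed)
    ultimately have "eqT (a \<otimes> inv x) (b \<otimes> inv b')" using C by simp
    then have "eqT (act (t ^ (m - n) - 1) x) (act (t ^ (m - n) * c n - c m) Q)"
      using C Q by (simp add: a_def b_def b'_def act_diff)
    moreover have "t ^ (m - n) - 1 \<noteq> 0"
    proof
      assume "t ^ (m - n) - 1 = 0"
      then have "gnorm (t ^ (m - n)) = 1" by simp
      moreover have "gnorm (t ^ k) = gnorm t ^ k" for k by (induction k) (simp_all add: gnorm_mult)
      ultimately show False using t nm(1) by (simp add: power_eq_1_iff)
    qed
    ultimately show ?thesis by blast
  qed
  then obtain f g where fg: "\<And>x. x \<in> S \<Longrightarrow> f x \<noteq> 0" "\<And>x. x \<in> S \<Longrightarrow> eqT (act (f x) x) (act (g x) Q)"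
    by metis
  define N where "N = prod f S"
  have "finite S" unfolding S_def by (rule fin)
  then have "N \<noteq> 0" unfolding N_def using fg(1) by simp
  moreover have "\<exists>c. eqT (act N x) (act c Q)" if x: "x \<in> carrier G" for x
  proof -
    obtain n c y where y: "y \<in> S" "eqT x (act c Q \<otimes> act (t ^ n) y)" using reach[OF x] by blast
    define M where "M = prod f (S - {y})"
    have N: "N = M * f y" unfolding N_def M_def using prod.remove[OF \<open>finite S\<close> y(1), of f] by (simp add: mult.commute)
    have "eqT (act N x) (act N (act c Q \<otimes> act (t ^ n) y))" by (rule eqT_act[OF y(2)])
    also have "act N (act c Q \<otimes> act (t ^ n) y) = act (N * c) Q \<otimes> act (t ^ n * M) (act (f y) y)"
      using Q S[OF y(1)] by (simp add: N act_distrib ac_simps flip: act_mult)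
    also have "eqT (act (N * c) Q \<otimes> act (t ^ n * M) (act (f y) y)) (act (N * c) Q \<otimes> act (t ^ n * M) (act (g y) Q))"
      using Q by (intro eqT_mult eqT_refl eqT_act fg(2) y(1)) simp
    also have "act (N * c) Q \<otimes> act (t ^ n * M) (act (g y) Q) = act (N * c + t ^ n * M * g y) Q"
      using Q by (simp add: act_add flip: act_mult)
    finally show ?thesis by blast
  qed
  ultimately show ?thesis by blast
qed

end

section \<open>Heights\<close>

definition cg :: "gint \<Rightarrow> complex" where
  "cg z = of_int (gre z) + of_int (gim z) * \<i>"

lemma cg_simps [simp]:
  "cg 0 = 0" "cg 1 = 1" "cg (z + w) = cg z + cg w" "cg (z - w) = cg z - cg w"
  "cg (- z) = - cg z" "cg (z * w) = cg z * cg w" "cg imag = \<i>"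
  by (simp_all add: cg_def algebra_simps)

lemma cg_power [simp]: "cg (z ^ n) = cg z ^ n"
  by (induction n) simp_all

lemma cg_of_nat [simp]: "cg (of_nat n) = of_nat n"
  by (simp add: cg_def)

lemma cg_numeral [simp]: "cg (numeral n) = numeral n"
  using cg_of_nat[of "numeral n"] by simp

lemma cg_eq_iff [simp]: "cg z = cg w \<longleftrightarrow> z = w"
  by (simp add: cg_def complex_eq_iff gint_eq_iff)

lemma cg_eq_0_iff [simp]: "cg z = 0 \<longleftrightarrow> z = 0"
  using cg_eq_iff[of z 0] by simp

lemma cg_K [simp]: "cg z \<in> K"
  by (simp add: cg_def)

lemma norm_cg: "(norm (cg z))\<^sup>2 = real (gnorm z)"
proof -
  have "real (gnorm z) = real_of_int (int (gnorm z))" by simp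
  also have "\<dots> = (norm (cg z))\<^sup>2"
    unfolding int_gnorm by (simp add: cg_def cmod_power2)
  finally show ?thesis by simp
qed

lemma K_coprime_fraction:
  assumes "z \<in> K"
  obtains a b where "b \<noteq> 0" "z = cg a / cg b" "coprime a b"
proof -
  obtain r s where z: "z = of_rat r + of_rat s * \<i>" using assms by (rule K_E)
  obtain m n where r: "r = Rat.Fract m n" "n > 0" by (cases r rule: Rat_cases)
  obtain m' n' where s: "s = Rat.Fract m' n'" "n' > 0" by (cases s rule: Rat_cases)
  define a b :: gint where "a = Gint (m * n') (m' * n)" and "b = of_int (n * n')"
  have b: "b \<noteq> 0" using r s by (simp add: b_def gint_eq_iff)
  have zab: "z = cg a / cg b"
    unfolding z r(1) s(1) using r(2) s(2)
    by (simp add: of_rat_rat a_def b_def cg_def field_simps)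
  obtain a' b' where ab: "a = a' * gcd a b" "b = b' * gcd a b" "coprime a' b'"
    using gcd_coprime_exists[of a b] b by auto
  have "gcd a b \<noteq> 0" using b by simp
  then have "z = cg a' / cg b'"
    unfolding zab by (subst ab(1), subst ab(2)) (simp del: gcd_eq_0_iff)
  moreover have "b' \<noteq> 0" using ab(2) b by auto
  ultimately show thesis using that ab(3) by blast
qed

lemma coprime_fraction_unique:
  assumes "b \<noteq> 0" "s \<noteq> 0" "cg a / cg b = cg r / cg s" "coprime a b"
  obtains k where "k \<noteq> 0" "r = k * a" "s = k * b"
proof -
  have "cg (a * s) = cg (r * b)" using assms(1-3) by (simp add: field_simps)
  then have *: "a * s = r * b" unfolding cg_eq_iff .
  then have "b dvd a * s" by simp
  then have "b dvd s" using assms(4) by (simp add: coprime_commute coprime_dvd_mult_right_iff)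
  then obtain k where "s = b * k" by (elim dvdE)
  then have k: "s = k * b" by (simp add: mult.commute)
  have "(r - k * a) * b = r * b - a * s" by (simp add: k algebra_simps)
  then have "r = k * a" using assms(1) * by simp
  then show thesis using that k assms(2) by auto
qed

lemma gnorm_ge_1: "z \<noteq> 0 \<Longrightarrow> 1 \<le> gnorm z"
  by (metis gnorm_eq_0_iff less_one not_le)

lemma gnorm_dvd_le: "a dvd b \<Longrightarrow> b \<noteq> 0 \<Longrightarrow> gnorm a \<le> gnorm b"
proof -
  assume *: "a dvd b" "b \<noteq> 0"
  then obtain k where k: "b = a * k" by (elim dvdE)
  then have "k \<noteq> 0" using *(2) by auto
  then show ?thesis unfolding k gnorm_mult using mult_le_mono2[OF gnorm_ge_1, of k "gnorm a"] by simp
qed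

lemma K_integrally_closed:
  assumes "z \<in> K" "z ^ 2 = cg n"
  obtains w where "z = cg w"
proof -
  obtain a b where ab: "b \<noteq> 0" "z = cg a / cg b" "coprime a b"
    using assms(1) by (rule K_coprime_fraction)
  have "cg (a ^ 2) = cg (b ^ 2 * n)" using assms(2) ab by (simp add: field_simps)
  then have "a ^ 2 = b ^ 2 * n" unfolding cg_eq_iff .
  then have "b dvd a ^ 2" by (simp add: power2_eq_square)
  moreover have "coprime b (a ^ 2)" using ab(3) by (simp add: coprime_commute)
  ultimately have "is_unit b" by (meson coprime_common_divisor dvd_refl)
  then obtain c where c: "1 = b * c" by (elim dvdE)
  have "cg b * cg c = 1" using arg_cong[OF c, of cg] by simp
  moreover have "z * cg b = cg a" using ab by simp
  ultimately have "z = cg (a * c)" by (metis cg_simps(6) mult.assoc mult.right_neutral)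
  then show thesis using that by blast
qed

text \<open>Minimising over all fractions lets any fraction, cancelled or not, bound the height from
  above; by \<open>height_fraction\<close> the minimum is attained by a coprime one.\<close>

definition height :: "complex \<Rightarrow> nat" where
  "height u = (LEAST n. \<exists>a b. b \<noteq> 0 \<and> u = cg a / cg b \<and> gnorm a \<le> n \<and> gnorm b \<le> n)"

lemma height_le: "b \<noteq> 0 \<Longrightarrow> u = cg a / cg b \<Longrightarrow> gnorm a \<le> n \<Longrightarrow> gnorm b \<le> n \<Longrightarrow> height u \<le> n"
  unfolding height_def by (rule Least_le) blast

lemma height_fraction:
  assumes "u \<in> K"
  obtains a b where "b \<noteq> 0" "u = cg a / cg b" "coprime a b" "gnorm a \<le> height u" "gnorm b \<le> height u"
proof -
  obtain a b where ab: "b \<noteq> 0" "u = cg a / cg b" "coprime a b"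
    using assms by (rule K_coprime_fraction)
  then have "\<exists>n a b. b \<noteq> 0 \<and> u = cg a / cg b \<and> gnorm a \<le> n \<and> gnorm b \<le> n"
    by (intro exI[of _ "max (gnorm a) (gnorm b)"] exI[of _ a] exI[of _ b]) simp
  from LeastI_ex[OF this] obtain r s where
    rs: "s \<noteq> 0" "u = cg r / cg s" "gnorm r \<le> height u" "gnorm s \<le> height u"
    unfolding height_def[symmetric] by blast
  obtain k where k: "k \<noteq> 0" "r = k * a" "s = k * b"
    by (rule coprime_fraction_unique[of b s a r]) (use ab rs in auto)
  have "a dvd r" "b dvd s" using k by simp_all
  then have "gnorm b \<le> gnorm s" using rs(1) by (intro gnorm_dvd_le)
  moreover have "gnorm a \<le> gnorm r" using k(1,2) mult_le_mono1[OF gnorm_ge_1[of k], of "gnorm a"]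
    by (simp add: gnorm_mult)
  ultimately show thesis by (intro that[OF ab] le_trans[OF _ rs(3)] le_trans[OF _ rs(4)])
qed

lemma finite_gnorm_le: "finite {z. gnorm z \<le> B}"
proof -
  have "{z. gnorm z \<le> B} \<subseteq> (\<lambda>(x, y). Gint x y) ` ({- int B..int B} \<times> {- int B..int B})"
  proof
    fix z assume "z \<in> {z. gnorm z \<le> B}"
    then have *: "gre z ^ 2 + gim z ^ 2 \<le> int B" using int_gnorm[of z] by simp
    have abs: "\<bar>x\<bar> \<le> x ^ 2" for x :: int
      using self_le_power[of "\<bar>x\<bar>" 2] by (cases "x = 0") simp_all
    have "\<bar>gre z\<bar> \<le> int B" "\<bar>gim z\<bar> \<le> int B"
      using * abs[of "gre z"] abs[of "gim z"] zero_le_power2[of "gre z"] zero_le_power2[of "gim z"]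
      by linarith+
    then show "z \<in> (\<lambda>(x, y). Gint x y) ` ({- int B..int B} \<times> {- int B..int B})"
      by (intro image_eqI[of _ _ "(gre z, gim z)"]) (auto simp: abs_le_iff)
  qed
  then show ?thesis by (rule finite_subset) simp
qed

lemma finite_height_le: "finite {u \<in> K. height u \<le> B}"
proof -
  have "{u \<in> K. height u \<le> B} \<subseteq> (\<lambda>(a, b). cg a / cg b) ` ({z. gnorm z \<le> B} \<times> {z. gnorm z \<le> B})"
  proof
    fix u assume "u \<in> {u \<in> K. height u \<le> B}"
    then obtain a b where "u = cg a / cg b" "gnorm a \<le> B" "gnorm b \<le> B"
      by (auto elim!: height_fraction)
    then show "u \<in> (\<lambda>(a, b). cg a / cg b) ` ({z. gnorm z \<le> B} \<times> {z. gnorm z \<le> B})" by auto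
  qed
  then show ?thesis by (rule finite_subset) (simp add: finite_gnorm_le)
qed

lemma gnorm_add_le: "gnorm (a + b) \<le> 2 * (gnorm a + gnorm b)"
proof -
  have "int (gnorm (a + b)) \<le> 2 * (int (gnorm a) + int (gnorm b))"
    unfolding int_gnorm using zero_le_power2[of "gre a - gre b"] zero_le_power2[of "gim a - gim b"]
    by (simp add: power2_eq_square algebra_simps)
  then show ?thesis
    by (simp only: of_nat_le_iff[where 'a = int, symmetric] of_nat_add of_nat_mult of_nat_numeral)
qed

lemma gnorm_minus [simp]: "gnorm (- a) = gnorm a"
  by (simp add: gnorm_def)

lemma gnorm_of_nat [simp]: "gnorm (of_nat n) = n ^ 2"
  using gnorm_of_int[of "int n"] by (simp add: nat_power_eq)

lemma gnorm_power: "gnorm (a ^ n) = gnorm a ^ n"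
  by (induction n) (simp_all add: gnorm_mult)

locale gauss_quartic = jacobi_quartic "of_nat e" for e :: nat
begin

abbreviation qh :: "complex \<times> complex \<Rightarrow> nat" where "qh P \<equiv> height (fst P)"

lemma e_pos: "e > 0"
  using d_nonzero by simp

lemma finite_qh: "finite {P \<in> quartic (of_nat e). qh P \<le> B}"
proof -
  have "{P \<in> quartic (of_nat e). qh P \<le> B} \<subseteq> (SIGMA u:{u \<in> K. height u \<le> B}. {v. v ^ 2 = 1 + of_nat e * u ^ 4})"
    by (auto simp: quartic_def)
  moreover have "finite {v :: complex. v ^ 2 = c}" for c
  proof (cases "\<exists>w. w ^ 2 = c")
    case True
    then obtain w where "w ^ 2 = c" by blast
    then have "{v. v ^ 2 = c} \<subseteq> {w, - w}" by (auto simp: power2_eq_iff)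
    then show ?thesis by (rule finite_subset) simp
  qed simp
  ultimately show ?thesis
    using finite_height_le by (meson finite_SigmaI finite_subset)
qed

text \<open>Writing \<open>u = a / b\<close> in lowest terms, \<open>u'\<^sup>2 = 2 \<i> a\<^sup>2 b\<^sup>2 / (b\<^sup>4 + e a\<^sup>4)\<close>, where numerator and
  denominator have no common factor outside \<open>2 e\<close>.\<close>

lemma height_qtheta:
  assumes "P \<in> quartic (of_nat e)"
  shows "qh P ^ 2 \<le> (e ^ 2 + 3 * e) * qh (qtheta P)"
proof -
  obtain u v where P: "P = (u, v)" by (cases P)
  note facts = quarticD[OF assms[unfolded P]]
  note v = v_nonzero[OF assms[unfolded P]]
  obtain a b where ab: "b \<noteq> 0" "u = cg a / cg b" "coprime a b"
    using facts(1) by (elim K_coprime_fraction)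
  define u' where "u' = (1 + \<i>) * u / v"
  have u'K: "u' \<in> K" using facts by (simp add: u'_def)
  define h where "h = height u'"
  obtain r s where rs: "s \<noteq> 0" "u' = cg r / cg s" "gnorm r \<le> h" "gnorm s \<le> h"
    unfolding h_def using u'K by (elim height_fraction)
  define E :: gint where "E = of_nat e"
  define Y where "Y = b ^ 4 + E * a ^ 4"
  have cY: "cg Y = cg b ^ 4 * v ^ 2"
    unfolding facts(3) using ab(1,2) by (simp add: Y_def E_def distrib_left power_divide)
  then have Y: "Y \<noteq> 0" using ab(1) v by (metis cg_eq_0_iff mult_eq_0_iff power_eq_0_iff)
  have "(1 + \<i>) ^ 2 = 2 * \<i>" by (simp add: power2_eq_square algebra_simps)
  then have "u' ^ 2 * v ^ 2 = 2 * \<i> * u ^ 2"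
    unfolding u'_def using v by (simp add: power_divide power_mult_distrib)
  then have "(cg r / cg s) ^ 2 * cg Y = 2 * \<i> * (cg a / cg b) ^ 2 * cg b ^ 4"
    unfolding cY rs(2) ab(2) by (simp add: ac_simps)
  then have "cg (r ^ 2 * Y) = cg (2 * imag * a ^ 2 * b ^ 2 * s ^ 2)"
    using rs(1) ab(1) by (simp add: power_divide field_simps) (simp add: eval_nat_numeral ac_simps)
  then have eq: "r ^ 2 * Y = 2 * imag * a ^ 2 * b ^ 2 * s ^ 2" unfolding cg_eq_iff .
  have copY: "coprime Y (a ^ k)" for k
  proof -
    have "coprime a (b ^ 4)" using ab(3) by simp
    then have "coprime a Y" unfolding Y_def
      using gcd_add_mult[of a "E * a ^ 3" "b ^ 4"]
      by (simp add: coprime_iff_gcd_eq_1 eval_nat_numeral ac_simps)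
    then show ?thesis by (simp add: coprime_commute)
  qed
  have "a ^ 2 dvd r ^ 2 * Y" unfolding eq by simp
  then have a2: "a ^ 2 dvd E * r ^ 2"
    using copY[of 2] by (simp add: coprime_dvd_mult_left_iff coprime_commute)
  have "b ^ 2 dvd r ^ 2 * Y" unfolding eq by simp
  then have "b ^ 2 dvd r ^ 2 * (E * a ^ 4)"
    unfolding Y_def distrib_left by (subst (asm) dvd_add_right_iff) (simp_all add: le_imp_power_dvd)
  then have b2: "b ^ 2 dvd E * r ^ 2"
    using ab(3) by (simp add: coprime_dvd_mult_left_iff coprime_commute flip: mult.assoc) (simp add: ac_simps)
  have "(a * b) ^ 2 dvd E * r ^ 2"
    using a2 b2 ab(3) by (simp add: power_mult_distrib divides_mult)
  have NN: "gnorm a * gnorm b \<le> e * h"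
  proof (cases "r = 0")
    case True
    then have "a = 0" using eq ab(1) rs(1) by auto
    then show ?thesis by simp
  next
    case False
    then have "E * r ^ 2 \<noteq> 0" using e_pos by (simp add: E_def)
    then have "gnorm ((a * b) ^ 2) \<le> gnorm (E * r ^ 2)"
      using \<open>(a * b) ^ 2 dvd E * r ^ 2\<close> by (intro gnorm_dvd_le)
    also have "\<dots> = (e * gnorm r) ^ 2" by (simp add: gnorm_mult gnorm_power E_def power_mult_distrib)
    finally have "gnorm a * gnorm b \<le> e * gnorm r"
      by (simp add: gnorm_mult gnorm_power power2_nat_le_eq_le)
    then show ?thesis using rs(3) by (meson le_trans mult_le_mono2)
  qed
  have "Y dvd a ^ 2 * (2 * imag * b ^ 2 * s ^ 2)"
    using eq by (metis dvd_triv_right mult.assoc mult.left_commute)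
  then have "Y dvd 2 * imag * b ^ 2 * s ^ 2"
    using copY[of 2] by (simp add: coprime_dvd_mult_right_iff)
  \<comment> \<open>The extra \<open>b^2\<close> produces \<open>b^4 = Y - E a^4\<close>; so
    \<open>Y\<close> divides \<open>2 E a^4 s^2\<close> and, being coprime to \<open>a\<close>, also
    \<open>2 E s^2\<close>.\<close>
  then have "Y dvd (2 * imag * b ^ 2 * s ^ 2) * (- imag * b ^ 2)" by (rule dvd_mult2)
  also have "(2 * imag * b ^ 2 * s ^ 2) * (- imag * b ^ 2) = 2 * s ^ 2 * b ^ 4 * (- (imag * imag))"
    by (simp add: eval_nat_numeral ac_simps del: imag_mult_imag)
  also have "\<dots> = 2 * s ^ 2 * Y - a ^ 4 * (2 * E * s ^ 2)"
    by (simp add: Y_def algebra_simps)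
  finally have "Y dvd a ^ 4 * (2 * E * s ^ 2)"
    by (simp add: dvd_diff_right_iff)
  then have "Y dvd 2 * E * s ^ 2"
    using copY[of 4] by (simp add: coprime_dvd_mult_right_iff)
  moreover have "2 * E * s ^ 2 \<noteq> 0"
    using rs(1) e_pos by (simp add: E_def)
  ultimately have "gnorm Y \<le> gnorm (2 * E * s ^ 2)" by (rule gnorm_dvd_le)
  also have "\<dots> = (2 * e * gnorm s) ^ 2"
    using gnorm_of_nat[of 2] by (simp add: gnorm_mult gnorm_power E_def power_mult_distrib)
  also have "\<dots> \<le> (2 * e * h) ^ 2" using rs(4) by (simp add: power_mono)
  finally have "(norm (cg Y))\<^sup>2 \<le> (2 * e * h)\<^sup>2"
    unfolding norm_cg using of_nat_mono by fastforce
  then have nY: "norm (cg Y) \<le> 2 * e * h" by (simp add: abs_le_square_iff[symmetric])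
  have n4: "norm (cg x ^ 4) = real (gnorm x) ^ 2" for x
  proof -
    have "norm (cg x ^ 4) = ((norm (cg x))\<^sup>2)\<^sup>2" by (simp add: norm_power flip: power_mult)
    then show ?thesis by (simp only: norm_cg)
  qed
  have nE: "norm (of_nat e * cg a ^ 4) = e * real (gnorm a) ^ 2" by (simp add: norm_mult n4)
  have Y': "cg Y = cg b ^ 4 + of_nat e * cg a ^ 4" by (simp add: Y_def E_def)
  \<comment> \<open>A small \<open>Y\<close> keeps \<open>b^4\<close> close to
    \<open>- E a^4\<close>, so the norms of \<open>a\<close> and \<open>b\<close> are comparable,
    and the bound \<open>NN\<close> on their product bounds the square of the larger one.\<close>
  have "norm (cg b ^ 4) \<le> norm (cg Y) + norm (of_nat e * cg a ^ 4)"
    unfolding Y' by (metis add_diff_cancel_right' norm_triangle_ineq4)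
  then have 1: "gnorm b ^ 2 \<le> 2 * e * h + e * gnorm a ^ 2"
    using nY unfolding n4 nE by (simp flip: of_nat_power of_nat_mult of_nat_add of_nat_le_iff)
  have "norm (of_nat e * cg a ^ 4) \<le> norm (cg Y) + norm (cg b ^ 4)"
    unfolding Y' by (metis add_diff_cancel_left' norm_triangle_ineq4)
  then have 2: "e * gnorm a ^ 2 \<le> 2 * e * h + gnorm b ^ 2"
    using nY unfolding n4 nE by (simp flip: of_nat_power of_nat_mult of_nat_add of_nat_le_iff)
  have "height u \<le> max (gnorm a) (gnorm b)"
    using ab by (intro height_le[of b u a]) simp_all
  then have "height u ^ 2 \<le> (max (gnorm a) (gnorm b)) ^ 2" by (simp add: power_mono)
  also have "\<dots> \<le> (e ^ 2 + 3 * e) * h"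
  proof (cases "gnorm a \<le> gnorm b")
    case True
    have "gnorm b ^ 2 \<le> 2 * e * h + e * (gnorm a * gnorm b)"
      using 1 mult_le_mono2[OF mult_le_mono2[OF True], of e "gnorm a"]
      unfolding power2_eq_square by linarith
    also have "\<dots> \<le> 2 * e * h + e * (e * h)" using NN by simp
    also have "\<dots> \<le> (e ^ 2 + 3 * e) * h" by (simp add: power2_eq_square algebra_simps)
    finally show ?thesis using True by (simp add: max_def)
  next
    case False
    have "gnorm a ^ 2 \<le> e * gnorm a ^ 2" using e_pos by simp
    also note 2
    also have "gnorm b ^ 2 \<le> gnorm a * gnorm b" using False by (simp add: power2_eq_square)
    also note NN
    also have "2 * e * h + e * h \<le> (e ^ 2 + 3 * e) * h" by (simp add: algebra_simps)
    finally show ?thesis using False by (simp add: max_def)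
  qed
  finally show ?thesis
    unfolding P qtheta_eq[OF assms[unfolded P]] fst_conv h_def u'_def .
qed

text \<open>For \<open>u = a / b\<close> the number \<open>w = v b^2\<close> is integral, because
  its square is \<open>b^4 + e a^4\<close>, and its size is at most quadratic in \<open>a\<close>
  and \<open>b\<close>. Hence the sum with a fixed point is a fraction whose two terms grow at most
  quadratically.\<close>

lemma height_qadd:
  assumes "R \<in> quartic (of_nat e)"
  obtains C where "\<And>P. P \<in> quartic (of_nat e) \<Longrightarrow> qh (qadd (of_nat e) P R) \<le> C * qh P ^ 2"
proof -
  obtain u0 v0 where R: "R = (u0, v0)" by (cases R)
  note facts0 = quarticD[OF assms[unfolded R]]
  obtain a1 b1 where ab1: "b1 \<noteq> 0" "u0 = cg a1 / cg b1" using facts0(1) by (elim K_coprime_fraction)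
  obtain a2 b2 where ab2: "b2 \<noteq> 0" "v0 = cg a2 / cg b2" using facts0(2) by (elim K_coprime_fraction)
  define D a0 w0 where "D = b1 * b2" and "a0 = a1 * b2" and "w0 = a2 * b1"
  have D: "D \<noteq> 0" "u0 = cg a0 / cg D" "v0 = cg w0 / cg D"
    using ab1 ab2 by (simp_all add: D_def a0_def w0_def field_simps)
  define E :: gint where "E = of_nat e"
  define c where "c = 2 * (1 + e ^ 2)"
  define C1 where "C1 = gnorm D * (2 * (gnorm w0 + gnorm a0 * c))"
  define C2 where "C2 = 2 * (gnorm D ^ 2 + e ^ 2 * gnorm a0 ^ 2)"
  show thesis
  proof (rule that[of "C1 + C2"])
    fix P assume "P \<in> quartic (of_nat e)"
    then obtain u v where P: "P = (u, v)" "(u, v) \<in> quartic (of_nat e)" by (cases P) auto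
    note facts = quarticD[OF P(2)]
    define h where "h = height u"
    obtain a b where ab: "b \<noteq> 0" "u = cg a / cg b" "gnorm a \<le> h" "gnorm b \<le> h"
      unfolding h_def using facts(1) by (elim height_fraction)
    have "(v * cg b ^ 2) ^ 2 = cg (b ^ 4 + E * a ^ 4)"
      unfolding power_mult_distrib facts(3)
      using ab(1,2) by (simp add: E_def distrib_right power_divide flip: power_mult)
    moreover have "v * cg b ^ 2 \<in> K" using facts by simp
    ultimately obtain w where w: "v * cg b ^ 2 = cg w" using K_integrally_closed by metis
    have v: "v = cg w / cg b ^ 2" using w ab(1) by (simp add: field_simps)
    have "cg (w ^ 2) = cg (b ^ 4 + E * a ^ 4)" using \<open>(v * cg b ^ 2) ^ 2 = _\<close> by (simp add: w)
    then have w2: "w ^ 2 = b ^ 4 + E * a ^ 4" unfolding cg_eq_iff .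
    define r where "r = D * (a * b * w0 + a0 * w)"
    define s where "s = D ^ 2 * b ^ 2 - E * a0 ^ 2 * a ^ 2"
    have den: "1 - of_nat e * u ^ 2 * u0 ^ 2 = cg s / (cg D ^ 2 * cg b ^ 2)"
      using D(1) ab(1) by (simp add: s_def E_def D(2) ab(2) field_simps)
    have "s \<noteq> 0" using den_nonzero[OF facts(1) facts0(1)] unfolding den by auto
    have num: "u * v0 + u0 * v = cg r / (cg D ^ 2 * cg b ^ 2)"
      using D(1) ab(1) by (simp add: r_def D(2,3) ab(2) v field_simps power2_eq_square)
    have "fst (qadd (of_nat e) P R) = cg r / cg s"
      unfolding P(1) R qadd.simps fst_conv num den using D(1) ab(1) by simp
    moreover have "gnorm r \<le> (C1 + C2) * h ^ 2"
    proof -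
      have ab2: "gnorm (a * b) \<le> h ^ 2"
        unfolding gnorm_mult power2_eq_square using ab by (intro mult_le_mono)
      have "gnorm w ^ 2 = gnorm (b ^ 4 + E * a ^ 4)" by (simp add: w2 flip: gnorm_power)
      also have "\<dots> \<le> 2 * (gnorm b ^ 4 + e ^ 2 * gnorm a ^ 4)"
        using gnorm_add_le[of "b ^ 4" "E * a ^ 4"] by (simp add: gnorm_mult gnorm_power E_def)
      also have "\<dots> \<le> 2 * (h ^ 4 + e ^ 2 * h ^ 4)"
        using ab(3,4) by (intro mult_le_mono2 add_mono power_mono) simp_all
      also have "\<dots> = c * (h ^ 2) ^ 2" by (simp add: c_def algebra_simps flip: power_mult)
      also have "\<dots> \<le> c ^ 2 * (h ^ 2) ^ 2"
        by (intro mult_le_mono1) (simp add: c_def power2_eq_square)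
      finally have w: "gnorm w \<le> c * h ^ 2"
        unfolding power_mult_distrib[symmetric] by (simp add: power2_nat_le_eq_le)
      have "gnorm r \<le> gnorm D * (2 * (gnorm (a * b) * gnorm w0 + gnorm a0 * gnorm w))"
        unfolding r_def gnorm_mult using gnorm_add_le[of "a * b * w0" "a0 * w"]
        by (intro mult_le_mono2) (simp add: gnorm_mult)
      also have "\<dots> \<le> gnorm D * (2 * (h ^ 2 * gnorm w0 + gnorm a0 * (c * h ^ 2)))"
        using ab2 w by (intro mult_le_mono2 add_mono mult_le_mono1)
      also have "\<dots> = C1 * h ^ 2" by (simp add: C1_def algebra_simps)
      finally show ?thesis by (simp add: algebra_simps)
    qed
    moreover have "gnorm s \<le> (C1 + C2) * h ^ 2"
    proof -
      have "gnorm s \<le> 2 * (gnorm (D ^ 2 * b ^ 2) + gnorm (E * a0 ^ 2 * a ^ 2))"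
        unfolding s_def using gnorm_add_le[of "D ^ 2 * b ^ 2" "- (E * a0 ^ 2 * a ^ 2)"] by simp
      also have "\<dots> = 2 * (gnorm D ^ 2 * gnorm b ^ 2 + e ^ 2 * gnorm a0 ^ 2 * gnorm a ^ 2)"
        by (simp add: gnorm_mult gnorm_power E_def)
      also have "\<dots> \<le> 2 * (gnorm D ^ 2 * h ^ 2 + e ^ 2 * gnorm a0 ^ 2 * h ^ 2)"
        using ab(3,4) by (intro mult_le_mono2 add_mono power_mono) simp_all
      also have "\<dots> = C2 * h ^ 2" by (simp add: C2_def algebra_simps)
      finally show ?thesis by (simp add: algebra_simps)
    qed
    ultimately show "qh (qadd (of_nat e) P R) \<le> (C1 + C2) * qh P ^ 2"
      using \<open>s \<noteq> 0\<close> unfolding h_def P(1) fst_conv by (intro height_le)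
  qed
qed

end

section \<open>The descent map\<close>

lemma squarefree_dvd_square:
  fixes d c :: gint
  assumes "squarefree d" "d dvd c ^ 2"
  shows "d dvd c"
proof -
  have "gcd d c \<noteq> 0" using assms(1) by auto
  then obtain d' c' where dc: "d = d' * gcd d c" "c = c' * gcd d c" "coprime d' c'"
    using gcd_coprime_exists by blast
  define g where "g = gcd d c"
  have g: "g \<noteq> 0" "d = g * d'" "c = g * c'"
    using \<open>gcd d c \<noteq> 0\<close> dc by (simp_all add: g_def mult.commute)
  have "g * d' dvd g * (g * c' ^ 2)"
    using assms(2) unfolding g(2,3) by (simp add: power2_eq_square ac_simps)
  then have "d' dvd g * c' ^ 2" using g(1) by simp
  then have "d' dvd g" using dc(3) by (simp add: coprime_dvd_mult_left_iff)
  then have "d' ^ 2 dvd d" unfolding g(2) power2_eq_square by (rule mult_dvd_mono) simp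
  with assms(1) have "is_unit d'" by (rule squarefreeD)
  then show ?thesis unfolding g(2,3) by (intro mult_dvd_mono) auto
qed

text \<open>Classical 2-descent. For \<open>x = a / b\<close> in lowest terms, \<open>a b W\<close>
  is a square, where \<open>W = a^2 + A b^2\<close> is coprime to \<open>b\<close>. So the
  squarefree part of \<open>b\<close> is a unit, the squarefree part of \<open>a\<close> divides
  both \<open>W\<close> and \<open>a^2\<close>, hence \<open>A\<close>, and removing squares leaves
  the equation for \<open>N\<close>.\<close>

lemma square_class_descent:
  assumes "x \<in> K" "y \<in> K" "x \<noteq> 0" "y ^ 2 = x ^ 3 + cg A * x"
  obtains D D' M e N where "D * D' = A" "M \<noteq> 0" "e \<noteq> 0" "x = cg D * (cg M / cg e) ^ 2"
    "N ^ 2 = D * M ^ 4 + D' * e ^ 4" "coprime M e" "coprime D e"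
proof -
  obtain a b where ab: "b \<noteq> 0" "x = cg a / cg b" "coprime a b"
    using assms(1) by (rule K_coprime_fraction)
  have a: "a \<noteq> 0" using ab(2) assms(3) by auto
  define W where "W = a ^ 2 + A * b ^ 2"
  have "(y * cg b ^ 2) ^ 2 = (x ^ 3 + cg A * x) * cg b ^ 4"
    by (simp add: power_mult_distrib assms(4) flip: power_mult)
  also have "\<dots> = cg (a * b * W)"
    unfolding ab(2) W_def using ab(1) by (simp add: field_simps eval_nat_numeral)
  finally have y: "(y * cg b ^ 2) ^ 2 = cg (a * b * W)" .
  moreover have "y * cg b ^ 2 \<in> K" using assms(2) by simp
  ultimately obtain c where "y * cg b ^ 2 = cg c" using K_integrally_closed by metis
  then have "cg (c ^ 2) = cg (a * b * W)" using y by (simp only: cg_power)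
  then have c: "c ^ 2 = a * b * W" unfolding cg_eq_iff .
  define d1 m d2 e where "d1 = squarefree_part a" and "m = square_part a"
    and "d2 = squarefree_part b" and "e = square_part b"
  have sf: "squarefree d1" "squarefree d2" by (simp_all add: d1_def d2_def)
  have a_eq: "a = d1 * m ^ 2" and b_eq: "b = d2 * e ^ 2"
    unfolding d1_def m_def d2_def e_def by (rule squarefree_decompose)+
  have me: "m \<noteq> 0" "e \<noteq> 0" using a ab(1) by (auto simp: m_def e_def)
  have cop: "coprime d1 d2" "coprime d1 e" "coprime m e" "coprime d1 b" "coprime m d2" "coprime d2 a"
    using ab(3) unfolding a_eq b_eq by (auto simp: coprime_commute)
  have "coprime b (a ^ 2)" using ab(3) by (simp add: coprime_commute)
  then have "coprime b W"
    unfolding W_def using gcd_add_mult[of b "A * b" "a ^ 2"]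
    by (simp add: coprime_iff_gcd_eq_1 power2_eq_square ac_simps)
  then have copW: "coprime d2 W" unfolding b_eq by simp
  have c2: "c ^ 2 = (m * e) ^ 2 * (d1 * d2 * W)"
    unfolding c by (subst a_eq, subst b_eq) (simp add: power_mult_distrib ac_simps)
  then have "(m * e) ^ 2 dvd c ^ 2" by simp
  then have "m * e dvd c" by (simp add: pow_divides_pow_iff)
  then obtain c' where c': "c = m * e * c'" by (elim dvdE)
  have "(m * e) ^ 2 * c' ^ 2 = (m * e) ^ 2 * (d1 * d2 * W)"
    using c2 unfolding c' by (simp add: power_mult_distrib)
  then have c'2: "c' ^ 2 = d1 * d2 * W" using me by simp
  then have "d2 dvd c' ^ 2" by simp
  then have "d2 dvd c'" by (rule squarefree_dvd_square[OF sf(2)])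
  then have "d2 * d2 dvd d2 * (d1 * W)"
    using mult_dvd_mono[of d2 c' d2 c'] c'2 by (simp add: power2_eq_square ac_simps)
  moreover have "d2 \<noteq> 0" using sf(2) by auto
  ultimately have "d2 dvd d1 * W" by simp
  moreover have "coprime d2 (d1 * W)" using cop(1) copW by (simp add: coprime_commute)
  ultimately have "is_unit d2" by (meson coprime_common_divisor dvd_refl)
  then obtain u where u: "1 = d2 * u" by (elim dvdE)
  have "d1 dvd c' ^ 2" unfolding c'2 by simp
  then have "d1 dvd c'" by (rule squarefree_dvd_square[OF sf(1)])
  then obtain c'' where c'': "c' = d1 * c''" by (elim dvdE)
  have d1: "d1 \<noteq> 0" using sf(1) by auto
  have eq1: "d1 * c'' ^ 2 = d2 * W"
  proof -
    have "d1 * (d1 * c'' ^ 2) = d1 * (d2 * W)"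
      using c'2 unfolding c'' by (simp add: power2_eq_square ac_simps)
    then show ?thesis using d1 by simp
  qed
  then have "d1 dvd d2 * W" by (metis dvd_triv_left)
  then have "d1 dvd W" using cop(1) by (simp add: coprime_dvd_mult_right_iff)
  moreover have "d1 dvd a ^ 2" unfolding a_eq by (simp add: power2_eq_square)
  ultimately have "d1 dvd A * b ^ 2" unfolding W_def by (simp add: dvd_add_right_iff)
  then have "d1 dvd A" using cop(4) by (simp add: coprime_dvd_mult_left_iff)
  then obtain A1 where A1: "A = d1 * A1" by (elim dvdE)
  have "d1 * c'' ^ 2 = d1 * (d2 * (d1 * m ^ 4 + A1 * (d2 ^ 2 * e ^ 4)))"
    unfolding eq1 W_def by (subst a_eq, subst b_eq, subst A1) (simp add: eval_nat_numeral algebra_simps)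
  then have c''2: "c'' ^ 2 = d2 * (d1 * m ^ 4 + A1 * (d2 ^ 2 * e ^ 4))" using d1 by simp
  show thesis
  \<comment> \<open>The denominator \<open>b\<close> is a square only up to the unit
    \<open>d2\<close>; the inverse \<open>u\<close> of that unit is absorbed into
    \<open>D\<close>.\<close>
  proof (rule that[of "d1 * u" "d2 * A1" m e "c'' * u"])
    have "d1 * u * (d2 * A1) = (d2 * u) * (d1 * A1)" by (simp add: ac_simps)
    then show "d1 * u * (d2 * A1) = A" unfolding A1 by (simp flip: u)
    have "cg d2 * cg u = 1" using arg_cong[OF u, of cg] by simp
    moreover from this have "cg d2 \<noteq> 0" by auto
    ultimately have cu: "cg u = 1 / cg d2" by (simp add: field_simps)
    show "x = cg (d1 * u) * (cg m / cg e) ^ 2"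
      unfolding ab(2) a_eq b_eq by (simp add: power_divide cu)
    have "(c'' * u) ^ 2 = (d2 * u) * (d1 * u * m ^ 4) + (d2 * u) * (d2 * u) * (d2 * A1 * e ^ 4)"
      unfolding power_mult_distrib c''2 by (simp add: eval_nat_numeral algebra_simps)
    then show "(c'' * u) ^ 2 = d1 * u * m ^ 4 + d2 * A1 * e ^ 4" by (simp flip: u)
    have "is_unit u" using u by (metis dvd_triv_right)
    then show "coprime (d1 * u) e" using cop(2) by (simp add: is_unit_left_imp_coprime)
  qed (use me cop in simp_all)
qed


section \<open>Quadratic characters at split primes\<close>

lemma Legendre_values: "Legendre a l \<in> {-1, 0, 1}"
  by (simp add: Legendre_def)

lemma Legendre_cong: "[a = b] (mod l) \<Longrightarrow> Legendre a l = Legendre b l"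
proof -
  assume ab: "[a = b] (mod l)"
  have "[c = a] (mod l) \<longleftrightarrow> [c = b] (mod l)" "[a = c] (mod l) \<longleftrightarrow> [b = c] (mod l)" for c
    using ab cong_trans cong_sym by blast+
  then show ?thesis by (simp add: Legendre_def QuadRes_def)
qed

lemma Legendre_mult:
  fixes l :: nat
  assumes "prime l" "2 < l"
  shows "Legendre (a * b) l = Legendre a l * Legendre b l"
proof -
  let ?k = "(l - 1) div 2"
  have "[Legendre (a * b) l = (a * b) ^ ?k] (mod l)" by (rule euler_criterion[OF assms])
  also have "(a * b) ^ ?k = a ^ ?k * b ^ ?k" by (rule power_mult_distrib)
  also have "[a ^ ?k * b ^ ?k = Legendre a l * Legendre b l] (mod l)"
    by (intro cong_mult cong_sym[OF euler_criterion[OF assms]])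
  finally have "int l dvd Legendre (a * b) l - Legendre a l * Legendre b l"
    by (simp add: cong_iff_dvd_diff)
  moreover have "\<bar>A - B * C\<bar> \<le> 2" if "A \<in> {-1, 0, 1}" "B \<in> {-1, 0, 1}" "C \<in> {-1, 0, 1}"
    for A B C :: int
    using that by auto
  then have "\<bar>Legendre (a * b) l - Legendre a l * Legendre b l\<bar> \<le> 2"
    using Legendre_values by blast
  ultimately have "Legendre (a * b) l - Legendre a l * Legendre b l = 0"
    using dvd_imp_le_int[of "Legendre (a * b) l - Legendre a l * Legendre b l" "int l"] assms(2)
    by linarith
  then show ?thesis by simp
qed

text \<open>Reduction sending \<open>imag\<close> to \<open>r\<close>, with integer values; it is
  multiplicative modulo \<open>l\<close> once \<open>l\<close> divides
  \<open>r^2 + 1\<close>.\<close>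

definition ev :: "int \<Rightarrow> gint \<Rightarrow> int" where
  "ev r z = gre z + r * gim z"

lemma ev_diff: "ev r (z - w) = ev r z - ev r w"
  and ev_minus [simp]: "ev r (- z) = - ev r z" and ev_of_nat [simp]: "ev r (of_nat n) = int n"
  and ev_imag [simp]: "ev r imag = r" and ev_1 [simp]: "ev r 1 = 1"
  by (simp_all add: ev_def algebra_simps)

text \<open>\<open>x + y i\<close> is a Gaussian prime above \<open>l\<close> with residue field the
  integers modulo \<open>l\<close>; \<open>root\<close> says that it reduces to 0 when
  \<open>i\<close> is sent to \<open>r\<close>.\<close>

locale split_prime =
  fixes x y r :: int and l :: nat
  assumes l: "prime l" "2 < l" and norm: "x ^ 2 + y ^ 2 = int l" and root: "int l dvd x + r * y"
begin

definition rho :: gint where "rho = Gint x y"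
definition chi :: "gint \<Rightarrow> int" where "chi z = Legendre (ev r z) l"

lemma l_int: "prime (int l)"
  using l by simp

lemma y_coprime: "\<not> int l dvd y"
proof
  assume "int l dvd y"
  then have "int l dvd x" using root by (simp add: dvd_add_left_iff)
  then have "int l ^ 2 dvd x ^ 2 + y ^ 2" using \<open>int l dvd y\<close> by (intro dvd_add dvd_power_same) 
  then have "int l * int l dvd int l * 1" unfolding norm by (simp add: power2_eq_square)
  then show False using l by (auto simp: dvd_mult_cancel_left)
qed

lemma root_sq: "int l dvd r ^ 2 + 1"
proof -
  have "(r ^ 2 + 1) * y ^ 2 = int l + (x + r * y) * (r * y - x)"
    unfolding norm[symmetric] by (simp add: power2_eq_square algebra_simps)
  then have "int l dvd (r ^ 2 + 1) * y ^ 2" using root by simp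
  then show ?thesis
    using y_coprime l_int by (metis prime_dvd_mult_iff prime_dvd_power)
qed

lemma ev_mult: "[ev r (z * w) = ev r z * ev r w] (mod l)"
proof -
  have "ev r z * ev r w - ev r (z * w) = (r ^ 2 + 1) * (gim z * gim w)"
    by (simp add: ev_def power2_eq_square algebra_simps)
  then have "int l dvd ev r z * ev r w - ev r (z * w)" using root_sq by simp
  then show ?thesis by (simp add: cong_iff_dvd_diff dvd_diff_commute)
qed

lemma rho_dvd_iff: "rho dvd z \<longleftrightarrow> int l dvd ev r z"
proof
  assume "rho dvd z"
  then obtain k where k: "z = rho * k" by (elim dvdE)
  have "int l dvd ev r rho" using root by (simp add: ev_def rho_def)
  then show "int l dvd ev r z"
    unfolding k using ev_mult[of rho k] by (metis cong_dvd_iff dvd_mult2)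
next
  assume *: "int l dvd ev r z"
  define a b where "a = gre z" and "b = gim z"
  have "a * x + b * y = (a + r * b) * x - (x + r * y) * (r * b) + (r ^ 2 + 1) * (b * y)"
    "b * x - a * y = b * (x + r * y) - (a + r * b) * y"
    by (simp_all add: power2_eq_square algebra_simps)
  then have "int l dvd a * x + b * y" "int l dvd b * x - a * y"
    using * root root_sq by (simp_all add: ev_def a_def b_def)
  then obtain m n where mn: "a * x + b * y = int l * m" "b * x - a * y = int l * n"
    by (elim dvdE)
  have rr: "rho * gcnj rho = of_nat l"
    using norm by (simp add: gint_eq_iff rho_def power2_eq_square)
  have "z * gcnj rho = of_nat l * Gint m n"
    using mn by (simp add: gint_eq_iff rho_def a_def b_def algebra_simps)
  then have "gcnj rho * z = gcnj rho * (rho * Gint m n)"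
    unfolding rr[symmetric] by (simp add: ac_simps)
  moreover have "gcnj rho \<noteq> 0" using rr l by (auto simp: gint_eq_iff)
  ultimately show "rho dvd z" by simp
qed

lemma rho_prime: "prime_elem rho"
proof (rule prime_elemI)
  show "rho \<noteq> 0" using norm l by (auto simp: rho_def zero_gint_def)
  have "gnorm rho = l" using norm by (simp add: gnorm_def rho_def)
  then show "\<not> is_unit rho" using l by (simp add: gint_dvd_1_iff)
  fix z w assume "rho dvd z * w"
  then have "int l dvd ev r z * ev r w"
    using ev_mult[of z w] by (simp add: rho_dvd_iff cong_dvd_iff)
  then show "rho dvd z \<or> rho dvd w"
    using l_int by (simp add: rho_dvd_iff prime_dvd_mult_iff)
qed

lemma chi_mult: "chi (z * w) = chi z * chi w"
  unfolding chi_def using Legendre_cong[OF ev_mult] Legendre_mult[OF l] by simp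

lemma chi_eq_0_iff: "chi z = 0 \<longleftrightarrow> rho dvd z"
  by (simp add: chi_def Legendre_def rho_dvd_iff cong_0_iff)

lemma chi_cases: "\<not> rho dvd z \<Longrightarrow> chi z = 1 \<or> chi z = - 1"
  using chi_eq_0_iff Legendre_values unfolding chi_def by auto

lemma chi_cong: "rho dvd z - w \<Longrightarrow> chi z = chi w"
  unfolding chi_def by (intro Legendre_cong) (simp add: rho_dvd_iff ev_diff cong_iff_dvd_diff)

lemma chi_square: "\<not> rho dvd z \<Longrightarrow> chi (z ^ 2) = 1"
  using chi_cases[of z] by (auto simp: power2_eq_square chi_mult)

lemma chi_of_nat: "chi (of_nat n) = Legendre (int n) l"
  by (simp add: chi_def)

lemma chi_minus_1: "chi (- 1) = 1"
proof -
  have "[r ^ 2 = - 1] (mod l)" using root_sq by (simp add: cong_iff_dvd_diff)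
  then have "QuadRes l (- 1)" unfolding QuadRes_def by blast
  moreover have "\<not> [- 1 = 0 :: int] (mod l)" using l by (simp add: cong_iff_dvd_diff)
  ultimately show ?thesis by (simp add: chi_def Legendre_def)
qed

lemma chi_minus: "chi (- z) = chi z"
  using chi_mult[of "- 1" z] by (simp add: chi_minus_1)

text \<open>The local condition at \<open>rho\<close> for solvability of the homogeneous space
  \<open>N\<^sup>2 = D M\<^sup>4 + D' e\<^sup>4\<close>, in a form symmetric in \<open>D\<close> and \<open>D'\<close>.\<close>

definition local_cond :: "gint \<Rightarrow> gint \<Rightarrow> bool" where
  "local_cond D D' \<longleftrightarrow> (rho dvd D \<longrightarrow> chi D' = 1) \<and> (rho dvd D' \<longrightarrow> chi D = 1)"

text \<open>Modulo \<open>rho\<close>: if \<open>rho\<close> divides \<open>D\<close>, it misses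
  \<open>e\<close> and \<open>N^2\<close> is \<open>D' e^4\<close>. If it divides \<open>D'\<close>,
  then \<open>N^2\<close> is \<open>D M^4\<close>, and \<open>rho\<close> misses \<open>M\<close>,
  since otherwise \<open>rho\<close> divides \<open>N\<close> and \<open>rho^2\<close> divides
  \<open>D' e^4\<close>, hence \<open>D'\<close>. Fourth powers prime to \<open>rho\<close> have
  character 1.\<close>

lemma local_condI:
  assumes eq: "N ^ 2 = D * M ^ 4 + D' * e ^ 4" and cop: "coprime M e" "coprime D e"
    and sf: "\<not> rho * rho dvd D * D'"
  shows "local_cond D D'"
proof -
  note pr = prime_elem_dvd_mult_iff[OF rho_prime] prime_elem_dvd_power_iff[OF rho_prime]
  have not_both: "\<not> (rho dvd D \<and> rho dvd D')" using sf mult_dvd_mono by blast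
  have nonunit: "\<not> is_unit rho" using rho_prime by (rule prime_elem_not_unit)
  have fourth: "chi (z ^ 4) = 1" if "\<not> rho dvd z" for z
    using chi_square[of "z ^ 2"] that by (simp add: pr flip: power_mult)
  have 1: "chi D' = 1" if d: "rho dvd D"
  proof -
    have e: "\<not> rho dvd e" using d cop(2) nonunit coprime_common_divisor by blast
    have "chi (N ^ 2) = chi (D' * e ^ 4)" by (rule chi_cong) (use d in \<open>simp add: eq\<close>)
    also have "\<dots> = chi D'" using fourth[OF e] by (simp add: chi_mult)
    finally have "chi N * chi N = chi D'" by (simp add: power2_eq_square chi_mult)
    moreover have "chi N * chi N \<ge> 0" by simp
    moreover have "chi D' = 1 \<or> chi D' = - 1" using not_both d by (intro chi_cases) blast
    ultimately show ?thesis by auto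
  qed
  have 2: "chi D = 1" if d: "rho dvd D'"
  proof -
    have M: "\<not> rho dvd M"
    proof
      assume M: "rho dvd M"
      then have e: "\<not> rho dvd e" using cop(1) nonunit coprime_common_divisor by blast
      have "rho dvd N ^ 2" unfolding eq using M d by (simp add: pr)
      then have "rho dvd N" by (simp add: pr)
      then have "rho * rho dvd N ^ 2" by (simp add: power2_eq_square mult_dvd_mono)
      moreover have "rho * rho dvd (M * M) * (D * (M * M))"
        using mult_dvd_mono[OF M M] by (rule dvd_mult2)
      then have "rho * rho dvd D * M ^ 4" by (simp add: eval_nat_numeral ac_simps)
      ultimately have "rho * rho dvd D' * e ^ 4" unfolding eq by (simp add: dvd_add_right_iff)
      then have "rho * rho dvd D'"
        using e prime_elem_imp_coprime[OF rho_prime, of e] by (simp add: coprime_dvd_mult_left_iff)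
      then show False using sf by simp
    qed
    have "chi (N ^ 2) = chi (D * M ^ 4)" by (rule chi_cong) (use d in \<open>simp add: eq\<close>)
    also have "\<dots> = chi D" using fourth[OF M] by (simp add: chi_mult)
    finally have "chi N * chi N = chi D" by (simp add: power2_eq_square chi_mult)
    moreover have "chi N * chi N \<ge> 0" by simp
    moreover have "chi D = 1 \<or> chi D = - 1" using not_both d by (intro chi_cases) blast
    ultimately show ?thesis by auto
  qed
  show ?thesis unfolding local_cond_def using 1 2 by blast
qed

text \<open>As \<open>rho\<close> divides exactly one of \<open>D\<close> and \<open>D'\<close>, the
  local condition becomes one on the cofactor \<open>D1\<close> alone: for \<open>n = 1\<close> the
  relation \<open>D1 D' = A1\<close> turns \<open>chi D' = 1\<close> into
  \<open>chi D1 = chi A1\<close>.\<close>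

lemma local_cond_value:
  assumes cond: "\<not> rho * rho dvd D * D' \<Longrightarrow> local_cond D D'"
    and eq: "D * D' = rho * A1" "D = rho ^ n * D1" "n \<le> 1" and nz: "chi A1 \<noteq> 0" "chi D1 \<noteq> 0"
  shows "chi D1 = (if n = 0 then 1 else chi A1)"
proof -
  note ndvd = nz[unfolded chi_eq_0_iff]
  have rho0: "rho \<noteq> 0" using rho_prime by (simp add: prime_elem_def)
  have lc: "local_cond D D'"
    by (rule cond) (use ndvd(1) eq(1) rho0 in simp)
  show ?thesis
  proof (cases "n = 0")
    case True
    then have "rho dvd D'"
      using eq ndvd(2) prime_elem_dvd_multD[OF rho_prime, of D D'] by auto
    then show ?thesis using lc eq(2) True by (simp add: local_cond_def)
  next
    case False
    then have n: "n = 1" using eq(3) by simp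
    then have "chi D' = 1" using lc eq(2) by (simp add: local_cond_def)
    moreover have "rho * (D1 * D') = rho * A1" using eq(1,2) n by (simp add: mult.assoc)
    then have "chi A1 = chi D1 * chi D'" using rho0 by (simp flip: chi_mult)
    ultimately show ?thesis using False by simp
  qed
qed

end

section \<open>Primes of the Gaussian integers and the image of the descent map\<close>

lemma of_nat_dvd_gint_iff: "(of_nat m :: gint) dvd z \<longleftrightarrow> int m dvd gre z \<and> int m dvd gim z"
proof
  assume "(of_nat m :: gint) dvd z"
  then obtain k where "z = of_nat m * k" by (elim dvdE)
  then show "int m dvd gre z \<and> int m dvd gim z" by simp
next
  assume "int m dvd gre z \<and> int m dvd gim z"
  then obtain a b where "gre z = int m * a" "gim z = int m * b" by (elim conjE dvdE)
  then have "z = of_nat m * Gint a b" by (simp add: gint_eq_iff)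
  then show "(of_nat m :: gint) dvd z" by simp
qed

lemma prime_square_factors:
  fixes a b p :: nat
  assumes "prime p" "a * b = p ^ 2" "a \<noteq> 1" "b \<noteq> 1"
  shows "a = p"
proof -
  have "a dvd p ^ 2" using assms(2) by (metis dvd_triv_left)
  then obtain i where i: "i \<le> 2" "a = p ^ i" using assms(1) by (meson divides_primepow_nat)
  have "i \<noteq> 0" using i assms(3) by (auto intro: ccontr)
  moreover have "i \<noteq> 2"
  proof
    assume "i = 2"
    then have "p ^ 2 * b = p ^ 2 * 1" using assms(2) i by simp
    then show False using assms(1,4) by (simp add: prime_gt_0_nat)
  qed
  ultimately show ?thesis using i by (simp add: le_less numeral_2_eq_2 less_Suc_eq)
qed

lemma square_mod_4: "x ^ 2 mod 4 = 0 \<or> x ^ 2 mod 4 = (1 :: int)"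
proof (cases "even x")
  case True
  then obtain k where "x = 2 * k" by (elim evenE)
  then show ?thesis by (simp add: power2_eq_square)
next
  case False
  then obtain k where "x = 2 * k + 1" by (elim oddE)
  then have "x ^ 2 = 4 * (k * k + k) + 1" by (simp add: power2_eq_square algebra_simps)
  then show ?thesis by (simp only: mod_mult_self4) simp
qed

text \<open>A proper factor would have norm \<open>q\<close>, but sums of two squares are never 3
  modulo 4.\<close>

lemma inert_prime:
  assumes "prime q" "q mod 4 = 3"
  shows "prime_elem (of_nat q :: gint)"
proof -
  have q: "q > 1" using assms(1) prime_gt_1_nat by blast
  have "irreducible (of_nat q :: gint)"
  proof (rule irreducibleI)
    show "(of_nat q :: gint) \<noteq> 0" using q by simp
    show "\<not> is_unit (of_nat q :: gint)" using q by (simp add: gint_dvd_1_iff)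
    fix z w :: gint assume zw: "of_nat q = z * w"
    then have N: "gnorm z * gnorm w = q ^ 2" by (metis gnorm_mult gnorm_of_nat)
    show "is_unit z \<or> is_unit w"
    proof (rule ccontr)
      assume "\<not> (is_unit z \<or> is_unit w)"
      then have "gnorm z = q"
        by (intro prime_square_factors[OF assms(1) N]) (simp_all add: gint_dvd_1_iff)
      then have "gre z ^ 2 + gim z ^ 2 = int q" using int_gnorm[of z] by simp
      moreover have "int q mod 4 = 3" using assms(2) by presburger
      moreover have "(gre z ^ 2 + gim z ^ 2) mod 4 = (gre z ^ 2 mod 4 + gim z ^ 2 mod 4) mod 4"
        by (simp only: mod_add_eq)
      ultimately show False
        using square_mod_4[of "gre z"] square_mod_4[of "gim z"] by auto
    qed
  qed
  then show ?thesis by (rule irreducible_imp_prime_elem)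
qed

lemma minus_one_square_mod:
  assumes "prime p" "p mod 4 = 1"
  obtains r where "int p dvd r ^ 2 + 1"
proof -
  have p: "2 < p" using assms prime_ge_2_nat[OF assms(1)] by (cases "p = 2") auto
  have "even ((p - 1) div 2)" using assms(2) by presburger
  then have "[Legendre (- 1) p = 1] (mod p)" using euler_criterion[OF assms(1) p, of "- 1"] by simp
  then have "Legendre (- 1) p \<noteq> - 1" "Legendre (- 1) p \<noteq> 0"
    using p zdvd_imp_le[of "int p" 2] zdvd_imp_le[of "int p" 1] by (auto simp: cong_iff_dvd_diff)
  then have "QuadRes p (- 1)" by (auto simp: Legendre_def split: if_splits)
  then show thesis using that by (auto simp: QuadRes_def cong_iff_dvd_diff)
qed

text \<open>\<open>p\<close> divides \<open>(r + i) (r - i)\<close> but neither factor, so it is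
  reducible among the Gaussian integers, and a proper factor has norm \<open>p\<close>.\<close>

lemma prime_sum_of_two_squares:
  assumes "prime p" "p mod 4 = 1"
  obtains x y :: int where "x ^ 2 + y ^ 2 = int p"
proof -
  obtain r where r: "int p dvd r ^ 2 + 1" using assms by (rule minus_one_square_mod)
  have p: "p > 1" using assms(1) prime_gt_1_nat by blast
  have "(of_nat p :: gint) dvd Gint r 1 * Gint r (- 1)"
    using r by (simp add: of_nat_dvd_gint_iff power2_eq_square)
  moreover have "\<not> (of_nat p :: gint) dvd Gint r 1" "\<not> (of_nat p :: gint) dvd Gint r (- 1)"
    using p by (simp_all add: of_nat_dvd_gint_iff)
  ultimately have "\<not> prime_elem (of_nat p :: gint)" by (meson prime_elem_dvd_multD)
  then have "\<not> irreducible (of_nat p :: gint)" using irreducible_imp_prime_elem by blast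
  moreover have "(of_nat p :: gint) \<noteq> 0" "\<not> is_unit (of_nat p :: gint)"
    using p by (simp_all add: gint_dvd_1_iff)
  ultimately obtain z w :: gint where zw: "of_nat p = z * w" "\<not> is_unit z" "\<not> is_unit w"
    unfolding irreducible_def by blast
  have N: "gnorm z * gnorm w = p ^ 2" using zw(1) by (metis gnorm_mult gnorm_of_nat)
  have "gnorm z = p"
    using zw by (intro prime_square_factors[OF assms(1) N]) (simp_all add: gint_dvd_1_iff)
  then show thesis using that[of "gre z" "gim z"] int_gnorm[of z] by simp
qed

lemma Legendre_5:
  "a mod 5 = 2 \<or> a mod 5 = 3 \<Longrightarrow> Legendre a 5 = - 1"
  "a mod 5 = 1 \<or> a mod 5 = 4 \<Longrightarrow> Legendre a 5 = 1"
proof -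
  have "[Legendre a (int 5) = a ^ ((5 - 1) div 2)] (mod (int 5))"
    by (rule euler_criterion) simp_all
  then have *: "Legendre a 5 mod 5 = (a mod 5) ^ 2 mod 5"
    by (simp add: cong_def power_mod)
  show "a mod 5 = 2 \<or> a mod 5 = 3 \<Longrightarrow> Legendre a 5 = - 1"
    "a mod 5 = 1 \<or> a mod 5 = 4 \<Longrightarrow> Legendre a 5 = 1"
    using * Legendre_values[of a 5] by auto
qed

lemma prime_elem_split:
  fixes r :: gint
  assumes "prime_elem r" "D dvd r * m"
  obtains n D1 where "n \<le> 1" "D = r ^ n * D1" "D1 dvd m"
proof (cases "r dvd D")
  case True
  then obtain D1 where "D = r * D1" by (elim dvdE)
  moreover from this have "D1 dvd m" using assms by (simp add: prime_elem_def)
  ultimately show thesis using that[of 1 D1] by simp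
next
  case False
  then have "coprime D r" using prime_elem_imp_coprime[OF assms(1)] by (simp add: coprime_commute)
  then have "D dvd m" using assms(2) by (simp add: coprime_dvd_mult_right_iff)
  then show thesis using that[of 0 D] by simp
qed

context split_prime
begin

lemma chi_power: "chi (z ^ n) = chi z ^ n"
proof (induction n)
  case 0
  have "chi 1 = 1" using chi_minus[of 1] chi_minus_1 by simp
  then show ?case by simp
qed (simp add: chi_mult)

lemma chi_imag_cong: "[chi imag = r ^ ((l - 1) div 2)] (mod l)"
  unfolding chi_def using euler_criterion[OF l, of r] by simp

text \<open>\<open>r^2 = - 1\<close> modulo \<open>l\<close>, and \<open>(l - 1) / 2\<close> is a
  multiple of 4, so Euler's criterion gives 1.\<close>

lemma chi_imag_1: "l mod 8 = 1 \<Longrightarrow> chi imag = 1"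
proof -
  assume "l mod 8 = 1"
  then have "(l - 1) div 2 = 4 * (l div 8)" by presburger
  then obtain k where "(l - 1) div 2 = 4 * k" ..
  have "[r ^ 2 = - 1] (mod l)" using root_sq by (simp add: cong_iff_dvd_diff)
  then have "[(r ^ 2) ^ (2 * k) = (- 1) ^ (2 * k)] (mod l)" by (rule cong_pow)
  then have "[r ^ ((l - 1) div 2) = 1] (mod l)"
    using \<open>(l - 1) div 2 = 4 * k\<close> by (simp flip: power_mult)
  then have "[chi imag = 1] (mod l)" using chi_imag_cong cong_trans by blast
  then have "int l dvd chi imag - 1" by (simp add: cong_iff_dvd_diff)
  moreover have "chi imag \<in> {-1, 0, 1}" unfolding chi_def by (rule Legendre_values)
  ultimately show ?thesis
    using l zdvd_imp_le[of "int l" 2] zdvd_imp_le[of "int l" 1] by auto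
qed

end

text \<open>For \<open>z = a + b i\<close> the real part is \<open>(a^2 - b^2)^2 - 4 (a b)^2\<close>
  and the imaginary part is \<open>4 a b (a^2 - b^2)\<close>, where \<open>a b (a^2 - b^2)\<close>
  is always even. Odd \<open>a + b\<close> means that \<open>z\<close> is prime to
  \<open>1 + i\<close>.\<close>

lemma fourth_power_mod_8:
  fixes z :: gint
  shows "gim (z ^ 4) mod 8 = 0" "odd (gre z + gim z) \<Longrightarrow> gre (z ^ 4) mod 8 = 1"
    "even (gre z + gim z) \<Longrightarrow> even (gre (z ^ 4))"
proof -
  obtain a b where z: "z = Gint a b" by (cases z)
  have re: "gre (z ^ 4) = (a ^ 2 - b ^ 2) ^ 2 - 4 * (a * b) ^ 2"
    and im: "gim (z ^ 4) = 4 * (a * b) * (a ^ 2 - b ^ 2)"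
    by (simp_all add: z eval_nat_numeral algebra_simps)
  have "even (a * b) \<or> even (a ^ 2 - b ^ 2)" by auto
  then have "even (a * b * (a ^ 2 - b ^ 2))" by auto
  then obtain k where "a * b * (a ^ 2 - b ^ 2) = 2 * k" by (elim evenE)
  then show "gim (z ^ 4) mod 8 = 0" unfolding im by (simp add: mult.assoc)
  show "even (gre (z ^ 4))" if "even (gre z + gim z)"
    using that unfolding re by (simp add: z)
  show "gre (z ^ 4) mod 8 = 1" if "odd (gre z + gim z)"
  proof -
    have odd: "odd (a ^ 2 - b ^ 2)" and even: "even (a * b)" using that by (auto simp: z)
    obtain m where m: "a ^ 2 - b ^ 2 = 2 * m + 1" using odd by (elim oddE)
    obtain n where n: "a * b = 2 * n" using even by (elim evenE)
    have "even (m * (m + 1))" by simp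
    then obtain j where j: "m * (m + 1) = 2 * j" by (elim evenE)
    have "gre (z ^ 4) = 4 * (m * (m + 1)) + 1 - 16 * n ^ 2"
      unfolding re m n by (simp add: power2_eq_square algebra_simps)
    also have "\<dots> = 8 * (j - 2 * n ^ 2) + 1" unfolding j by simp
    finally show ?thesis by presburger
  qed
qed

text \<open>A \<open>2\<close>-adic obstruction: if \<open>M\<close> and \<open>e\<close> are both odd then the right-hand side is
  \<open>4 \<i>\<close> modulo \<open>8\<close>, and if only one of them is odd then its imaginary part is odd.\<close>

lemma no_solution_mod_8:
  fixes N M e u :: gint and P Q :: int
  assumes "N ^ 2 = u * of_int P * M ^ 4 + u * of_int Q * e ^ 4" "u = imag \<or> u = - imag"
    and "odd P" "odd Q" "(P + Q) mod 8 = 4" "coprime M e"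
  shows False
proof -
  define X Y where "X = P * gre (M ^ 4) + Q * gre (e ^ 4)" and "Y = P * gim (M ^ 4) + Q * gim (e ^ 4)"
  have "8 dvd gim (M ^ 4)" "8 dvd gim (e ^ 4)"
    using fourth_power_mod_8(1) by (simp_all add: dvd_eq_mod_eq_0)
  then have Y: "8 dvd Y" by (simp add: Y_def)
  have N2: "gre (N ^ 2) = gre N ^ 2 - gim N ^ 2" "gim (N ^ 2) = 2 * (gre N * gim N)"
    by (simp_all add: power2_eq_square)
  have re: "gre (N ^ 2) = Y \<or> gre (N ^ 2) = - Y" and im: "gim (N ^ 2) = X \<or> gim (N ^ 2) = - X"
    using assms(2) unfolding assms(1) by (auto simp: X_def Y_def algebra_simps)
  have "8 dvd gre N ^ 2 - gim N ^ 2" using re Y unfolding N2 by auto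
  then have "even (gre N ^ 2 - gim N ^ 2)" by (meson dvd_trans even_numeral)
  then have parity: "even (gre N) \<longleftrightarrow> even (gim N)" by simp
  have X: "even X" using im unfolding N2 by (metis dvd_minus_iff dvd_triv_left)
  have nd: "\<not> (even (gre M + gim M) \<and> even (gre e + gim e))"
  proof
    have dvd: "Gint 1 1 dvd z" if ev: "even (gre z + gim z)" for z
    proof -
      obtain k where k: "gre z + gim z = 2 * k" using ev by (elim evenE)
      have "z = Gint 1 1 * Gint k (gim z - k)" using k by (simp add: gint_eq_iff)
      then show ?thesis by (rule dvdI)
    qed
    assume "even (gre M + gim M) \<and> even (gre e + gim e)"
    then have "is_unit (Gint 1 1)" using dvd assms(6) coprime_common_divisor by blast
    then show False by (simp add: gint_dvd_1_iff gnorm_def)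
  qed
  have par: "even (gre (z ^ 4)) \<longleftrightarrow> even (gre z + gim z)" for z
    using fourth_power_mod_8(2,3)[of z] by presburger
  have odd: "odd (gre M + gim M)" "odd (gre e + gim e)"
    using nd X assms(3,4) par[of M] par[of e] by (auto simp: X_def)
  have "[X = P * 1 + Q * 1] (mod 8)"
    unfolding X_def using odd fourth_power_mod_8(2)
    by (intro cong_add cong_mult cong_refl) (simp_all add: cong_def)
  then have X4: "X mod 8 = 4" using assms(5) by (simp add: cong_def)
  have "n mod 4 = 2" if "2 * n = X \<or> 2 * n = - X" for n
  proof -
    define k where "k = X div 8"
    have "X = 8 * k + 4" using X4 div_mult_mod_eq[of X 8] by (simp add: k_def)
    then have "n = 4 * k + 2 \<or> n = 4 * (- k - 1) + 2" using that by auto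
    then show ?thesis by (elim disjE; simp only: mod_mult_self4; simp)
  qed
  \<comment> \<open>An imaginary part of 4 modulo 8 needs exactly one of \<open>gre N\<close>,
    \<open>gim N\<close> even, against \<open>parity\<close>, which comes from the real part being
    divisible by 8.\<close>
  then have "gre N * gim N mod 4 = 2" using im unfolding N2 by blast
  moreover have "even n" if "n mod 4 = 2" for n :: int using that by presburger
  ultimately have "even (gre N * gim N)" by blast
  then have "even (gre N)" "even (gim N)" using parity by auto
  then obtain i j where "gre N = 2 * i" "gim N = 2 * j" by (elim evenE)
  then have "gre N * gim N = 4 * (i * j)" by simp
  then show False using \<open>gre N * gim N mod 4 = 2\<close> by simp
qed

lemma mod_eq_of_mod_eq:
  fixes m n k r :: nat
  assumes "m dvd k" "n mod k = r"
  shows "n mod m = r mod m"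
  using mod_mod_cancel[OF assms(1), of n] assms(2) by simp

text \<open>\<open>q = 7\<close> modulo 20 is what the residues 7 and 27 modulo 40 have in common;
  they differ modulo 8, where they are 7 and 3.\<close>

locale curve_primes =
  fixes p q :: nat
  assumes p: "prime p" "p mod 40 = 33" and q: "prime q" "q mod 20 = 7"
begin

lemma p_facts: "p mod 4 = 1" "p mod 8 = 1" "p mod 5 = 3" "2 < p" "odd p" "p \<noteq> 5"
proof -
  have *: "p mod m = 33 mod m" if "m dvd 40" for m
    by (rule mod_eq_of_mod_eq[OF that p(2)])
  show "p mod 4 = 1" "p mod 8 = 1" "p mod 5 = 3"
    using *[of 4] *[of 8] *[of 5] by simp_all
  show "2 < p" using mod_less_eq_dividend[of p 40] p(2) by simp
  show "odd p" using *[of 2] by (simp add: odd_iff_mod_2_eq_one)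
  show "p \<noteq> 5" using p(2) by auto
qed

lemma q_facts: "q mod 4 = 3" "q mod 5 = 2" "2 < q" "odd q" "q \<noteq> 5" "q \<noteq> p"
proof -
  have *: "q mod m = 7 mod m" if "m dvd 20" for m
    by (rule mod_eq_of_mod_eq[OF that q(2)])
  show mod4: "q mod 4 = 3" and "q mod 5 = 2"
    using *[of 4] *[of 5] by simp_all
  show "2 < q" using mod_less_eq_dividend[of q 20] q(2) by simp
  show "odd q" using *[of 2] by (simp add: odd_iff_mod_2_eq_one)
  show "q \<noteq> 5" using q(2) by auto
  show "q \<noteq> p" using mod4 p_facts(1) by auto
qed

lemma Legendre_5_p: "Legendre 5 p = - 1"
proof -
  have "Legendre (int p) (int 5) * Legendre (int 5) (int p) = (- 1) ^ ((p - 1) div 2 * ((5 - 1) div 2))"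
    using p p_facts by (intro Quadratic_Reciprocity) simp_all
  moreover have "int p mod 5 = 3" using p_facts(3) by presburger
  then have "Legendre (int p) 5 = - 1" by (rule Legendre_5(1)[OF disjI2])
  ultimately show ?thesis by simp
qed

lemma q_prime_elem: "prime_elem (of_nat q :: gint)"
  using q(1) q_facts(1) by (rule inert_prime)

lemma ex_split_prime:
  obtains x y r where "split_prime x y r p"
proof -
  obtain x y :: int where xy: "x ^ 2 + y ^ 2 = int p"
    using p(1) p_facts(1) by (rule prime_sum_of_two_squares)
  have "\<not> int p dvd y"
  proof
    assume y: "int p dvd y"
    then have "int p dvd x ^ 2" using xy by (metis dvd_add_left_iff dvd_power dvd_refl dvd_trans zero_less_numeral)
    then have "int p dvd x" using p(1) by (simp add: prime_dvd_power_iff)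
    then have "int p * int p dvd x * x + y * y" using y by (intro dvd_add mult_dvd_mono)
    then have "int p * int p dvd int p * 1" using xy by (simp add: power2_eq_square)
    then show False using p_facts(4) by (auto simp: dvd_mult_cancel_left)
  qed
  then have "coprime (int p) y" using p(1) by (simp add: prime_imp_coprime)
  then obtain r where r: "int p dvd x + r * y"
  proof -
    obtain s where "[y * s = 1] (mod int p)"
      using \<open>coprime (int p) y\<close> by (metis cong_solve_coprime_int coprime_commute)
    then have "int p dvd x * (1 - y * s)" by (metis cong_iff_dvd_diff cong_sym dvd_mult)
    then have "int p dvd x + (- x * s) * y" by (simp add: algebra_simps)
    then show thesis using that by blast
  qed
  have "split_prime x y r p"
    using p(1) p_facts(4) xy r by unfold_locales simp_all
  then show thesis by (rule that)
qed

text \<open>\<open>2 = - i (1 + i)^2\<close>, and \<open>i\<close> has character 1 at a prime above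
  \<open>p\<close> because \<open>p = 1\<close> modulo 8.\<close>

lemma Legendre_2_p: "Legendre 2 p = 1"
proof -
  obtain x y r where "split_prime x y r p" by (rule ex_split_prime)
  then interpret P: split_prime x y r p .
  have "\<not> int p dvd 2" using p_facts(4) zdvd_imp_le[of "int p" 2] by auto
  then have *: "\<not> P.rho dvd of_nat 2" by (simp add: P.rho_dvd_iff ev_def)
  have two: "(of_nat 2 :: gint) = - imag * (1 + imag) ^ 2"
    by (simp add: gint_eq_iff power2_eq_square)
  then have "\<not> P.rho dvd 1 + imag" using * by (metis dvd_mult dvd_power dvd_trans zero_less_numeral)
  then have "P.chi (of_nat 2) = 1"
    unfolding two P.chi_mult P.chi_minus using P.chi_square P.chi_imag_1[OF p_facts(2)] by simp
  then show ?thesis unfolding P.chi_of_nat by simp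
qed

text \<open>\<open>D\<close> is a unit times \<open>l1^a l2^b p1^c p2^c'\<close>, where
  \<open>l1 = 2 + i\<close> and \<open>l2 = 2 - i\<close> lie above 5 and \<open>p1\<close>,
  \<open>p2\<close> above \<open>p\<close>. As \<open>p\<close> is a nonresidue modulo 5, the
  conditions at 5 force \<open>c = c'\<close> and tie the unit to \<open>c\<close>: it is
  \<open>1\<close> or \<open>-1\<close> for \<open>c = 0\<close>, and \<open>i\<close> or
  \<open>-i\<close> for \<open>c = 1\<close>. As 5 is a nonresidue modulo \<open>p\<close>, the
  conditions at \<open>p\<close> force \<open>a = b\<close>, with \<open>a = 0\<close> when
  \<open>c = 0\<close>; when \<open>c = 1\<close>, the Legendre symbol of \<open>q\<close> decides
  \<open>a\<close>.\<close>

lemma descent_classification: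
  assumes DD': "D * D' = - of_nat (5 * p * q)" and qD: "\<not> of_nat q dvd D"
    and local_cond: "\<And>x y r l. split_prime x y r l \<Longrightarrow> \<not> split_prime.rho x y * split_prime.rho x y dvd D * D'
       \<Longrightarrow> split_prime.local_cond x y r l D D'"
  shows "D = 1 \<or> D = - 1 \<or> (\<exists>u \<in> {imag, - imag}. \<exists>a. (a = 0 \<and> Legendre q p = - 1 \<or> a = 1 \<and> Legendre q p = 1)
     \<and> D = u * of_nat (p * 5 ^ a))"
proof -
  obtain x y r where p_split: "split_prime x y r p" by (rule ex_split_prime)
  then interpret P3: split_prime x y r p .
  note xy = P3.norm and r = P3.root
  interpret P1: split_prime 2 1 "- 2" 5 by standard simp_all
  interpret P2: split_prime 2 "- 1" 2 5 by standard simp_all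
  interpret P4: split_prime x "- y" "- r" p using p(1) p_facts(4) xy r by unfold_locales simp_all
  let ?l1 = "P1.rho" and ?l2 = "P2.rho" and ?p1 = "P3.rho" and ?p2 = "P4.rho" and ?q = "of_nat q :: gint"
  have l12: "?l1 * ?l2 = of_nat 5" by (simp add: P1.rho_def P2.rho_def gint_eq_iff)
  have p12: "?p1 * ?p2 = of_nat p"
    using xy by (simp add: P3.rho_def P4.rho_def gint_eq_iff power2_eq_square algebra_simps)
  have Leg5: "Legendre (int p) 5 = - 1" "Legendre (int q) 5 = - 1"
    using p_facts(3) q_facts(2) by (intro Legendre_5(1); presburger)+
  have chi_units1: "P1.chi imag = - 1" "P2.chi imag = - 1"
    unfolding P1.chi_def P2.chi_def by (simp_all add: Legendre_5)
  have chi_units2: "P3.chi imag = 1" "P4.chi imag = 1"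
    using P3.chi_imag_1 P4.chi_imag_1 p_facts(2) by simp_all
  have one: "P1.chi 1 = 1" "P2.chi 1 = 1" "P3.chi 1 = 1" "P4.chi 1 = 1"
    using P1.chi_power[of 1 0] P2.chi_power[of 1 0] P3.chi_power[of 1 0] P4.chi_power[of 1 0] by simp_all
  have l_cross: "P1.chi ?l2 = 1" "P2.chi ?l1 = 1"
    unfolding P1.chi_def P2.chi_def P1.rho_def P2.rho_def ev_def by (simp_all add: Legendre_5)
  define s s' where "s = P1.chi ?p1" and "s' = P1.chi ?p2"
  define t t' where "t = P3.chi ?l1" and "t' = P3.chi ?l2"
  define w w' where "w = P3.chi ?p2" and "w' = P4.chi ?p1"
  define h where "h = Legendre (int q) p"
  \<comment> \<open>Complex conjugation exchanges the two primes above 5 and the two above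
    \<open>p\<close>, so half of the symbols determine the others.\<close>
  have swap1: "P2.chi ?p1 = s'" "P2.chi ?p2 = s"
    unfolding s_def s'_def P1.chi_def P2.chi_def P3.rho_def P4.rho_def ev_def by simp_all
  have swap2: "P4.chi ?l1 = t'" "P4.chi ?l2 = t"
    unfolding t_def t'_def P3.chi_def P4.chi_def P1.rho_def P2.rho_def ev_def by simp_all
  have ss': "s * s' = - 1"
    unfolding s_def s'_def P1.chi_mult[symmetric] p12 P1.chi_of_nat using Leg5 by simp
  have tt': "t * t' = - 1"
    unfolding t_def t'_def P3.chi_mult[symmetric] l12 P3.chi_of_nat using Legendre_5_p by simp
  have chi_q: "P1.chi ?q = - 1" "P2.chi ?q = - 1" "P3.chi ?q = h" "P4.chi ?q = h"
    unfolding P1.chi_of_nat P2.chi_of_nat P3.chi_of_nat P4.chi_of_nat h_def using Leg5 by simp_all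
  have s_cases: "s = 1 \<and> s' = - 1 \<or> s = - 1 \<and> s' = 1"
    using ss' Legendre_values[of "ev (- 2) ?p1" 5] Legendre_values[of "ev (- 2) ?p2" 5]
    by (auto simp: s_def s'_def P1.chi_def)
  have t_cases: "t = 1 \<and> t' = - 1 \<or> t = - 1 \<and> t' = 1"
    using tt' Legendre_values[of "ev r ?l1" p] Legendre_values[of "ev r ?l2" p]
    by (auto simp: t_def t'_def P3.chi_def)
  have h: "h = 1 \<or> h = - 1"
  proof -
    have "\<not> p dvd q" using p(1) q(1) q_facts(6) primes_dvd_imp_eq by blast
    then show ?thesis by (auto simp: h_def Legendre_def cong_0_iff)
  qed
  have w: "w = 1 \<or> w = - 1" "w' = 1 \<or> w' = - 1"
  proof -
    have "\<not> int p dvd x" 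
    proof
      assume x: "int p dvd x"
      then have "int p dvd y ^ 2" using xy by (metis dvd_add_right_iff dvd_power dvd_refl dvd_trans zero_less_numeral)
      then show False using P3.y_coprime p(1) by (simp add: prime_dvd_power_iff)
    qed
    moreover have "\<not> int p dvd 2" using p_facts(4) zdvd_imp_le[of "int p" 2] by auto
    ultimately have x2: "\<not> int p dvd 2 * x" using p(1) by (simp add: prime_dvd_mult_iff)
    have e: "ev r ?p2 = 2 * x - (x + r * y)" "ev (- r) ?p1 = 2 * x - (x + r * y)"
      by (simp_all add: ev_def P3.rho_def P4.rho_def)
    have "\<not> int p dvd ev r ?p2" "\<not> int p dvd ev (- r) ?p1"
      unfolding e using x2 dvd_add[OF _ r, of "2 * x - (x + r * y)"] by auto
    then show "w = 1 \<or> w = - 1" "w' = 1 \<or> w' = - 1"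
      unfolding w_def w'_def by (intro P3.chi_cases P4.chi_cases; simp add: P3.rho_dvd_iff P4.rho_dvd_iff)+
  qed
  have nz: "s \<noteq> 0" "s' \<noteq> 0" "t \<noteq> 0" "t' \<noteq> 0" "h \<noteq> 0" "w \<noteq> 0" "w' \<noteq> 0"
    using s_cases t_cases h w by auto
  have A: "D * D' = - (?l1 * (?l2 * (?p1 * (?p2 * ?q))))"
    unfolding DD' of_nat_mult using l12 p12 by (simp flip: mult.assoc)
  have "D dvd (?l1 * (?l2 * (?p1 * (?p2 * 1)))) * ?q"
    using dvd_triv_left[of D D'] unfolding A by (simp add: ac_simps)
  moreover have "coprime D ?q"
    using prime_elem_imp_coprime[OF q_prime_elem qD] by (simp add: coprime_commute)
  ultimately have "D dvd ?l1 * (?l2 * (?p1 * (?p2 * 1)))" by (simp add: coprime_dvd_mult_left_iff)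
  then obtain a D1 where a: "a \<le> 1" "D = ?l1 ^ a * D1" "D1 dvd ?l2 * (?p1 * (?p2 * 1))"
    by (rule prime_elem_split[OF P1.rho_prime])
  then obtain b D2 where b: "b \<le> 1" "D1 = ?l2 ^ b * D2" "D2 dvd ?p1 * (?p2 * 1)"
    using prime_elem_split[OF P2.rho_prime] by metis
  then obtain c D3 where c: "c \<le> 1" "D2 = ?p1 ^ c * D3" "D3 dvd ?p2 * 1"
    using prime_elem_split[OF P3.rho_prime] by metis
  then obtain c' u where c': "c' \<le> 1" "D3 = ?p2 ^ c' * u" "is_unit u"
    using prime_elem_split[OF P4.rho_prime] by metis
  have D: "D = ?l1 ^ a * (?l2 ^ b * (?p1 ^ c * (?p2 ^ c' * u)))"
    using a b c c' by simp
  define \<kappa> where "\<kappa> = P1.chi u"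
  have \<kappa>: "(u = 1 \<or> u = - 1) \<and> \<kappa> = 1 \<or> (u = imag \<or> u = - imag) \<and> \<kappa> = - 1"
    using c'(3) by (cases rule: is_unit_gint_cases) (simp_all add: \<kappa>_def P1.chi_minus chi_units1 one)
  have chi_u: "P2.chi u = \<kappa>" "P3.chi u = 1" "P4.chi u = 1"
    using c'(3) unfolding \<kappa>_def
    by (cases rule: is_unit_gint_cases;
        simp add: P1.chi_minus P2.chi_minus P3.chi_minus P4.chi_minus chi_units1 chi_units2 one)+
  have \<kappa>0: "\<kappa> \<noteq> 0" using \<kappa> by auto
  note chi1 = P1.chi_mult P1.chi_power P1.chi_minus l_cross s_def[symmetric] s'_def[symmetric] \<kappa>_def[symmetric] chi_q
  note chi2 = P2.chi_mult P2.chi_power P2.chi_minus l_cross swap1 chi_u chi_q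
  note chi3 = P3.chi_mult P3.chi_power P3.chi_minus t_def[symmetric] t'_def[symmetric] w_def[symmetric] chi_u chi_q
  note chi4 = P4.chi_mult P4.chi_power P4.chi_minus swap2 w'_def[symmetric] chi_u chi_q
  \<comment> \<open>Both values of \<open>a\<close> lead to the same equation, since
    \<open>- l2 p1 p2 q\<close> has character \<open>- s s' = 1\<close> at
    \<open>l1\<close>.\<close>
  have F1: "s ^ c * s' ^ c' * \<kappa> = 1"
  proof -
    have "P1.chi (?l2 ^ b * (?p1 ^ c * (?p2 ^ c' * u)))
        = (if a = 0 then 1 else P1.chi (- (?l2 * (?p1 * (?p2 * ?q)))))"
      by (rule P1.local_cond_value[OF local_cond[OF P1.split_prime_axioms] _ D a(1)])
        (use A nz \<kappa>0 in \<open>simp_all add: chi1\<close>)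
    then show ?thesis using ss' by (simp add: chi1 split: if_splits)
  qed
  have F2: "s' ^ c * s ^ c' * \<kappa> = 1"
  proof -
    have "P2.chi (?l1 ^ a * (?p1 ^ c * (?p2 ^ c' * u)))
        = (if b = 0 then 1 else P2.chi (- (?l1 * (?p1 * (?p2 * ?q)))))"
      by (rule P2.local_cond_value[OF local_cond[OF P2.split_prime_axioms] _ _ b(1)])
        (use A D nz \<kappa>0 in \<open>simp_all add: chi2 ac_simps\<close>)
    then show ?thesis using ss' by (simp add: chi2 mult.commute[of s' s] split: if_splits)
  qed
  have F3: "t ^ a * t' ^ b * w ^ c' = (if c = 0 then 1 else - (w * h))"
  proof -
    have "P3.chi (?l1 ^ a * (?l2 ^ b * (?p2 ^ c' * u)))
        = (if c = 0 then 1 else P3.chi (- (?l1 * (?l2 * (?p2 * ?q)))))"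
      by (rule P3.local_cond_value[OF local_cond[OF P3.split_prime_axioms] _ _ c(1)])
        (use A D nz in \<open>simp_all add: chi3 ac_simps\<close>)
    moreover have "P3.chi (- (?l1 * (?l2 * (?p2 * ?q)))) = - (w * h)"
      using tt' by (simp add: chi3 flip: mult.assoc)
    ultimately show ?thesis by (simp add: chi3 mult.assoc)
  qed
  have F4: "t' ^ a * t ^ b * w' ^ c = (if c' = 0 then 1 else - (w' * h))"
  proof -
    have "P4.chi (?l1 ^ a * (?l2 ^ b * (?p1 ^ c * u)))
        = (if c' = 0 then 1 else P4.chi (- (?l1 * (?l2 * (?p1 * ?q)))))"
      by (rule P4.local_cond_value[OF local_cond[OF P4.split_prime_axioms] _ _ c'(1)])
        (use A D nz in \<open>simp_all add: chi4 ac_simps\<close>)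
    moreover have "P4.chi (- (?l1 * (?l2 * (?p1 * ?q)))) = - (w' * h)"
      using tt' by (simp add: chi4 mult.commute[of t' t] flip: mult.assoc)
    ultimately show ?thesis by (simp add: chi4 mult.assoc)
  qed
  have cases01: "n = 0 \<or> n = 1" if "n \<le> 1" for n :: nat using that by linarith
  \<comment> \<open>\<open>s\<close> and \<open>s'\<close> have opposite signs, so \<open>F1\<close>
    and \<open>F2\<close> would contradict each other if \<open>c\<close> and \<open>c'\<close>
    differed.\<close>
  have cc': "c = c' \<and> \<kappa> = (if c = 0 then 1 else - 1)"
    using cases01[OF c(1)] cases01[OF c'(1)] s_cases F1 F2 by (elim disjE) auto
  have ab: "a = b \<and> (c = 0 \<longrightarrow> a = 0) \<and> (c = 1 \<longrightarrow> h = (if a = 0 then - 1 else 1))"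
    using cases01[OF a(1)] cases01[OF b(1)] cases01[OF c(1)] t_cases w F3 F4 cc' by (elim disjE) auto
  show ?thesis
  proof (cases "c = 0")
    case True
    then have "a = 0" "b = 0" "c' = 0" using cc' ab by auto
    then have "D = u" using D True by simp
    then show ?thesis using \<kappa> cc' True by auto
  next
    case False
    then have c1: "c = 1" using cases01[OF c(1)] by simp
    then have "D = u * ((?l1 * ?l2) ^ a * (?p1 * ?p2))"
      unfolding D using cc' ab by (simp add: power_mult_distrib ac_simps)
    then have "D = u * of_nat (p * 5 ^ a)" unfolding l12 p12 by (simp add: mult.commute)
    moreover have "u \<in> {imag, - imag}" using \<kappa> cc' c1 by auto
    moreover have "a = 0 \<and> h = - 1 \<or> a = 1 \<and> h = 1" using ab c1 cases01[OF a(1)] by auto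
    ultimately show ?thesis unfolding h_def by blast
  qed
qed

end

section \<open>The rank\<close>

context gauss_module
begin

lemma finite_bound:
  fixes h :: "'a \<Rightarrow> nat"
  assumes "finite S" and "\<And>r. r \<in> S \<Longrightarrow> \<exists>C. \<forall>x \<in> carrier G. h (x \<otimes> r) \<le> C * h x ^ 2"
  obtains C where "\<And>r x. r \<in> S \<Longrightarrow> x \<in> carrier G \<Longrightarrow> h (x \<otimes> r) \<le> C * h x ^ 2"
proof -
  from assms(2) obtain f where f: "\<And>r x. r \<in> S \<Longrightarrow> x \<in> carrier G \<Longrightarrow> h (x \<otimes> r) \<le> f r * h x ^ 2"
    by metis
  show thesis
  proof (rule that[of "sum f S"])
    fix r x assume "r \<in> S" "x \<in> carrier G"
    then have "h (x \<otimes> r) \<le> f r * h x ^ 2" by (rule f)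
    also have "f r \<le> sum f S" using \<open>r \<in> S\<close> assms(1) by (intro member_le_sum) simp_all
    then have "f r * h x ^ 2 \<le> sum f S * h x ^ 2" by (rule mult_le_mono1)
    finally show "h (x \<otimes> r) \<le> sum f S * h x ^ 2" .
  qed
qed

text \<open>Since multiplication by \<open>t\<close> has degree two only, one step of the descent need not lower
  the height; two steps do.\<close>

lemma commensurable_of_cosets:
  fixes h :: "'a \<Rightarrow> nat"
  assumes Q: "Q \<in> carrier G" and t: "gnorm t > 1"
    and fin: "\<And>B. finite {x \<in> carrier G. h x \<le> B}"
    and mult: "\<And>x. x \<in> carrier G \<Longrightarrow> h x ^ 2 \<le> C1 * h (act t x)"
    and shift: "\<And>r. r \<in> carrier G \<Longrightarrow> \<exists>C. \<forall>x \<in> carrier G. h (x \<otimes> r) \<le> C * h x ^ 2"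
    and R: "finite R" "R \<subseteq> carrier G" "\<And>r. r \<in> R \<Longrightarrow> \<exists>c. eqT r (act c Q)"
    and cosets: "\<And>x. x \<in> carrier G \<Longrightarrow> \<exists>r \<in> R. \<exists>y \<in> carrier G. x = r \<otimes> act t y"
  shows "\<exists>N. N \<noteq> 0 \<and> (\<forall>x \<in> carrier G. \<exists>c. eqT (act N x) (act c Q))"
proof -
  define S where "S = (\<lambda>(r, r'). inv (r \<otimes> act t r')) ` (R \<times> R)"
  have "finite S" using R(1) by (simp add: S_def)
  moreover have "S \<subseteq> carrier G" using R(2) by (auto simp: S_def subset_iff)
  ultimately obtain C2 where C2: "\<And>r x. r \<in> S \<Longrightarrow> x \<in> carrier G \<Longrightarrow> h (x \<otimes> r) \<le> C2 * h x ^ 2"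
    using finite_bound[of S h] shift by (metis subsetD)
  \<comment> \<open>\<open>h z^4 <= C1^2 h(t z)^2 <= C1^3 h(t^2 z) <= C1^3 C2 h x^2\<close>, where
    the last step pays for the shift by the coset representatives; taking square roots leaves
    \<open>h z^2 <= C h x\<close>.\<close>
  define C where "C = C1 ^ 3 * C2"
  have "\<exists>c. \<exists>y \<in> carrier G. eqT x (act c Q \<otimes> act (t * t) y) \<and> h y ^ 2 \<le> C * h x"
    if x: "x \<in> carrier G" for x
  proof -
    obtain r y where y: "r \<in> R" "y \<in> carrier G" "x = r \<otimes> act t y" using cosets[OF x] by blast
    obtain r' z where z: "r' \<in> R" "z \<in> carrier G" "y = r' \<otimes> act t z" using cosets[OF y(2)] by blast
    have rC: "r \<in> carrier G" "r' \<in> carrier G" using y z R(2) by auto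
    obtain c c' where cc': "eqT r (act c Q)" "eqT r' (act c' Q)" using R(3) y(1) z(1) by meson
    have x_eq: "x = (r \<otimes> act t r') \<otimes> act (t * t) z"
      using rC z(2) by (simp add: y(3) z(3) act_distrib act_mult m_assoc)
    have "eqT (r \<otimes> act t r') (act c Q \<otimes> act t (act c' Q))"
      using cc' by (intro eqT_mult eqT_act)
    also have "act c Q \<otimes> act t (act c' Q) = act (c + t * c') Q"
      using Q by (simp add: act_add act_mult)
    finally have "eqT x (act (c + t * c') Q \<otimes> act (t * t) z)"
      unfolding x_eq using z(2) by (intro eqT_mult eqT_refl) simp_all
    moreover have "h z ^ 2 \<le> C * h x"
    proof -
      have s: "inv (r \<otimes> act t r') \<in> S" using y(1) z(1) by (auto simp: S_def)
      have "x \<otimes> inv (r \<otimes> act t r') = act (t * t) z"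
        using rC z(2) by (subst x_eq) (simp add: m_comm[of _ "act (t * t) z"] m_assoc)
      then have b: "h (act (t * t) z) \<le> C2 * h x ^ 2" using C2[OF s x] by simp
      have "(h z ^ 2) ^ 2 \<le> (C1 * h (act t z)) ^ 2" using mult[OF z(2)] by (rule power_mono) simp
      also have "\<dots> = C1 ^ 2 * h (act t z) ^ 2" by (rule power_mult_distrib)
      also have "\<dots> \<le> C1 ^ 2 * (C1 * h (act t (act t z)))"
        using mult[of "act t z"] z(2) by (intro mult_le_mono2) simp
      also have "act t (act t z) = act (t * t) z" using z(2) by (simp add: act_mult)
      also have "C1 ^ 2 * (C1 * h (act (t * t) z)) \<le> C1 ^ 2 * (C1 * (C2 * h x ^ 2))"
        using b by (intro mult_le_mono2)
      also have "\<dots> = C * h x ^ 2" by (simp add: C_def eval_nat_numeral)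
      also have "\<dots> \<le> (C * h x) ^ 2"
        unfolding power_mult_distrib by (intro mult_le_mono1) (simp add: power2_eq_square)
      finally show ?thesis by (rule power2_le_imp_le) simp
    qed
    ultimately show ?thesis using z(2) by blast
  qed
  moreover have "gnorm (t * t) > 1" using less_1_mult[OF t t] by (simp add: gnorm_mult)
  ultimately show ?thesis using commensurable_descent[OF Q _ fin] by blast
qed

end

section \<open>Cosets modulo \<open>1 + i\<close> for the given primes\<close>

context curve_primes
begin

text \<open>The classes that remain under the hypothesis \<open>small\<close> of
  \<open>ex_class\<close>. Here \<open>-1\<close> stands for the trivial class, being the square of
  \<open>i\<close>.\<close>

definition good :: "gint \<Rightarrow> bool" where
  "good D \<longleftrightarrow> D = 1 \<or> D = - 1 \<or> q mod 8 \<noteq> 7 \<and> (D = imag * of_nat p \<or> D = - imag * of_nat p)"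

abbreviation Acoeff :: gint where "Acoeff \<equiv> - of_nat (5 * p * q)"

lemma of_nat_mult_dvd_gint: "(of_nat m * of_nat m :: gint) dvd of_nat n \<Longrightarrow> m * m dvd n"
proof -
  assume "(of_nat m * of_nat m :: gint) dvd of_nat n"
  then have "(of_nat (m * m) :: gint) dvd of_nat n" by simp
  then have "int (m * m) dvd int n" unfolding of_nat_dvd_gint_iff by simp
  then show ?thesis by (simp only: of_nat_dvd_iff)
qed

lemma q_ndvd: "\<not> q dvd 20 * p"
proof
  assume "q dvd 20 * p"
  moreover have "\<not> q dvd p" using p(1) q(1) q_facts(6) primes_dvd_imp_eq by blast
  ultimately have "q dvd 2 * 2 * 5" using q(1) by (simp add: prime_dvd_mult_iff)
  then have "q dvd 2 \<or> q dvd 5" using q(1) by (metis prime_dvd_mult_iff)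
  moreover have "prime (2 :: nat)" "prime (5 :: nat)" by simp_all
  ultimately have "q = 2 \<or> q = 5" using q(1) primes_dvd_imp_eq by blast
  then show False using q_facts(3,5) by auto
qed

lemma q2_ndvd: "\<not> q * q dvd 20 * p * q"
  using q_ndvd q_facts(3) by simp

text \<open>\<open>q\<close> divides \<open>5 p q\<close> only once, so it misses \<open>D\<close>
  or \<open>D'\<close>, and the classification applies to that one. The class of
  \<open>5 i p\<close> can occur only when \<open>q\<close> is a residue modulo \<open>p\<close>;
  \<open>small\<close> either excludes this or supplies \<open>q = 7\<close> modulo 8, where the
  2-adic obstruction removes it.\<close>

lemma ex_class:
  assumes small: "Legendre q p = - 1 \<or> q mod 8 = 7"
    and "x \<in> K" "y \<in> K" "x \<noteq> 0" "y ^ 2 = x ^ 3 + cg Acoeff * x"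
  obtains D D' k where "D * D' = Acoeff" "k \<in> K" "k \<noteq> 0" "x = cg D * k ^ 2" "good D \<or> good D'"
proof -
  obtain D D' M e N where D: "D * D' = Acoeff" "M \<noteq> 0" "e \<noteq> 0" "x = cg D * (cg M / cg e) ^ 2"
    "N ^ 2 = D * M ^ 4 + D' * e ^ 4" "coprime M e" "coprime D e"
    using assms(2-5) by (rule square_class_descent)
  have goodI: "good E"
    if E: "E = 1 \<or> E = - 1 \<or> (\<exists>u \<in> {imag, - imag}. \<exists>a. (a = 0 \<and> Legendre q p = - 1 \<or> a = 1 \<and> Legendre q p = 1)
        \<and> E = u * of_nat (p * 5 ^ a))"
      and prod: "E * E' = Acoeff" and sol: "N ^ 2 = E * m ^ 4 + E' * n ^ 4" "coprime m n" for E E' m n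
  proof -
    consider "E = 1 \<or> E = - 1" | u a where "u = imag \<or> u = - imag"
        "a = 0 \<and> Legendre q p = - 1 \<or> a = 1 \<and> Legendre q p = 1" "E = u * of_nat (p * 5 ^ a)"
      using E by blast
    then show ?thesis
    proof cases
      case 2
      have uu: "u * u = - 1" using 2(1) by auto
      have a: "a = 0 \<or> a = 1" using 2(2) by auto
      have "E * (u * of_nat (5 ^ (1 - a) * q)) = (u * u) * of_nat (5 * p * q)"
        using a by (auto simp: 2(3) ac_simps)
      then have "E * (u * of_nat (5 ^ (1 - a) * q)) = E * E'" unfolding prod uu by simp
      moreover have "E \<noteq> 0" using 2 p_facts(4) by auto
      ultimately have E': "E' = u * of_nat (5 ^ (1 - a) * q)" by simp
      have "q mod 8 \<noteq> 7"
      proof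
        assume q8: "q mod 8 = 7"
        have "N ^ 2 = u * of_int (int (p * 5 ^ a)) * m ^ 4 + u * of_int (int (5 ^ (1 - a) * q)) * n ^ 4"
          using sol(1) by (simp only: 2(3) E' of_int_of_nat_eq)
        moreover have "odd (int (p * 5 ^ a))" "odd (int (5 ^ (1 - a) * q))"
          using p_facts(5) q_facts(4) by simp_all
        \<comment> \<open>With \<open>p = 1\<close> and \<open>q = 7\<close> modulo 8 the sum is
          \<open>1 + 35\<close> for \<open>a = 0\<close> and \<open>5 + 7\<close> for
          \<open>a = 1\<close>, which is 4 modulo 8 in both cases.\<close>
        moreover have "(int (p * 5 ^ a) + int (5 ^ (1 - a) * q)) mod 8 = 4"
          using a p_facts(2) q8 by (elim disjE; simp; presburger)
        ultimately show False using no_solution_mod_8 2(1) sol(2) by blast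
      qed
      moreover from this have "a = 0" using small 2(2) by auto
      ultimately show ?thesis using 2(1,3) by (auto simp: good_def)
    qed (auto simp: good_def)
  qed
  have lc: "split_prime.local_cond x y r l D D'"
    if sp: "split_prime x y r l" and nd: "\<not> split_prime.rho x y * split_prime.rho x y dvd D * D'" for x y r l
    using D(5-7) nd by (rule split_prime.local_condI[OF sp])
  \<comment> \<open>For the equation with \<open>D\<close> and \<open>D'\<close> exchanged,
    coprimality of \<open>D'\<close> and \<open>M\<close> is not at hand, so the condition is taken
    over by the symmetry of \<open>local_cond\<close>.\<close>
  have sym: "split_prime.local_cond x y r l D' D"
    if sp: "split_prime x y r l" and nd: "\<not> split_prime.rho x y * split_prime.rho x y dvd D' * D" for x y r l
    using lc[OF sp] nd by (simp add: split_prime.local_cond_def[OF sp] mult.commute)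
  have "\<not> of_nat q dvd D \<or> \<not> of_nat q dvd D'"
  proof (rule ccontr)
    assume "\<not> (\<not> of_nat q dvd D \<or> \<not> of_nat q dvd D')"
    then have "of_nat q * of_nat q dvd D * D'" by (intro mult_dvd_mono) simp_all
    then have "(of_nat q * of_nat q :: gint) dvd of_nat (5 * p * q)" unfolding D(1) by simp
    then have "q * q dvd 5 * p * q" by (rule of_nat_mult_dvd_gint)
    then have "q * q dvd 4 * (5 * p * q)" by (rule dvd_mult)
    then show False using q2_ndvd by (simp add: mult.assoc)
  qed
  then have "good D \<or> good D'"
  proof
    assume "\<not> of_nat q dvd D"
    from descent_classification[OF D(1) this lc] have "good D"
      by (rule goodI) (use D in auto)
    then show ?thesis ..
  next
    assume nd: "\<not> of_nat q dvd D'"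
    have "D' * D = Acoeff" using D(1) by (simp add: mult.commute)
    from descent_classification[OF this nd sym] have "good D'"
      by (rule goodI[where m = e and n = M]) (use D in \<open>auto simp: mult.commute coprime_commute add.commute\<close>)
    then show ?thesis ..
  qed
  then show thesis using that[of D D' "cg M / cg e"] D by simp
qed

definition ee :: nat where "ee = 20 * p * q"

text \<open>\<open>q\<close> is a Gaussian prime that divides \<open>20 p q\<close> exactly
  once.\<close>

lemma d_nonsquare': "k \<in> K \<Longrightarrow> k ^ 2 \<noteq> of_nat ee"
proof
  assume k: "k \<in> K" "k ^ 2 = of_nat ee"
  then have k2: "k ^ 2 = of_nat (20 * p * q)" by (simp only: ee_def)
  then have "k ^ 2 = cg (of_nat (20 * p * q))" by (simp only: cg_of_nat)
  then obtain w where "k = cg w" using K_integrally_closed k(1) by metis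
  then have "cg (w ^ 2) = cg (of_nat (20 * p * q))" using \<open>k ^ 2 = cg _\<close> by (simp only: cg_power)
  then have w: "w ^ 2 = of_nat (20 * p * q)" unfolding cg_eq_iff .
  have "of_nat q dvd w ^ 2" unfolding w of_nat_mult by simp
  then have "of_nat q dvd w" using q_prime_elem prime_elem_dvd_power by blast
  then have "of_nat q * of_nat q dvd w ^ 2" by (simp add: power2_eq_square mult_dvd_mono)
  then show False unfolding w using of_nat_mult_dvd_gint q2_ndvd by blast
qed

sublocale C: gauss_quartic ee
  by unfold_locales (use d_nonsquare' in simp_all)

abbreviation dd :: complex where "dd \<equiv> of_nat ee"

lemma coeffA_eq: "C.coeffA = cg Acoeff"
  unfolding C.coeffA_def unfolding ee_def by simp

definition rot :: "complex \<times> complex \<Rightarrow> complex \<times> complex" where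
  "rot P = (\<i> * fst P, snd P)"

sublocale M: gauss_module C.qgroup rot
proof (intro gauss_module.intro C.comm_group_qgroup gauss_module_axioms.intro)
  show "rot \<in> hom C.qgroup C.qgroup"
    unfolding hom_def
  proof (intro CollectI conjI ballI)
    show "rot \<in> carrier C.qgroup \<rightarrow> carrier C.qgroup" by (auto simp: rot_def C.rot_closed)
    fix P Q :: "complex \<times> complex"
    obtain u1 v1 u2 v2 where PQ: "P = (u1, v1)" "Q = (u2, v2)" by (cases P; cases Q)
    have 1: "c * (\<i> * u1) ^ 2 * (\<i> * u2) ^ 2 = c * u1 ^ 2 * u2 ^ 2" for c
      by (simp add: power_mult_distrib)
    have 2: "c * (\<i> * u1) * (\<i> * u2) * ((\<i> * u1) ^ 2 + (\<i> * u2) ^ 2) = c * u1 * u2 * (u1 ^ 2 + u2 ^ 2)" for c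
      by (simp add: power_mult_distrib algebra_simps)
    show "rot (P \<otimes>\<^bsub>C.qgroup\<^esub> Q) = rot P \<otimes>\<^bsub>C.qgroup\<^esub> rot Q"
      unfolding PQ rot_def C.qgroup_sel qadd.simps fst_conv snd_conv 1 2 by (simp add: algebra_simps)
  qed
  fix P :: "complex \<times> complex" assume P: "P \<in> carrier C.qgroup"
  then obtain u v where uv: "P = (u, v)" "(u, v) \<in> quartic dd" by (cases P) auto
  have "rot (rot P) = (- u, v)" by (simp add: rot_def uv)
  moreover have "inv\<^bsub>C.qgroup\<^esub> P = (- u, v)"
    using C.qadd_neg[OF uv(2)] C.neg_closed[OF uv(2)] uv
    by (intro group.inv_equality comm_group.axioms(2) C.comm_group_qgroup) (simp_all del: qadd.simps)
  ultimately show "rot (rot P) = inv\<^bsub>C.qgroup\<^esub> P" by simp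
qed

definition th :: gint where "th = 1 + imag"

lemma act_th:
  assumes "P \<in> quartic dd"
  shows "M.act th P = C.qtheta P"
proof -
  have P: "P \<in> carrier C.qgroup" using assms by simp
  have "M.act imag P = rot P"
    unfolding M.act_def imag_sel int_pow_0 M.int_pow_1[OF M.rot_closed[OF P]] M.l_one[OF M.rot_closed[OF P]] ..
  then have "M.act th P = qadd dd P (rot P)"
    unfolding th_def M.act_add[OF P] M.act_1[OF P] by simp
  then show ?thesis by (simp add: rot_def C.qtheta_def)
qed

definition tau :: "complex \<times> complex" where "tau = (0, - 1)"

lemma tau_closed [simp]: "tau \<in> quartic dd"
  unfolding tau_def by (rule C.two_torsion_closed)

lemma qadd_tau: "qadd dd P tau = (- fst P, - snd P)"
  by (cases P) (simp add: tau_def)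

lemma tau_tau: "qadd dd (qadd dd P tau) tau = P"
  by (simp add: qadd_tau)

text \<open>Adding \<open>tau\<close> changes the sign of \<open>v\<close>, and
  \<open>4 (1 - v^2) = 16 D D' u^4\<close>. So if \<open>P\<close> has class \<open>D\<close>, then
  \<open>P + tau\<close> has class \<open>D'\<close>, and one of the two is good.\<close>

lemma alpha_class:
  assumes small: "Legendre q p = - 1 \<or> q mod 8 = 7" and P: "P \<in> quartic dd"
  obtains P' D k where "P' = P \<or> P' = qadd dd P tau" "k \<in> K" "k \<noteq> 0" "good D"
    "2 * (1 + snd P') = cg D * k ^ 2"
proof -
  obtain u v where uv: "P = (u, v)" by (cases P)
  note facts = C.quarticD[OF P[unfolded uv]]
  show thesis
  proof (cases "u = 0")
    case True
    then have "v = 1 \<or> v = - 1" using C.quartic_u0 P uv by simp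
    then show thesis
    proof
      assume "v = 1"
      then show thesis by (intro that[of P 2 1]) (simp_all add: uv good_def)
    next
      \<comment> \<open>At \<open>tau\<close> itself \<open>2 (1 + v)\<close> is 0 and defines no
        class; \<open>P + tau\<close> is then the zero point, of class \<open>1\<close>.\<close>
      assume "v = - 1"
      then show thesis by (intro that[of "qadd dd P tau" 2 1]) (simp_all add: uv good_def qadd_tau)
    qed
  next
    case False
    define x where "x = (1 + v) / (2 * u ^ 2)"
    define y where "y = (1 + v) / (2 * u ^ 3)"
    have v: "1 + v \<noteq> 0" using C.quartic_v_ne P uv False by blast
    have "C.of_quartic P \<in> ec_points K C.coeffA 0" using P by (rule C.of_quartic_closed)
    then have xy: "x \<in> K" "y \<in> K" "y ^ 2 = x ^ 3 + cg Acoeff * x"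
      using False unfolding coeffA_eq by (simp_all add: uv ec_points_def x_def y_def)
    have "x \<noteq> 0" using v False by (simp add: x_def)
    then obtain D D' k where D: "D * D' = Acoeff" "k \<in> K" "k \<noteq> 0" "x = cg D * k ^ 2" "good D \<or> good D'"
      using ex_class[OF small xy(1,2) _ xy(3)] by blast
    have "2 * (1 + v) = (2 * u) ^ 2 * x" using False by (simp add: x_def power_mult_distrib)
    then have a: "2 * (1 + v) = cg D * (2 * u * k) ^ 2" unfolding D(4) by (simp add: power_mult_distrib)
    from D(5) show thesis
    proof
      assume "good D"
      then show thesis using a False D facts by (intro that[of P "2 * u * k" D]) (simp_all add: uv)
    next
      assume "good D'"
      have "cg D * cg D' = cg (D * D')" by simp
      also have "\<dots> = - dd / 4" unfolding D(1) ee_def by simp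
      finally have DD: "dd = - (4 * (cg D * cg D'))" by simp
      have "(2 * (1 + v)) * (2 * (1 - v)) = 4 * (1 - v ^ 2)" by (simp add: power2_eq_square algebra_simps)
      also have "\<dots> = 16 * (cg D * cg D') * u ^ 4" unfolding facts(3) DD by simp
      finally have "cg D * (2 * u * k) ^ 2 * (2 * (1 - v)) = cg D * (2 * u * k) ^ 2 * (cg D' * (2 * u / k) ^ 2)"
        unfolding a using D(3) by (simp add: power_mult_distrib power_divide eval_nat_numeral ac_simps)
      moreover have "cg D * (2 * u * k) ^ 2 \<noteq> 0" using a v by (metis mult_eq_0_iff zero_neq_numeral)
      ultimately have "2 * (1 - v) = cg D' * (2 * u / k) ^ 2"
        using mult_left_cancel[of "cg D * (2 * u * k) ^ 2" "2 * (1 - v)" "cg D' * (2 * u / k) ^ 2"] by blast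
      then show thesis
        using False D facts \<open>good D'\<close> by (intro that[of "qadd dd P tau" "2 * u / k" D']) (simp_all add: uv qadd_tau)
    qed
  qed
qed

lemma theta_of_square:
  assumes "P \<in> quartic dd" "2 * (1 + snd P) = s ^ 2" "s \<in> K" "s \<noteq> 0"
  shows "\<exists>R \<in> quartic dd. P = M.act th R"
proof -
  obtain u v where "P = (u, v)" by (cases P)
  then show ?thesis using C.qtheta_surj[of u v s] assms by (metis act_th snd_conv)
qed

lemma theta_of_unit:
  assumes "P \<in> quartic dd" "2 * (1 + snd P) = cg D * k ^ 2" "D = 1 \<or> D = - 1" "k \<in> K" "k \<noteq> 0"
  shows "\<exists>R \<in> quartic dd. P = M.act th R"
proof -
  have "cg D * k ^ 2 = k ^ 2 \<or> cg D * k ^ 2 = (\<i> * k) ^ 2"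
    using assms(3) by (auto simp: power_mult_distrib)
  then show ?thesis
    using theta_of_square[OF assms(1), of k] theta_of_square[OF assms(1), of "\<i> * k"] assms by auto
qed

lemma tau_T: "tau \<in> M.T"
proof (rule M.T_I[where z = 2])
  have "M.act 1 tau = tau" using M.act_1[of tau] by simp
  then have "M.act (1 + 1) tau = qadd dd tau tau" using M.act_add[of tau 1 1] by simp
  also have "\<dots> = (0, 1)" by (simp add: tau_def)
  finally show "M.act 2 tau = \<one>\<^bsub>C.qgroup\<^esub>" by simp
qed simp_all

text \<open>\<open>tau\<close> is torsion, so each of the four coset representatives is 0 or
  \<open>Q\<close> modulo torsion, as the abstract descent requires.\<close>

lemma commensurable:
  assumes Q: "Q \<in> quartic dd"
    and cosets: "\<And>P. P \<in> quartic dd \<Longrightarrow> \<exists>r \<in> {(0, 1), tau, Q, qadd dd Q tau}. \<exists>y \<in> quartic dd. P = qadd dd r (M.act th y)"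
  shows "\<exists>N. N \<noteq> 0 \<and> (\<forall>P \<in> quartic dd. \<exists>c. M.eqT (M.act N P) (M.act c Q))"
proof -
  have tQ: "M.eqT tau (M.act 0 Q)"
    using tau_T M.T_carrier[OF tau_T] by (simp add: M.eqT_def del: C.qgroup_sel)
  have 1: "M.eqT (0, 1) (M.act 0 Q)" using M.eqT_refl[of "(0, 1)"] C.zero_closed by simp
  have Q1: "M.eqT Q (M.act 1 Q)" using Q M.eqT_refl by simp
  have "M.eqT (Q \<otimes>\<^bsub>C.qgroup\<^esub> tau) (M.act 1 Q \<otimes>\<^bsub>C.qgroup\<^esub> M.act 0 Q)" by (rule M.eqT_mult[OF Q1 tQ])
  then have Qt: "M.eqT (qadd dd Q tau) (M.act (1 + 0) Q)" using Q M.act_add[of Q 1 0] by (simp del: qadd.simps)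
  have "\<exists>N. N \<noteq> 0 \<and> (\<forall>x \<in> carrier C.qgroup. \<exists>c. M.eqT (M.act N x) (M.act c Q))"
  proof (rule M.commensurable_of_cosets[where h = C.qh and t = th and R = "{(0, 1), tau, Q, qadd dd Q tau}"])
    show "gnorm th > 1" by (simp add: th_def gnorm_def)
    show "finite {x \<in> carrier C.qgroup. C.qh x \<le> B}" for B using C.finite_qh by simp
    show "C.qh x ^ 2 \<le> (ee ^ 2 + 3 * ee) * C.qh (M.act th x)" if "x \<in> carrier C.qgroup" for x
      using that C.height_qtheta[of x] act_th[of x] by simp
    show "\<exists>C. \<forall>x \<in> carrier C.qgroup. C.qh (x \<otimes>\<^bsub>C.qgroup\<^esub> r) \<le> C * C.qh x ^ 2" if "r \<in> carrier C.qgroup" for r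
      using that C.height_qadd[of r] unfolding C.qgroup_sel by metis
    show "\<exists>c. M.eqT r (M.act c Q)" if "r \<in> {(0, 1), tau, Q, qadd dd Q tau}" for r
      using that tQ 1 Q1 Qt by blast
    show "{(0, 1), tau, Q, qadd dd Q tau} \<subseteq> carrier C.qgroup"
      using Q C.zero_closed C.qadd_closed by simp
  qed (use Q cosets in simp_all)
  then show ?thesis by simp
qed

lemma coset_of_shift:
  assumes "P \<in> quartic dd" "P' = P \<or> P' = qadd dd P tau" "P' = qadd dd r y" "r \<in> quartic dd" "y \<in> quartic dd"
  shows "P = qadd dd r y \<or> P = qadd dd (qadd dd r tau) y"
proof -
  have "qadd dd (qadd dd r tau) y = qadd dd (qadd dd r y) tau"
    using assms(4,5) C.qadd_assoc[of r tau y] C.qadd_assoc[of r y tau] C.qadd_commute[of tau y] by simp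
  then show ?thesis using assms(2,3) tau_tau[of P] by metis
qed

lemma rank_0:
  assumes "q mod 8 = 7"
  shows "has_rank C.qgroup 0"
proof -
  have "\<exists>r \<in> {(0, 1), tau, (0, 1), qadd dd (0, 1) tau}. \<exists>y \<in> quartic dd. P = qadd dd r (M.act th y)"
    if P: "P \<in> quartic dd" for P
  proof -
    obtain P' D k where P': "P' = P \<or> P' = qadd dd P tau" "k \<in> K" "k \<noteq> 0" "good D"
        "2 * (1 + snd P') = cg D * k ^ 2"
      by (rule alpha_class[OF disjI2[OF assms] P])
    have P'C: "P' \<in> quartic dd" using P'(1) P C.qadd_closed tau_closed by blast
    have "D = 1 \<or> D = - 1" using P'(4) assms by (simp add: good_def)
    then obtain R where R: "R \<in> quartic dd" "P' = M.act th R"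
      using theta_of_unit[OF P'C P'(5) _ P'(2,3)] by blast
    have "P' = qadd dd (0, 1) (M.act th R)" using R(2) C.qadd_zero by metis
    moreover have "M.act th R \<in> quartic dd" using M.act_closed[of R th] R(1) by simp
    ultimately have "P = qadd dd (0, 1) (M.act th R) \<or> P = qadd dd (qadd dd (0, 1) tau) (M.act th R)"
      using coset_of_shift[OF P P'(1) _ C.zero_closed] by blast
    then show ?thesis using R(1) by blast
  qed
  then obtain N where N: "N \<noteq> 0" "\<And>P. P \<in> quartic dd \<Longrightarrow> \<exists>c. M.eqT (M.act N P) (M.act c (0, 1))"
    using commensurable[OF C.zero_closed] by blast
  show ?thesis
  proof (rule M.has_rank_0I, rule subsetI)
    fix P assume P: "P \<in> carrier C.qgroup"
    then have "P \<in> quartic dd" by simp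
    then obtain c where "M.eqT (M.act N P) (M.act c (0, 1))" using N(2) by blast
    then have "M.act N P \<in> M.T" using M.eqT_T M.act_one[of c] M.one_T by (metis C.qgroup_sel(3))
    then show "P \<in> M.T" using M.T_act_iff[OF N(1) P] by blast
  qed
qed


text \<open>The kernel of \<open>th\<close> consists of zero and \<open>tau\<close>. Since
  \<open>(2 - v^2) / v^2 = - 1\<close> is impossible, \<open>tau\<close> is not an image under
  \<open>th\<close>, and so the kernel does not grow with the power.\<close>

lemma theta_power_kernel:
  assumes "R \<in> quartic dd" "M.act (th ^ k) R = (0, 1)"
  shows "R = (0, 1) \<or> R = tau"
  using assms
proof (induction k arbitrary: R)
  case 0
  then show ?case using M.act_1[of R] by simp
next
  case (Suc k)
  obtain u v where uv: "R = (u, v)" by (cases R)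
  note v = C.v_nonzero[OF Suc.prems(1)[unfolded uv]]
  have th: "M.act th R = ((1 + \<i>) * u / v, (2 - v ^ 2) / v ^ 2)"
    unfolding act_th[OF Suc.prems(1)] unfolding uv by (rule C.qtheta_eq[OF Suc.prems(1)[unfolded uv]])
  have "M.act (th ^ k) (M.act th R) = M.act (th ^ k * th) R" using M.act_mult[of R] Suc.prems(1) by simp
  also have "\<dots> = (0, 1)" using Suc.prems(2) by (simp add: mult.commute)
  finally have "M.act th R = (0, 1) \<or> M.act th R = tau"
    using Suc.prems(1) M.act_closed[of R th] by (intro Suc.IH) simp_all
  moreover have "M.act th R \<noteq> tau"
  proof
    assume "M.act th R = tau"
    then have "(2 - v ^ 2) / v ^ 2 = - 1" by (simp add: th tau_def)
    then show False using v by (simp add: field_simps)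
  qed
  ultimately have "fst (M.act th R) = 0" by auto
  then have "(1 + \<i>) * u / v = 0" unfolding th by simp
  moreover have "1 + \<i> \<noteq> 0" by (simp add: complex_eq_iff)
  ultimately have "u = 0" using v by simp
  then show ?case using C.quartic_u0[of v] Suc.prems(1) by (auto simp: uv tau_def)
qed

text \<open>Let \<open>n = 2^a m\<close> with \<open>m\<close> odd kill \<open>Q\<close>. As
  \<open>th^2 = 2 i\<close>, the point \<open>R = m Q\<close> is killed by \<open>th^(2 a)\<close>,
  hence is zero or \<open>tau\<close>. As \<open>m = 1 + th c\<close>, \<open>Q\<close> differs from
  \<open>R\<close> by an image under \<open>th\<close>, which \<open>ne\<close> forbids.\<close>

lemma not_torsion:
  assumes Q: "Q \<in> quartic dd"
    and ne: "\<And>r S. r = (0, 1) \<or> r = tau \<Longrightarrow> S \<in> quartic dd \<Longrightarrow> Q \<noteq> qadd dd r (M.act th S)"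
  shows "Q \<notin> M.T"
proof
  assume "Q \<in> M.T"
  have QC: "Q \<in> carrier C.qgroup" using Q by simp
  obtain n :: nat where n: "n > 0" "Q [^]\<^bsub>C.qgroup\<^esub> n = \<one>\<^bsub>C.qgroup\<^esub>"
    using \<open>Q \<in> M.T\<close> unfolding torsion_set_def by blast
  obtain m where "n = m * 2 ^ multiplicity 2 n" "odd m"
    by (rule multiplicity_decompose'[of n 2]) (use n(1) in \<open>auto simp: mult.commute\<close>)
  then obtain a where am: "n = 2 ^ a * m" "odd m" by (metis mult.commute)
  obtain j where j: "m = 2 * j + 1" using am(2) by (elim oddE)
  define R where "R = M.act (of_nat m) Q"
  have RC: "R \<in> carrier C.qgroup" using QC unfolding R_def by (rule M.act_closed)
  have "M.act (2 ^ a) R = M.act (of_nat n) Q"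
    unfolding R_def am(1) M.act_mult[OF QC, symmetric] by simp
  also have "\<dots> = \<one>\<^bsub>C.qgroup\<^esub>" unfolding M.act_of_nat[OF QC] by (rule n(2))
  finally have R2: "M.act (2 ^ a) R = \<one>\<^bsub>C.qgroup\<^esub>" .
  have th2: "th ^ 2 = imag * 2" by (simp add: th_def gint_eq_iff power2_eq_square)
  have "M.act (th ^ (2 * a)) R = M.act (imag ^ a * 2 ^ a) R"
    by (simp only: power_mult th2 power_mult_distrib)
  also have "\<dots> = (0, 1)" unfolding M.act_mult[OF RC] R2 M.act_one by simp
  finally have "R = (0, 1) \<or> R = tau" using RC by (intro theta_power_kernel) simp_all
  moreover define c where "c = (1 - imag) * of_nat j"
  have "of_nat m = 1 + th * c"
  proof -
    have "th * (1 - imag) = 2" by (simp add: th_def gint_eq_iff)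
    then have "th * c = 2 * of_nat j" unfolding c_def by (simp flip: mult.assoc)
    then show ?thesis by (simp add: j)
  qed
  then have "R = Q \<otimes>\<^bsub>C.qgroup\<^esub> M.act th (M.act c Q)"
    unfolding R_def by (simp only: M.act_add[OF QC] M.act_1[OF QC] M.act_mult[OF QC])
  then have "Q = R \<otimes>\<^bsub>C.qgroup\<^esub> M.act th (inv\<^bsub>C.qgroup\<^esub> (M.act c Q))"
    using QC by (simp add: M.act_inv M.m_assoc del: C.qgroup_sel)
  moreover have "inv\<^bsub>C.qgroup\<^esub> (M.act c Q) \<in> quartic dd" using QC M.inv_closed M.act_closed by simp
  ultimately show False using ne by simp
qed

end

text \<open>The equation is the perfect square condition, because
  \<open>40 k + 33 + 5 (40 l + 27) = 8 (5 k + 25 l + 21)\<close>.\<close>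

locale curve_primes_ii = curve_primes +
  fixes m :: int
  assumes m: "int p + 5 * int q = 8 * m ^ 2" and q8: "q mod 8 = 3"
begin

lemma m_nonzero: "m \<noteq> 0"
  using m p_facts(4) by auto

text \<open>Modulo \<open>p\<close>, \<open>5 q\<close> is \<open>2 (2 m)^2\<close>, where 2 is a
  residue and 5 is not; so \<open>q\<close> is a nonresidue.\<close>

lemma Legendre_q_p: "Legendre q p = - 1"
proof -
  have pp: "prime p" "2 < p" using p(1) p_facts(4) by simp_all
  have "[5 * int q = 2 * (2 * m * (2 * m))] (mod p)"
    using m by (simp add: cong_iff_dvd_diff power2_eq_square) (metis add_diff_cancel_right' dvd_minus_iff dvd_refl minus_diff_eq)
  then have "Legendre (5 * int q) p = Legendre (2 * (2 * m * (2 * m))) p" by (rule Legendre_cong)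
  then have *: "- Legendre q p = Legendre (2 * m) p * Legendre (2 * m) p"
    unfolding Legendre_mult[OF pp] Legendre_5_p Legendre_2_p by simp
  moreover have "Legendre q p \<noteq> 0"
  proof -
    have "\<not> p dvd q" using p(1) q(1) q_facts(6) primes_dvd_imp_eq by blast
    then show ?thesis by (simp add: Legendre_def cong_0_iff)
  qed
  ultimately show ?thesis using Legendre_values[of "2 * m" p] by auto
qed

text \<open>The image of the point with \<open>x = - i p\<close> and \<open>u = 1 / N\<close>, where
  \<open>N = - 2 (1 - i) m\<close> solves \<open>N^2 = - i (p M^4 + 5 q e^4)\<close> at
  \<open>M = e = 1\<close>.\<close>

definition base :: "complex \<times> complex" where
  "base = (- (1 + \<i>) / (4 * of_int m), (of_nat p - 5 * of_nat q) / (8 * of_int m ^ 2))"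

lemma m_complex: "of_nat p + 5 * of_nat q = (8 * of_int m ^ 2 :: complex)"
proof -
  have "(of_int (int p + 5 * int q) :: complex) = of_int (8 * m ^ 2)" by (simp only: m)
  then show ?thesis by simp
qed

lemma base_closed: "base \<in> quartic dd"
proof -
  define M P Q :: complex where "M = of_int m" and "P = of_nat p" and "Q = of_nat q"
  have M: "M \<noteq> 0" using m_nonzero by (simp add: M_def)
  have PQ: "P + 5 * Q = 8 * M ^ 2" using m_complex by (simp add: M_def P_def Q_def)
  have i4: "(- (1 + \<i>)) ^ 4 = - 4" by (simp add: eval_nat_numeral algebra_simps)
  have "(P - 5 * Q) ^ 2 = (P + 5 * Q) ^ 2 - 20 * P * Q" by (simp add: power2_eq_square algebra_simps)
  also have "\<dots> = 64 * M ^ 4 - 20 * P * Q" unfolding PQ by (simp add: power_mult_distrib flip: power_mult)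
  finally have sq: "(P - 5 * Q) ^ 2 = 64 * M ^ 4 - 20 * P * Q" .
  have "((P - 5 * Q) / (8 * M ^ 2)) ^ 2 = (64 * M ^ 4 - 20 * P * Q) / (64 * M ^ 4)"
    unfolding power_divide sq by (simp add: power_mult_distrib flip: power_mult)
  also have "\<dots> = 1 + dd * (- (1 + \<i>) / (4 * M)) ^ 4"
    unfolding power_divide power_mult_distrib i4
    using M by (simp add: ee_def P_def Q_def field_simps)
  finally show ?thesis
    unfolding base_def M_def[symmetric] P_def[symmetric] Q_def[symmetric]
    by (intro C.quarticI) (simp_all add: M_def P_def Q_def)
qed

lemma alpha_base: "2 * (1 + snd base) = of_nat p / (2 * of_int m ^ 2)"
proof -
  have "1 + snd base = (8 * of_int m ^ 2 + (of_nat p - 5 * of_nat q)) / (8 * of_int m ^ 2)"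
    using m_nonzero by (simp add: base_def field_simps)
  also have "8 * of_int m ^ 2 + (of_nat p - 5 * of_nat q) = (2 * of_nat p :: complex)"
    unfolding m_complex[symmetric] by simp
  finally show ?thesis using m_nonzero by (simp add: field_simps)
qed

text \<open>\<open>P\<close> and \<open>base\<close> both have the class of \<open>i p\<close>, so
  by multiplicativity their difference \<open>S\<close> has a class represented by \<open>1\<close>
  or \<open>-1\<close> and is an image under \<open>th\<close>.\<close>

lemma shift_by_base:
  assumes P: "P \<in> quartic dd" and k: "k \<in> K" "k \<noteq> 0"
    and D: "D = imag * of_nat p \<or> D = - imag * of_nat p" and a: "2 * (1 + snd P) = cg D * k ^ 2"
  shows "\<exists>r \<in> {base, qadd dd base tau}. \<exists>y \<in> quartic dd. P = qadd dd r (M.act th y)"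
proof -
  obtain u0 v0 where b: "base = (u0, v0)" by (cases base)
  have bC: "(u0, v0) \<in> quartic dd" "(- u0, v0) \<in> quartic dd"
    using base_closed C.neg_closed by (simp_all add: b)
  define S where "S = qadd dd P (- u0, v0)"
  have S: "S \<in> quartic dd" unfolding S_def by (rule C.qadd_closed[OF P bC(2)])
  have PS: "P = qadd dd S (u0, v0)" using C.qadd_cancel[OF P bC(2)] by (simp add: S_def)
  obtain \<kappa> where \<kappa>: "\<kappa> \<in> K" "2 * (1 + snd P) * (2 * (1 + v0)) * (2 * (1 + snd S)) = \<kappa> ^ 2"
    using C.alpha_mult[of "fst P" "snd P" "- u0" v0] P bC(2) by (auto simp: S_def simp del: qadd.simps)
  \<comment> \<open>Chosen so that the product of the two values of \<open>2 (1 + v)\<close> is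
    \<open>g^2\<close> up to sign: by \<open>(1 + i)^2 = 2 i\<close>,
    \<open>g^2 = - i p^2 k^2 / (2 m^2)\<close>.\<close>
  define g where "g = of_nat p * k / ((1 + \<i>) * of_int m)"
  have i0: "1 + \<i> \<noteq> 0" by (simp add: complex_eq_iff)
  have g: "g \<in> K" "g \<noteq> 0" using k m_nonzero p_facts(4) i0 by (simp_all add: g_def)
  have i2: "(1 + \<i>) ^ 2 = 2 * \<i>" by (simp add: power2_eq_square algebra_simps)
  have "2 * (1 + v0) = of_nat p / (2 * of_int m ^ 2)" using alpha_base by (simp add: b)
  then have X: "2 * (1 + snd P) * (2 * (1 + v0)) = cg D * k ^ 2 * (of_nat p / (2 * of_int m ^ 2))"
    unfolding a by simp
  have g2: "g ^ 2 = - (\<i> * of_nat p ^ 2 * k ^ 2 / (2 * of_int m ^ 2))"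
    unfolding g_def power_divide power_mult_distrib i2 using m_nonzero by (simp add: field_simps)
  obtain E where E: "E = 1 \<or> E = - 1" "cg E * g ^ 2 * (2 * (1 + snd S)) = \<kappa> ^ 2"
  proof -
    from D show thesis
    proof
      assume "D = imag * of_nat p"
      then have "2 * (1 + snd P) * (2 * (1 + v0)) = cg (- 1) * g ^ 2"
        unfolding X g2 by (simp add: power2_eq_square)
      then show thesis using that[of "- 1"] \<kappa>(2) by simp
    next
      assume "D = - imag * of_nat p"
      then have "2 * (1 + snd P) * (2 * (1 + v0)) = cg 1 * g ^ 2"
        unfolding X g2 by (simp add: power2_eq_square)
      then show thesis using that[of 1] \<kappa>(2) by simp
    qed
  qed
  have "cg E * cg E = 1" using E(1) by auto
  then have "g ^ 2 * (2 * (1 + snd S)) = cg E * \<kappa> ^ 2"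
    unfolding E(2)[symmetric] by (simp flip: mult.assoc)
  then have aS: "2 * (1 + snd S) = cg E * (\<kappa> / g) ^ 2" using g(2) by (simp add: power_divide field_simps)
  show ?thesis
  proof (cases "\<kappa> = 0")
    case False
    obtain R where "R \<in> quartic dd" "S = M.act th R"
      using theta_of_unit[OF S aS E(1)] False g \<kappa>(1) by auto
    then show ?thesis using PS C.qadd_commute[of S] by (auto simp: b simp del: qadd.simps)
  next
    \<comment> \<open>Here \<open>2 (1 + v)\<close> vanishes at \<open>S\<close>, so
      \<open>S\<close> is \<open>tau\<close>, which has no class and is absorbed into the
      representative.\<close>
    case True
    then have "2 * (1 + snd S) = 0" using aS by simp
    then have "1 + snd S = 0" by (metis mult_eq_0_iff zero_neq_numeral)
    moreover obtain us vs where "S = (us, vs)" by (cases S)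
    ultimately have "S = tau"
      using C.quartic_v_ne[of us vs] S by (auto simp: tau_def add_eq_0_iff)
    then have "P = qadd dd base tau" using PS C.qadd_commute by (simp add: b)
    also have "\<dots> = qadd dd (qadd dd base tau) (M.act th (0, 1))"
      using M.act_one[of th] C.qadd_zero C.qadd_commute by (metis C.qgroup_sel(3))
    finally show ?thesis using C.zero_closed by blast
  qed
qed

lemma cosets_ii:
  assumes P: "P \<in> quartic dd"
  shows "\<exists>r \<in> {(0, 1), tau, base, qadd dd base tau}. \<exists>y \<in> quartic dd. P = qadd dd r (M.act th y)"
proof -
  obtain P' D k where P': "P' = P \<or> P' = qadd dd P tau" "k \<in> K" "k \<noteq> 0" "good D"
      "2 * (1 + snd P') = cg D * k ^ 2"
    by (rule alpha_class[OF disjI1[OF Legendre_q_p] P])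
  have P'C: "P' \<in> quartic dd" using P'(1) P C.qadd_closed tau_closed by blast
  have "\<exists>r \<in> {(0, 1), base, qadd dd base tau}. \<exists>y \<in> quartic dd. P' = qadd dd r (M.act th y)"
  proof (cases "D = 1 \<or> D = - 1")
    case True
    then obtain R where R: "R \<in> quartic dd" "P' = M.act th R"
      using theta_of_unit[OF P'C P'(5) _ P'(2,3)] by blast
    have "P' = qadd dd (0, 1) (M.act th R)" using R(2) C.qadd_zero by metis
    then show ?thesis using R(1) by blast
  next
    case False
    then have "D = imag * of_nat p \<or> D = - imag * of_nat p" using P'(4) by (simp add: good_def)
    then show ?thesis using shift_by_base[OF P'C P'(2,3) _ P'(5)] by blast
  qed
  then obtain r y where ry: "r = (0, 1) \<or> r = base \<or> r = qadd dd base tau" "y \<in> quartic dd"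
      "P' = qadd dd r (M.act th y)" by blast
  have rC: "r \<in> quartic dd" using ry(1) C.zero_closed base_closed C.qadd_closed tau_closed by blast
  have yC: "M.act th y \<in> quartic dd" using M.act_closed[of y th] ry(2) by simp
  have "P = qadd dd r (M.act th y) \<or> P = qadd dd (qadd dd r tau) (M.act th y)"
    by (rule coset_of_shift[OF P P'(1) ry(3) rC yC])
  moreover have "r \<in> {(0, 1), tau, base, qadd dd base tau}" using ry(1) by blast
  moreover have "qadd dd r tau \<in> {(0, 1), tau, base, qadd dd base tau}"
    using ry(1) C.qadd_zero[of tau] tau_tau[of base] by (elim disjE) simp_all
  ultimately show ?thesis using ry(2) by blast
qed

text \<open>At an image under \<open>th\<close>, \<open>2 (1 + v)\<close> is a square. For
  \<open>base\<close> this would make \<open>i p\<close> the square of a Gaussian integer, whose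
  imaginary part is even; for \<open>base + tau\<close> it would make \<open>10 q\<close> a square,
  although the prime \<open>q\<close> divides it only once.\<close>

lemma base_not_torsion: "base \<notin> M.T"
proof (rule not_torsion[OF base_closed])
  fix r S assume r: "r = (0, 1) \<or> r = tau" and S: "S \<in> quartic dd"
  obtain u v where uv: "S = (u, v)" by (cases S)
  note v = C.v_nonzero[OF S[unfolded uv]]
  have vK: "v \<in> K" using C.quarticD(2)[of u v] S uv by simp
  have th: "snd (M.act th S) = (2 - v ^ 2) / v ^ 2"
    unfolding act_th[OF S] unfolding uv C.qtheta_eq[OF S[unfolded uv]] by simp
  have a: "2 * (1 + snd (M.act th S)) = (2 / v) ^ 2"
    unfolding th using v by (simp add: field_simps power2_eq_square)
  have int_square: False if z: "z \<in> K" "z ^ 2 = cg n" and no: "\<And>w. w ^ 2 = n \<Longrightarrow> False" for z n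
  proof -
    obtain w where "z = cg w" using K_integrally_closed z by blast
    then have "cg (w ^ 2) = cg n" using z(2) by (simp only: cg_power)
    then show False using no unfolding cg_eq_iff by blast
  qed
  show "base \<noteq> qadd dd r (M.act th S)"
  proof
    assume eq: "base = qadd dd r (M.act th S)"
    from r show False
    proof
      assume "r = (0, 1)"
      then have "base = M.act th S" using eq C.qadd_zero by simp
      then have "of_nat p / (2 * of_int m ^ 2) = (2 / v) ^ 2" using a alpha_base by simp
      then have "((1 + \<i>) * (2 * of_int m / v)) ^ 2 = \<i> * of_nat p"
        using m_nonzero v by (simp add: field_simps power2_eq_square)
      also have "\<dots> = cg (imag * of_nat p)" by simp
      finally show False
      proof (rule int_square[rotated])
        fix w :: gint assume "w ^ 2 = imag * of_nat p"
        then have "gim (w ^ 2) = int p" by simp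
        then have "2 * (gre w * gim w) = int p" by (simp add: power2_eq_square mult.commute)
        then have "even (int p)" by (metis dvd_triv_left)
        then show False using p_facts(5) by simp
      qed (use vK in simp)
    next
      assume "r = tau"
      then have "qadd dd base tau = M.act th S"
        using eq tau_tau[of "M.act th S"] C.qadd_commute[of tau] by simp
      then have "snd (M.act th S) = - snd base" by (simp add: qadd_tau prod_eq_iff)
      then have "(2 / v) ^ 2 = 2 * (1 - snd base)" using a by simp
      also have "1 - snd base = (8 * of_int m ^ 2 - (of_nat p - 5 * of_nat q)) / (8 * of_int m ^ 2)"
        using m_nonzero by (simp add: base_def diff_divide_distrib)
      also have "8 * of_int m ^ 2 - (of_nat p - 5 * of_nat q) = (10 * of_nat q :: complex)"
        unfolding m_complex[symmetric] by simp
      finally have v2: "(2 / v) ^ 2 = 2 * (10 * of_nat q / (8 * of_int m ^ 2))" .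
      have "(4 * of_int m / v) ^ 2 = 4 * of_int m ^ 2 * (2 / v) ^ 2"
        by (simp add: power_divide power_mult_distrib)
      also have "\<dots> = 10 * of_nat q" unfolding v2 using m_nonzero by simp
      also have "\<dots> = cg (of_nat (10 * q))" by simp
      finally show False
      proof (rule int_square[rotated])
        fix w :: gint assume w: "w ^ 2 = of_nat (10 * q)"
        then have "of_nat q dvd w ^ 2" unfolding w of_nat_mult by simp
        then have "of_nat q dvd w" using q_prime_elem prime_elem_dvd_power by blast
        then have "of_nat q * of_nat q dvd w ^ 2" by (simp add: power2_eq_square mult_dvd_mono)
        then have "q * q dvd 10 * q" unfolding w by (rule of_nat_mult_dvd_gint)
        then have "q dvd 10" using q_facts(3) by simp
        then have "q dvd 10 * (2 * p)" by (rule dvd_mult2)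
        then show False using q_ndvd by simp
      qed (use vK in simp)
    qed
  qed
qed

lemma rank_2: "has_rank C.qgroup 2"
proof -
  obtain N where "N \<noteq> 0" "\<And>P. P \<in> quartic dd \<Longrightarrow> \<exists>c. M.eqT (M.act N P) (M.act c base)"
    using commensurable[OF base_closed cosets_ii] by blast
  then show ?thesis using base_closed base_not_torsion by (intro M.has_rank_2_commensurable) simp_all
qed

end

lemma (in curve_primes) has_rank_E_pq:
  assumes "has_rank C.qgroup r"
  shows "has_rank (E_pq p q) r"
proof -
  have "E_pq p q = ec_group K C.coeffA 0"
    unfolding E_pq_def coeffA_eq by simp
  moreover have "has_rank (ec_group K C.coeffA 0) r"
    using C.group_ec_group comm_group.axioms(2)[OF C.comm_group_qgroup] C.ec_group_iso assms
    by (rule has_rank_iso)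
  ultimately show ?thesis by simp
qed

theorem corollary3p2:
  fixes p q :: nat
  assumes "prime p" and "prime q" and "odd p" and "odd q" and "p \<noteq> q"
  shows "([p = 33] (mod 40) \<and> [q = 7] (mod 40) \<longrightarrow> has_rank (E_pq p q) 0) \<and>
         (\<forall>k l :: int. int p = 40 * k + 33 \<and> int q = 40 * l + 27 \<and>
            (\<exists>m :: int. 5 * k + 25 * l + 21 = m ^ 2) \<longrightarrow> has_rank (E_pq p q) 2)"
proof (intro conjI impI allI)
  assume *: "[p = 33] (mod 40) \<and> [q = 7] (mod 40)"
  then have pq: "p mod 40 = 33" "q mod 40 = 7" by (simp_all add: cong_def)
  have mods: "q mod m = 7 mod m" if "m dvd 40" for m
    by (rule mod_eq_of_mod_eq[OF that pq(2)])
  have "q mod 20 = 7" using mods[of 20] by simp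
  with assms(1,2) pq(1) interpret curve_primes p q by unfold_locales
  have "q mod 8 = 7" using mods[of 8] by simp
  then show "has_rank (E_pq p q) 0" by (intro has_rank_E_pq rank_0)
next
  fix k l :: int
  assume *: "int p = 40 * k + 33 \<and> int q = 40 * l + 27 \<and> (\<exists>m :: int. 5 * k + 25 * l + 21 = m ^ 2)"
  then obtain m where m: "5 * k + 25 * l + 21 = m ^ 2" by blast
  have kl: "int p = 40 * k + 33" "int q = 40 * l + 27" using * by simp_all
  have "int (p mod 40) = 33" "int (q mod 40) = 27" unfolding zmod_int kl by simp_all
  then have "p mod 40 = 33" and q: "q mod 40 = 27" by linarith+
  moreover have "q mod 20 = 7" "q mod 8 = 3"
    using mod_eq_of_mod_eq[OF _ q, of 20] mod_eq_of_mod_eq[OF _ q, of 8] by simp_all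
  moreover have "int p + 5 * int q = 8 * m ^ 2" using kl by (simp flip: m)
  ultimately interpret curve_primes_ii p q m
    by (intro curve_primes_ii.intro curve_primes.intro curve_primes_ii_axioms.intro assms(1,2))
  show "has_rank (E_pq p q) 2" using rank_2 by (rule has_rank_E_pq)
qed

end
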